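(* Let $R$ be a non-discrete irreducible, continuous ring, and let $E$ be a maximal nest in $R$. Consider the topological group $1+\mathrm{Lev}\,R_E\le\mathrm{GL}(R_E)$, equipped with the topology generated by the restriction of the rank metric $d_R$. Then $$\ell(1+\mathrm{Lev}\,R_E,d_R)=0 .$$ In particular, $1+\mathrm{Lev}\,R_E$ is extremely amenable.
   Context: A unital ring $R$ is (von Neumann) regular if for every $a\in R$ there is $b\in R$ with $aba=a$. For such $R$, the set $\mathrm{L}(R)=\{aR\mid a\in R\}$ ordered by inclusion is a complemented modular lattice. A continuous ring is a regular ring $R$ such that $\mathrm{L}(R)$ is a continuous geometry, i.e., additionally a complete lattice such that for every chain $C\subseteq \mathrm{L}(R)$ and every $x\in\mathrm{L}(R)$ one has $x\wedge\bigvee C=\bigvee\{x\wedge y\mid y\in C\}$ and $x\vee\bigwedge C=\bigwedge\{x\vee y\mid y\in C\}$. A ring is irreducible if it is non-zero and not isomorphic to a direct product of two non-zero rings. A rank function on a regular ring $R$ is a map $\rho\colon R\to[0,1]$ with $\rho(1)=1$, $\rho(ab)\le\min\{\rho(a),\rho(b)\}$ for all $a,b\in R$, $\rho(e+f)=\rho(e)+\rho(f)$ for all idempotents $e,f$ with $ef=fe=0$, and $\rho(a)>0$ for $a\ne0$. Every irreducible, continuous ring $R$ has a unique rank function $\rho_R$ (von Neumann), and $d_R(a,b):=\rho_R(a-b)$ is a complete metric on $R$; $R$ is non-discrete if the topology generated by $d_R$ is not discrete. $\mathrm{GL}(R)$ is the group of units of $R$; $d_R$ restricts to a bi-invariant metric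 on it, making it a topological group. $\mathrm{E}(R)$ is the set of idempotents of $R$, ordered by $e\le f:\Leftrightarrow ef=fe=e$. A nest in $R$ is a chain in $(\mathrm{E}(R),\le)$; a maximal nest is a nest that is maximal with respect to inclusion. For a nest $E$, $R_E:=\{a\in R\mid eae=ae\text{ for all }e\in E\}$, a unital subring of $R$, and $\mathrm{GL}(R_E)$ is its unit group. Levitzki radical. A ring $N$ is nilpotent if for some $k\ge1$ all products of $k$ elements of $N$ vanish; it is locally nilpotent if each of its finitely generated (not necessarily unital) subrings is nilpotent. For a unital ring $T$, $\mathrm{Lev}\,T$ is the sum of all locally nilpotent two-sided ideals of $T$; it is itself a locally nilpotent two-sided ideal, and $1+\mathrm{Lev}\,T$ is a subgroup of $\mathrm{GL}(T)$. Amenable length. A topological group is amenable if every (jointly) continuous action of it on a non-empty compact Hausdorff space admits an invariant regular Borel probability measure, and extremely amenable if every such action has a fixed point. For a topological group $G$ and a bounded, continuous, right-invariant pseudo-metric $d$ on $G$, $\ell(G,d)\in[0,\infty]$ is the infimum, over all $n\in\mathbb{N}$ and all chains $\{e\}=G_0\le\dots\le G_n=G$ of subgroups that are amenable in the relative topology, of $$\Bigl(\sum_{i=0}^{n-1}\bigl(\sup_{g\in G}\operatorname{diam}(G_{i+1}/G_i,d_i^g)\bigr)^2\Bigr)^{1/2},\qquad d_i^g(xG_i,yG_i):=\inf_{h\in G_i}d(gx,gyh).$$ In the claim $d_R$ stands for its restriction to $1+\mathrm{Lev}\,R_E$. *)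

theory Defs
  imports "HOL-Algebra.Complete_Lattice" "HOL-Algebra.Generated_Groups"
    "HOL-Algebra.Chinese_Remainder" "HOL-Algebra.Group_Action" "HOL-Probability.Probability"
begin

section \<open>Continuous rings\<close>

text \<open>
  Rings are those of HOL-Algebra: unital, associative, not necessarily commutative.
\<close>

definition regular_ring :: "('a, 'm) ring_scheme \<Rightarrow> bool" where
  "regular_ring R \<longleftrightarrow> ring R \<and>
     (\<forall>a\<in>carrier R. \<exists>b\<in>carrier R. a \<otimes>\<^bsub>R\<^esub> b \<otimes>\<^bsub>R\<^esub> a = a)"

definition principal_right_ideal :: "('a, 'm) ring_scheme \<Rightarrow> 'a \<Rightarrow> 'a set" where
  "principal_right_ideal R a = {a \<otimes>\<^bsub>R\<^esub> x | x. x \<in> carrier R}"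

definition right_ideal_lattice :: "('a, 'm) ring_scheme \<Rightarrow> 'a set gorder" where
  "right_ideal_lattice R =
     \<lparr>carrier = principal_right_ideal R ` carrier R, eq = (=), le = (\<subseteq>)\<rparr>"

definition chain_in :: "('a, 'm) gorder_scheme \<Rightarrow> 'a set \<Rightarrow> bool" where
  "chain_in L C \<longleftrightarrow> C \<subseteq> carrier L \<and> (\<forall>x\<in>C. \<forall>y\<in>C. x \<sqsubseteq>\<^bsub>L\<^esub> y \<or> y \<sqsubseteq>\<^bsub>L\<^esub> x)"

definition modular_lattice :: "('a, 'm) gorder_scheme \<Rightarrow> bool" where
  "modular_lattice L \<longleftrightarrow> lattice L \<and>
     (\<forall>x\<in>carrier L. \<forall>y\<in>carrier L. \<forall>z\<in>carrier L. x \<sqsubseteq>\<^bsub>L\<^esub> z \<longrightarrow>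
        x \<squnion>\<^bsub>L\<^esub> (y \<sqinter>\<^bsub>L\<^esub> z) = (x \<squnion>\<^bsub>L\<^esub> y) \<sqinter>\<^bsub>L\<^esub> z)"

definition complemented_lattice :: "('a, 'm) gorder_scheme \<Rightarrow> bool" where
  "complemented_lattice L \<longleftrightarrow> bounded_lattice L \<and>
     (\<forall>x\<in>carrier L. \<exists>y\<in>carrier L. x \<sqinter>\<^bsub>L\<^esub> y = \<bottom>\<^bsub>L\<^esub> \<and> x \<squnion>\<^bsub>L\<^esub> y = \<top>\<^bsub>L\<^esub>)"

definition continuous_geometry :: "('a, 'm) gorder_scheme \<Rightarrow> bool" where
  "continuous_geometry L \<longleftrightarrow>
     complete_lattice L \<and> modular_lattice L \<and> complemented_lattice L \<and>
     (\<forall>C x. chain_in L C \<longrightarrow> x \<in> carrier L \<longrightarrow>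
        x \<sqinter>\<^bsub>L\<^esub> \<Squnion>\<^bsub>L\<^esub>C = \<Squnion>\<^bsub>L\<^esub>((\<lambda>y. x \<sqinter>\<^bsub>L\<^esub> y) ` C) \<and>
        x \<squnion>\<^bsub>L\<^esub> \<Sqinter>\<^bsub>L\<^esub>C = \<Sqinter>\<^bsub>L\<^esub>((\<lambda>y. x \<squnion>\<^bsub>L\<^esub> y) ` C))"

definition continuous_ring :: "('a, 'm) ring_scheme \<Rightarrow> bool" where
  "continuous_ring R \<longleftrightarrow> regular_ring R \<and> continuous_geometry (right_ideal_lattice R)"

text \<open>
  Letting the two factors range over rings with elements in the type of \<open>R\<close> is no restriction:
  if \<open>R\<close> is isomorphic to a product of two rings (over any types), the factors are isomorphic to
  the rings \<open>eR\<close> and \<open>(1 - e)R\<close> for a central idempotent \<open>e\<close> of \<open>R\<close>.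
\<close>

definition irreducible_ring :: "('a, 'm) ring_scheme \<Rightarrow> bool" where
  "irreducible_ring R \<longleftrightarrow> carrier R \<noteq> {\<zero>\<^bsub>R\<^esub>} \<and>
     \<not> (\<exists>(S :: 'a ring) (T :: 'a ring). ring S \<and> ring T \<and>
          carrier S \<noteq> {\<zero>\<^bsub>S\<^esub>} \<and> carrier T \<noteq> {\<zero>\<^bsub>T\<^esub>} \<and> R \<simeq> RDirProd S T)"

definition idempotents :: "('a, 'm) ring_scheme \<Rightarrow> 'a set" where
  "idempotents R = {e \<in> carrier R. e \<otimes>\<^bsub>R\<^esub> e = e}"

text \<open>
  On an irreducible continuous ring \<open>R\<close> there is exactly one rank function up to values outside
  the carrier (von Neumann); a variable \<open>\<rho>\<close> with \<open>rank_function R \<rho>\<close> thus denotes \<open>\<rho>\<^sub>R\<close>.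
\<close>

definition rank_function :: "('a, 'm) ring_scheme \<Rightarrow> ('a \<Rightarrow> real) \<Rightarrow> bool" where
  "rank_function R \<rho> \<longleftrightarrow>
     \<rho> \<in> carrier R \<rightarrow> {0..1} \<and>
     \<rho> \<one>\<^bsub>R\<^esub> = 1 \<and>
     (\<forall>a\<in>carrier R. \<forall>b\<in>carrier R. \<rho> (a \<otimes>\<^bsub>R\<^esub> b) \<le> min (\<rho> a) (\<rho> b)) \<and>
     (\<forall>e\<in>idempotents R. \<forall>f\<in>idempotents R.
        e \<otimes>\<^bsub>R\<^esub> f = \<zero>\<^bsub>R\<^esub> \<longrightarrow> f \<otimes>\<^bsub>R\<^esub> e = \<zero>\<^bsub>R\<^esub> \<longrightarrow> \<rho> (e \<oplus>\<^bsub>R\<^esub> f) = \<rho> e + \<rho> f) \<and>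
     (\<forall>a\<in>carrier R. a \<noteq> \<zero>\<^bsub>R\<^esub> \<longrightarrow> \<rho> a > 0)"

text \<open>
  The locale \<open>Metric_space\<close> demands non-negativity and symmetry on the whole type, hence the
  value \<open>0\<close> outside the carrier.
\<close>

definition rank_metric :: "('a, 'm) ring_scheme \<Rightarrow> ('a \<Rightarrow> real) \<Rightarrow> 'a \<Rightarrow> 'a \<Rightarrow> real" where
  "rank_metric R \<rho> a b =
     (if a \<in> carrier R \<and> b \<in> carrier R then \<rho> (a \<ominus>\<^bsub>R\<^esub> b) else 0)"

definition rank_topology_on :: "('a, 'm) ring_scheme \<Rightarrow> ('a \<Rightarrow> real) \<Rightarrow> 'a set \<Rightarrow> 'a topology" where
  "rank_topology_on R \<rho> A = Metric_space.mtopology A (rank_metric R \<rho>)"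

definition non_discrete_ring :: "('a, 'm) ring_scheme \<Rightarrow> ('a \<Rightarrow> real) \<Rightarrow> bool" where
  "non_discrete_ring R \<rho> \<longleftrightarrow>
     rank_topology_on R \<rho> (carrier R) \<noteq> discrete_topology (carrier R)"


section \<open>Nests\<close>

definition idem_le :: "('a, 'm) ring_scheme \<Rightarrow> 'a \<Rightarrow> 'a \<Rightarrow> bool" where
  "idem_le R e f \<longleftrightarrow> e \<otimes>\<^bsub>R\<^esub> f = e \<and> f \<otimes>\<^bsub>R\<^esub> e = e"

definition nest :: "('a, 'm) ring_scheme \<Rightarrow> 'a set \<Rightarrow> bool" where
  "nest R E \<longleftrightarrow> E \<subseteq> idempotents R \<and> (\<forall>e\<in>E. \<forall>f\<in>E. idem_le R e f \<or> idem_le R f e)"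

definition maximal_nest :: "('a, 'm) ring_scheme \<Rightarrow> 'a set \<Rightarrow> bool" where
  "maximal_nest R E \<longleftrightarrow> nest R E \<and> (\<forall>E'. nest R E' \<longrightarrow> E \<subseteq> E' \<longrightarrow> E' = E)"

definition nest_ring :: "('a, 'm) ring_scheme \<Rightarrow> 'a set \<Rightarrow> ('a, 'm) ring_scheme" where
  "nest_ring R E = R\<lparr>carrier :=
     {a \<in> carrier R. \<forall>e\<in>E. e \<otimes>\<^bsub>R\<^esub> a \<otimes>\<^bsub>R\<^esub> e = a \<otimes>\<^bsub>R\<^esub> e}\<rparr>"


section \<open>The Levitzki radical\<close>

definition nonunital_subring :: "('a, 'm) ring_scheme \<Rightarrow> 'a set \<Rightarrow> bool" where
  "nonunital_subring T S \<longleftrightarrow> additive_subgroup S T \<and> (\<forall>x\<in>S. \<forall>y\<in>S. x \<otimes>\<^bsub>T\<^esub> y \<in> S)"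

definition generated_nonunital_subring :: "('a, 'm) ring_scheme \<Rightarrow> 'a set \<Rightarrow> 'a set" where
  "generated_nonunital_subring T F = \<Inter>{S. nonunital_subring T S \<and> F \<subseteq> S}"

definition nilpotent_subring :: "('a, 'm) ring_scheme \<Rightarrow> 'a set \<Rightarrow> bool" where
  "nilpotent_subring T N \<longleftrightarrow> (\<exists>k\<ge>1. \<forall>xs. length xs = k \<longrightarrow> set xs \<subseteq> N \<longrightarrow>
     foldr (\<lambda>x y. x \<otimes>\<^bsub>T\<^esub> y) xs \<one>\<^bsub>T\<^esub> = \<zero>\<^bsub>T\<^esub>)"

definition locally_nilpotent :: "('a, 'm) ring_scheme \<Rightarrow> 'a set \<Rightarrow> bool" where
  "locally_nilpotent T N \<longleftrightarrow>
     (\<forall>F. finite F \<longrightarrow> F \<subseteq> N \<longrightarrow> nilpotent_subring T (generated_nonunital_subring T F))"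

text \<open>A sum of ideals is the additive subgroup generated by their union.\<close>

definition levitzki_radical :: "('a, 'm) ring_scheme \<Rightarrow> 'a set" where
  "levitzki_radical T = generate (add_monoid T) (\<Union>{I. ideal I T \<and> locally_nilpotent T I})"

definition one_plus_levitzki :: "('a, 'm) ring_scheme \<Rightarrow> 'a monoid" where
  "one_plus_levitzki T =
     (units_of T)\<lparr>carrier := (\<lambda>a. \<one>\<^bsub>T\<^esub> \<oplus>\<^bsub>T\<^esub> a) ` levitzki_radical T\<rparr>"


section \<open>Amenability and extreme amenability\<close>

definition topological_group :: "('a, 'm) monoid_scheme \<Rightarrow> 'a topology \<Rightarrow> bool" where
  "topological_group G \<tau> \<longleftrightarrow> group G \<and> topspace \<tau> = carrier G \<and>
     continuous_map (prod_topology \<tau> \<tau>) \<tau> (\<lambda>(x, y). x \<otimes>\<^bsub>G\<^esub> y) \<and>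
     continuous_map \<tau> \<tau> (\<lambda>x. inv\<^bsub>G\<^esub> x)"

definition compact_action ::
    "('a, 'm) monoid_scheme \<Rightarrow> 'a topology \<Rightarrow> 'x topology \<Rightarrow> ('a \<Rightarrow> 'x \<Rightarrow> 'x) \<Rightarrow> bool" where
  "compact_action G \<tau> X \<alpha> \<longleftrightarrow>
     compact_space X \<and> Hausdorff_space X \<and> topspace X \<noteq> {} \<and>
     group_action G (topspace X) \<alpha> \<and>
     continuous_map (prod_topology \<tau> X) X (\<lambda>(g, x). \<alpha> g x)"

definition borel_of :: "'x topology \<Rightarrow> 'x measure" where
  "borel_of X = sigma (topspace X) {U. openin X U}"

definition regular_borel_prob :: "'x topology \<Rightarrow> 'x measure \<Rightarrow> bool" where
  "regular_borel_prob X \<mu> \<longleftrightarrow> prob_space \<mu> \<and> sets \<mu> = sets (borel_of X) \<and>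
     (\<forall>A\<in>sets \<mu>.
        emeasure \<mu> A = (INF U\<in>{U. openin X U \<and> A \<subseteq> U}. emeasure \<mu> U) \<and>
        emeasure \<mu> A = (SUP K\<in>{K. compactin X K \<and> K \<subseteq> A}. emeasure \<mu> K))"

text \<open>
  A formula of HOL cannot quantify over all types, so the type of the points of the compact
  spaces is an explicit argument. For the notion without size restriction, either leave this type
  as a free type variable of a theorem, or take it to be \<open>'a set set\<close>, where \<open>'a\<close> is the type of
  the group elements: the latter type is large enough by \<open>amenable_all_types\<close> below.
\<close>

definition amenable :: "'x itself \<Rightarrow> ('a, 'm) monoid_scheme \<Rightarrow> 'a topology \<Rightarrow> bool" where
  "amenable (_ :: 'x itself) G \<tau> \<longleftrightarrow> topological_group G \<tau> \<and>
     (\<forall>(X :: 'x topology) \<alpha>. compact_action G \<tau> X \<alpha> \<longrightarrow>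
        (\<exists>\<mu>. regular_borel_prob X \<mu> \<and> (\<forall>g\<in>carrier G. distr \<mu> \<mu> (\<alpha> g) = \<mu>)))"

definition extremely_amenable :: "'x itself \<Rightarrow> ('a, 'm) monoid_scheme \<Rightarrow> 'a topology \<Rightarrow> bool" where
  "extremely_amenable (_ :: 'x itself) G \<tau> \<longleftrightarrow> topological_group G \<tau> \<and>
     (\<forall>(X :: 'x topology) \<alpha>. compact_action G \<tau> X \<alpha> \<longrightarrow>
        (\<exists>x\<in>topspace X. \<forall>g\<in>carrier G. \<alpha> g x = x))"

lemma space_borel_of [simp]: "space (borel_of M) = topspace M"
  unfolding borel_of_def by (rule space_measure_of) (auto dest: openin_subset)

lemma sets_borel_of: "sets (borel_of M) = sigma_sets (topspace M) {U. openin M U}"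
  unfolding borel_of_def by (rule sets_measure_of) (auto dest: openin_subset)

lemma openin_borel_of: "openin M U \<Longrightarrow> U \<in> sets (borel_of M)"
  by (auto simp: sets_borel_of)

lemma compactin_borel_of:
  assumes "Hausdorff_space M" "compactin M K"
  shows "K \<in> sets (borel_of M)"
proof -
  have c: "closedin M K"
    using assms compactin_imp_closedin by blast
  then have "topspace M - K \<in> sets (borel_of M)"
    by (auto intro: openin_borel_of)
  then have "space (borel_of M) - (topspace M - K) \<in> sets (borel_of M)"
    by (rule sets.compl_sets)
  moreover have "space (borel_of M) - (topspace M - K) = K"
    using closedin_subset[OF c] by auto
  ultimately show ?thesis by simp
qed

lemma continuous_map_borel_of:
  assumes "continuous_map M N f"
  shows "f \<in> measurable (borel_of M) (borel_of N)"
  unfolding borel_of_def[of N]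
proof (rule measurable_measure_of)
  show "{U. openin N U} \<subseteq> Pow (topspace N)"
    by (auto dest: openin_subset)
  show "f \<in> space (borel_of M) \<rightarrow> topspace N"
    using continuous_map_image_subset_topspace[OF assms] by auto
  fix U assume "U \<in> {U. openin N U}"
  then have "openin M {x \<in> topspace M. f x \<in> U}"
    using assms by (auto simp: continuous_map_def)
  moreover have "f -` U \<inter> space (borel_of M) = {x \<in> topspace M. f x \<in> U}"
    by auto
  ultimately show "f -` U \<inter> space (borel_of M) \<in> sets (borel_of M)"
    by (auto intro: openin_borel_of)
qed

text \<open>
  Every action on a compact Hausdorff space restricts to the closure of the orbit of a point \<open>x0\<close>,
  and a point of that closure is determined by the sets \<open>A\<close> of group elements for which it lies in
  the closure of \<open>{\<alpha> g x0 | g \<in> A}\<close>.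
\<close>

lemma amenable_all_types:
  fixes G :: "('a, 'm) monoid_scheme"
  assumes am: "amenable TYPE('a set set) G \<tau>"
  shows "amenable TYPE('x) G \<tau>"
  unfolding amenable_def
proof (intro conjI allI impI)
  show tg: "topological_group G \<tau>"
    using am by (simp add: amenable_def)
  fix M :: "'x topology" and \<alpha>
  assume ca: "compact_action G \<tau> M \<alpha>"
  have grp: "group G" and top\<tau>: "topspace \<tau> = carrier G"
    using tg by (auto simp: topological_group_def)
  have cM: "compact_space M" and hM: "Hausdorff_space M" and neM: "topspace M \<noteq> {}"
    and act: "group_action G (topspace M) \<alpha>"
    and cont: "continuous_map (prod_topology \<tau> M) M (\<lambda>(g, x). \<alpha> g x)"
    using ca by (auto simp: compact_action_def)
  interpret group G by (rule grp)
  interpret group_action G "topspace M" \<alpha> by (rule act)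
  have cont1: "continuous_map M M (\<alpha> g)" if "g \<in> carrier G" for g
  proof -
    have "continuous_map M (prod_topology \<tau> M) (\<lambda>x. (g, x))"
      using that top\<tau> by (simp add: continuous_map_pairedI)
    from continuous_map_compose[OF this cont] show ?thesis
      by (simp add: comp_def)
  qed
  have a1: "\<alpha> \<one>\<^bsub>G\<^esub> x = x" if "x \<in> topspace M" for x
    using id_eq_one that by (metis restrict_apply')
  have am': "\<alpha> (g \<otimes>\<^bsub>G\<^esub> h) x = \<alpha> g (\<alpha> h x)"
    if "x \<in> topspace M" "g \<in> carrier G" "h \<in> carrier G" for g h x
    using composition_rule that by blast
  obtain x0 where x0: "x0 \<in> topspace M" using neM by blast
  define p where "p = (\<lambda>g. \<alpha> g x0)"
  define Y where "Y = M closure_of (p ` carrier G)"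
  define j where "j x = {A. A \<subseteq> carrier G \<and> x \<in> M closure_of (p ` A)}" for x
  have YM: "Y \<subseteq> topspace M" by (simp add: Y_def closure_of_subset_topspace)
  have clY: "closedin M Y" by (simp add: Y_def)
  have pM: "p g \<in> topspace M" if "g \<in> carrier G" for g
    using that x0 element_image unfolding p_def by blast
  have neY: "Y \<noteq> {}"
  proof -
    have "p \<one>\<^bsub>G\<^esub> \<in> Y"
      unfolding Y_def using closure_of_subset[of "p ` carrier G" M] pM by auto
    then show ?thesis by auto
  qed
  have inj: "inj_on j Y"
  proof (rule inj_onI, rule ccontr)
    fix x y assume x: "x \<in> Y" and y: "y \<in> Y" and eq: "j x = j y" and "x \<noteq> y"
    then obtain U V where UV: "openin M U" "openin M V" "x \<in> U" "y \<in> V" "disjnt U V"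
      using hM YM unfolding Hausdorff_space_def by (meson subsetD)
    define A where "A = {g \<in> carrier G. p g \<in> U}"
    have "x \<in> M closure_of (p ` A)"
      unfolding in_closure_of
    proof (intro conjI allI impI)
      show "x \<in> topspace M" using x YM by auto
      fix W assume "x \<in> W \<and> openin M W"
      then have "openin M (W \<inter> U)" "x \<in> W \<inter> U" using UV by auto
      then obtain z where "z \<in> p ` carrier G" "z \<in> W \<inter> U"
        using x unfolding Y_def in_closure_of by blast
      then show "\<exists>y. y \<in> p ` A \<and> y \<in> W" by (auto simp: A_def)
    qed
    then have "A \<in> j x" by (auto simp: j_def A_def)
    then have "y \<in> M closure_of (p ` A)" using eq by (auto simp: j_def)
    then obtain z where "z \<in> p ` A" "z \<in> V"
      using UV unfolding in_closure_of by blast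
    then show False using UV(5) by (auto simp: A_def disjnt_def)
  qed
  define Z0 where "Z0 = j ` Y"
  define k where "k = inv_into Y j"
  have kY: "k z \<in> Y" if "z \<in> Z0" for z
    using that unfolding k_def Z0_def by (rule inv_into_into)
  have jk: "j (k z) = z" if "z \<in> Z0" for z
    using that unfolding k_def Z0_def by (rule f_inv_into_f)
  have kj: "k (j y) = y" if "y \<in> Y" for y
    using that inj unfolding k_def by simp
  have jZ: "j y \<in> Z0" if "y \<in> Y" for y
    using that by (simp add: Z0_def)
  define Z where "Z = pullback_topology Z0 k (subtopology M Y)"
  have topY: "topspace (subtopology M Y) = Y"
    using YM by auto
  have topZ: "topspace Z = Z0"
    unfolding Z_def topspace_pullback_topology topY using kY by auto
  have ck: "continuous_map Z (subtopology M Y) k"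
    using continuous_map_pullback[OF continuous_map_id, of Z0 k "subtopology M Y"]
    by (simp add: Z_def)
  have ckM: "continuous_map Z M k"
    using ck continuous_map_in_subtopology by blast
  have cj: "continuous_map (subtopology M Y) Z j"
    unfolding Z_def
  proof (rule continuous_map_pullback')
    show "continuous_map (subtopology M Y) (subtopology M Y) (k \<circ> j)"
      by (rule continuous_map_eq[OF continuous_map_id]) (simp add: kj topY)
    show "topspace (subtopology M Y) \<subseteq> j -` Z0"
      using jZ topY by auto
  qed
  have hom: "subtopology M Y homeomorphic_space Z"
    unfolding homeomorphic_space_def homeomorphic_maps_def topY topZ
    by (intro exI[of _ j] exI[of _ k] conjI ballI cj ck kj jk)
  have cZ: "compact_space Z"
  proof -
    have "compactin M Y" using cM clY by (rule closedin_compact_space)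
    then have "compact_space (subtopology M Y)" by (simp add: compact_space_subtopology)
    then show ?thesis using homeomorphic_compact_space[OF hom] by simp
  qed
  have hZ: "Hausdorff_space Z"
    using homeomorphic_Hausdorff_space[OF hom] hM Hausdorff_space_subtopology by blast
  have invY: "\<alpha> g y \<in> Y" if g: "g \<in> carrier G" and y: "y \<in> Y" for g y
  proof -
    have "\<alpha> g ` p ` carrier G \<subseteq> p ` carrier G"
    proof (rule, elim imageE)
      fix a b h assume "a = \<alpha> g b" "b = p h" "h \<in> carrier G"
      then have "a = p (g \<otimes>\<^bsub>G\<^esub> h)" using am'[OF x0 g] by (simp add: p_def)
      then show "a \<in> p ` carrier G" using g \<open>h \<in> carrier G\<close> by blast
    qed
    then have "M closure_of (\<alpha> g ` p ` carrier G) \<subseteq> Y"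
      unfolding Y_def by (rule closure_of_mono)
    moreover have "\<alpha> g ` Y \<subseteq> M closure_of (\<alpha> g ` p ` carrier G)"
      unfolding Y_def by (rule continuous_map_image_closure_subset[OF cont1[OF g]])
    ultimately show ?thesis using y by blast
  qed
  define \<beta> where "\<beta> g = restrict (\<lambda>z. j (\<alpha> g (k z))) Z0" for g
  have \<beta>Z: "\<beta> g z \<in> Z0" if "g \<in> carrier G" "z \<in> Z0" for g z
    using that invY kY jZ by (simp add: \<beta>_def)
  have k\<beta>: "k (\<beta> g z) = \<alpha> g (k z)" if "g \<in> carrier G" "z \<in> Z0" for g z
    using that invY kY kj by (simp add: \<beta>_def)
  have \<beta>m: "\<beta> (g \<otimes>\<^bsub>G\<^esub> h) z = \<beta> g (\<beta> h z)"
    if "g \<in> carrier G" "h \<in> carrier G" "z \<in> Z0" for g h z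
  proof -
    have "\<beta> g (\<beta> h z) = j (\<alpha> g (\<alpha> h (k z)))"
      using that by (simp add: \<beta>_def[of g] \<beta>Z k\<beta>)
    also have "\<dots> = j (\<alpha> (g \<otimes>\<^bsub>G\<^esub> h) (k z))"
      using am'[of "k z" g h] that kY[of z] YM by (simp add: subset_iff)
    finally show ?thesis using that by (simp add: \<beta>_def)
  qed
  have \<beta>1: "\<beta> \<one>\<^bsub>G\<^esub> z = z" if "z \<in> Z0" for z
    using that a1[of "k z"] kY[of z] YM jk[of z] by (simp add: \<beta>_def subset_iff)
  have \<beta>B: "\<beta> g \<in> Bij Z0" if g: "g \<in> carrier G" for g
  proof -
    have "bij_betw (\<beta> g) Z0 Z0"
    proof (rule bij_betw_byWitness[where f' = "\<beta> (inv\<^bsub>G\<^esub> g)"])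
      show "\<forall>a\<in>Z0. \<beta> (inv\<^bsub>G\<^esub> g) (\<beta> g a) = a"
        using g \<beta>m[of "inv\<^bsub>G\<^esub> g" g] \<beta>1 by (metis inv_closed l_inv)
      show "\<forall>a\<in>Z0. \<beta> g (\<beta> (inv\<^bsub>G\<^esub> g) a) = a"
        using g \<beta>m[of g "inv\<^bsub>G\<^esub> g"] \<beta>1 by (metis inv_closed r_inv)
    qed (use g \<beta>Z in auto)
    moreover have "\<beta> g \<in> extensional Z0" by (simp add: \<beta>_def)
    ultimately show ?thesis by (simp add: Bij_def)
  qed
  have "group_action G Z0 \<beta>"
    unfolding group_action_def group_hom_def group_hom_axioms_def
  proof (intro conjI grp group_BijGroup homI)
    fix g assume "g \<in> carrier G"
    then show "\<beta> g \<in> carrier (BijGroup Z0)" using \<beta>B by (simp add: BijGroup_def)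
  next
    fix g h assume gh: "g \<in> carrier G" "h \<in> carrier G"
    have "\<beta> (g \<otimes>\<^bsub>G\<^esub> h) = compose Z0 (\<beta> g) (\<beta> h)"
    proof (rule extensionalityI[of _ Z0])
      show "\<beta> (g \<otimes>\<^bsub>G\<^esub> h) \<in> extensional Z0" by (simp add: \<beta>_def)
    qed (use gh \<beta>m in \<open>auto simp: compose_def\<close>)
    then show "\<beta> (g \<otimes>\<^bsub>G\<^esub> h) = \<beta> g \<otimes>\<^bsub>BijGroup Z0\<^esub> \<beta> h"
      using gh \<beta>B by (simp add: BijGroup_def)
  qed
  moreover have "continuous_map (prod_topology \<tau> Z) Z (\<lambda>(g, z). \<beta> g z)"
  proof -
    have "continuous_map (prod_topology \<tau> Z) (prod_topology \<tau> M) (\<lambda>w. (fst w, k (snd w)))"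
      by (intro continuous_map_pairedI continuous_map_fst
          continuous_map_compose[OF continuous_map_snd ckM, unfolded comp_def])
    from continuous_map_compose[OF this cont]
    have c: "continuous_map (prod_topology \<tau> Z) M (\<lambda>w. \<alpha> (fst w) (k (snd w)))"
      by (simp add: comp_def)
    have "continuous_map (prod_topology \<tau> Z) M (k \<circ> (\<lambda>(g, z). \<beta> g z))"
      by (rule continuous_map_eq[OF c]) (auto simp: k\<beta> top\<tau> topZ)
    then have "continuous_map (prod_topology \<tau> Z) (subtopology M Y) (k \<circ> (\<lambda>(g, z). \<beta> g z))"
      using kY \<beta>Z by (auto simp: continuous_map_in_subtopology top\<tau> topZ)
    then have "continuous_map (prod_topology \<tau> Z) (pullback_topology Z0 k (subtopology M Y))
        (\<lambda>(g, z). \<beta> g z)"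
      by (rule continuous_map_pullback') (use topZ top\<tau> \<beta>Z in auto)
    then show ?thesis by (simp only: Z_def)
  qed
  ultimately have "compact_action G \<tau> Z \<beta>"
    using cZ hZ neY by (simp add: compact_action_def topZ) (simp add: Z0_def)
  then obtain \<mu> where \<mu>: "regular_borel_prob Z \<mu>"
    and \<mu>inv: "\<And>g. g \<in> carrier G \<Longrightarrow> distr \<mu> \<mu> (\<beta> g) = \<mu>"
    using am unfolding amenable_def by blast
  have sets\<mu>: "sets \<mu> = sets (borel_of Z)" and prob\<mu>: "prob_space \<mu>"
    using \<mu> by (auto simp: regular_borel_prob_def)
  have space\<mu>: "space \<mu> = Z0"
    using sets_eq_imp_space_eq[OF sets\<mu>] topZ by simp
  have km: "k \<in> measurable \<mu> (borel_of M)"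
    using continuous_map_borel_of[OF ckM] measurable_cong_sets[OF sets\<mu> refl] by blast
  define \<nu> where "\<nu> = distr \<mu> (borel_of M) k"
  have \<nu>: "emeasure \<nu> A = emeasure \<mu> (k -` A \<inter> Z0)" if "A \<in> sets (borel_of M)" for A
    using emeasure_distr[OF km that] by (simp add: \<nu>_def space\<mu>)
  have sets\<nu>: "sets \<nu> = sets (borel_of M)" by (simp add: \<nu>_def)
  have "regular_borel_prob M \<nu>"
    unfolding regular_borel_prob_def sets\<nu>
  proof (intro conjI ballI refl)
    show "prob_space \<nu>"
      unfolding \<nu>_def using prob\<mu> km by (rule prob_space.prob_space_distr)
    fix A assume A: "A \<in> sets (borel_of M)"
    let ?B = "k -` A \<inter> Z0"
    have B: "?B \<in> sets \<mu>" using measurable_sets[OF km A] by (simp add: space\<mu>)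
    have out: "emeasure \<mu> ?B = (INF U\<in>{U. openin Z U \<and> ?B \<subseteq> U}. emeasure \<mu> U)"
      and inn: "emeasure \<mu> ?B = (SUP K\<in>{K. compactin Z K \<and> K \<subseteq> ?B}. emeasure \<mu> K)"
      using \<mu> B unfolding regular_borel_prob_def by blast+
    show "emeasure \<nu> A = (INF U\<in>{U. openin M U \<and> A \<subseteq> U}. emeasure \<nu> U)"
    proof (rule antisym)
      show "emeasure \<nu> A \<le> (INF U\<in>{U. openin M U \<and> A \<subseteq> U}. emeasure \<nu> U)"
        by (intro INF_greatest emeasure_mono) (auto simp: sets\<nu> openin_borel_of)
      show "(INF U\<in>{U. openin M U \<and> A \<subseteq> U}. emeasure \<nu> U) \<le> emeasure \<nu> A"
        unfolding \<nu>[OF A] out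
      proof (rule INF_mono)
        fix V assume "V \<in> {U. openin Z U \<and> ?B \<subseteq> U}"
        then have oV: "openin Z V" and BV: "?B \<subseteq> V" by auto
        then obtain U where U: "openin M U" "V = k -` (U \<inter> Y) \<inter> Z0"
          unfolding Z_def openin_pullback_topology openin_subtopology by auto
        define U' where "U' = U \<union> (topspace M - Y)"
        have oU': "openin M U'" using U clY by (auto simp: U'_def)
        have "A \<subseteq> topspace M" using sets.sets_into_space[OF A] by simp
        have "A \<subseteq> U'"
        proof
          fix a assume a: "a \<in> A"
          show "a \<in> U'"
          proof (cases "a \<in> Y")
            case True
            then have "j a \<in> ?B" using a kj jZ by simp
            then have "j a \<in> V" using BV by blast
            then show ?thesis using U True kj by (simp add: U'_def)
          qed (use a \<open>A \<subseteq> topspace M\<close> in \<open>auto simp: U'_def\<close>)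
        qed
        moreover have "k -` U' \<inter> Z0 = V"
          using U kY by (auto simp: U'_def)
        then have "emeasure \<nu> U' = emeasure \<mu> V"
          using \<nu>[OF openin_borel_of[OF oU']] by simp
        ultimately show "\<exists>W\<in>{U. openin M U \<and> A \<subseteq> U}. emeasure \<nu> W \<le> emeasure \<mu> V"
          using oU' by auto
      qed
    qed
    show "emeasure \<nu> A = (SUP K\<in>{K. compactin M K \<and> K \<subseteq> A}. emeasure \<nu> K)"
    proof (rule antisym)
      show "(SUP K\<in>{K. compactin M K \<and> K \<subseteq> A}. emeasure \<nu> K) \<le> emeasure \<nu> A"
        by (intro SUP_least emeasure_mono) (auto simp: sets\<nu> A)
      show "emeasure \<nu> A \<le> (SUP K\<in>{K. compactin M K \<and> K \<subseteq> A}. emeasure \<nu> K)"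
        unfolding \<nu>[OF A] inn
      proof (rule SUP_mono)
        fix K assume "K \<in> {K. compactin Z K \<and> K \<subseteq> ?B}"
        then have K: "compactin Z K" "K \<subseteq> ?B" by auto
        have cK: "compactin M (k ` K)" using K(1) ckM by (rule image_compactin)
        have "k -` (k ` K) \<inter> Z0 = K"
        proof
          show "k -` (k ` K) \<inter> Z0 \<subseteq> K"
          proof
            fix z assume "z \<in> k -` (k ` K) \<inter> Z0"
            then obtain w where "w \<in> K" "k z = k w" "z \<in> Z0" by auto
            then have "z = w" using jk K(2) by (metis IntD2 subsetD)
            then show "z \<in> K" using \<open>w \<in> K\<close> by simp
          qed
        qed (use K(2) in auto)
        then have "emeasure \<nu> (k ` K) = emeasure \<mu> K"
          using \<nu>[OF compactin_borel_of[OF hM cK]] by simp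
        then show "\<exists>L\<in>{K. compactin M K \<and> K \<subseteq> A}. emeasure \<mu> K \<le> emeasure \<nu> L"
          using cK K(2) by (intro bexI[of _ "k ` K"]) auto
      qed
    qed
  qed
  moreover have "distr \<nu> \<nu> (\<alpha> g) = \<nu>" if g: "g \<in> carrier G" for g
  proof (rule measure_eqI)
    have \<alpha>m: "\<alpha> g \<in> measurable (borel_of M) (borel_of M)"
      by (rule continuous_map_borel_of[OF cont1[OF g]])
    have \<alpha>m': "\<alpha> g \<in> measurable \<nu> \<nu>"
      using \<alpha>m measurable_cong_sets[OF sets\<nu> sets\<nu>] by blast
    have "continuous_map Z M (\<lambda>z. \<alpha> g (k z))"
      using continuous_map_compose[OF ckM cont1[OF g]] by (simp add: comp_def)
    then have "continuous_map Z M (k \<circ> \<beta> g)"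
      by (rule continuous_map_eq) (simp add: k\<beta> g topZ)
    then have "continuous_map Z (subtopology M Y) (k \<circ> \<beta> g)"
      using kY \<beta>Z g by (auto simp: continuous_map_in_subtopology topZ)
    then have "continuous_map Z (pullback_topology Z0 k (subtopology M Y)) (\<beta> g)"
      by (rule continuous_map_pullback') (use topZ \<beta>Z g in auto)
    then have "continuous_map Z Z (\<beta> g)" by (simp only: Z_def)
    then have \<beta>meas: "\<beta> g \<in> measurable \<mu> \<mu>"
      using continuous_map_borel_of measurable_cong_sets[OF sets\<mu> sets\<mu>] by blast
    fix A assume "A \<in> sets (distr \<nu> \<nu> (\<alpha> g))"
    then have A: "A \<in> sets (borel_of M)" by (simp add: sets\<nu>)
    have gA: "\<alpha> g -` A \<inter> topspace M \<in> sets (borel_of M)"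
      using measurable_sets[OF \<alpha>m A] by simp
    have B: "k -` A \<inter> Z0 \<in> sets \<mu>" using measurable_sets[OF km A] by (simp add: space\<mu>)
    have "space \<nu> = topspace M" by (simp add: \<nu>_def)
    then have "emeasure (distr \<nu> \<nu> (\<alpha> g)) A = emeasure \<nu> (\<alpha> g -` A \<inter> topspace M)"
      using emeasure_distr[OF \<alpha>m'] A sets\<nu> by simp
    also have "\<dots> = emeasure \<mu> (k -` (\<alpha> g -` A \<inter> topspace M) \<inter> Z0)"
      by (rule \<nu>[OF gA])
    also have "k -` (\<alpha> g -` A \<inter> topspace M) \<inter> Z0 = \<beta> g -` (k -` A \<inter> Z0) \<inter> Z0"
      using g k\<beta> \<beta>Z subsetD[OF YM kY] by auto
    also have "emeasure \<mu> \<dots> = emeasure (distr \<mu> \<mu> (\<beta> g)) (k -` A \<inter> Z0)"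
      using emeasure_distr[OF \<beta>meas B] by (simp add: space\<mu>)
    also have "\<dots> = emeasure \<nu> A"
      using \<mu>inv[OF g] \<nu>[OF A] by simp
    finally show "emeasure (distr \<nu> \<nu> (\<alpha> g)) A = emeasure \<nu> A" .
  qed simp
  ultimately show "\<exists>\<mu>. regular_borel_prob M \<mu> \<and> (\<forall>g\<in>carrier G. distr \<mu> \<mu> (\<alpha> g) = \<mu>)"
    by blast
qed


section \<open>Amenable length\<close>

definition amenable_chain ::
    "('a, 'm) monoid_scheme \<Rightarrow> 'a topology \<Rightarrow> nat \<Rightarrow> (nat \<Rightarrow> 'a set) \<Rightarrow> bool" where
  "amenable_chain G \<tau> n K \<longleftrightarrow>
     K 0 = {\<one>\<^bsub>G\<^esub>} \<and> K n = carrier G \<and>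
     (\<forall>i<n. K i \<subseteq> K (Suc i)) \<and>
     (\<forall>i\<le>n. subgroup (K i) G \<and>
        amenable TYPE('a set set) (G\<lparr>carrier := K i\<rparr>) (subtopology \<tau> (K i)))"

text \<open>
  Cosets \<open>xH\<close>, \<open>yH\<close> are given by representatives; by right-invariance of \<open>d\<close> the value does not
  depend on them. All suprema and infima are real ones, over bounded
  non-empty sets since \<open>d\<close> is a bounded pseudo-metric.
\<close>

definition coset_dist ::
    "('a, 'm) monoid_scheme \<Rightarrow> ('a \<Rightarrow> 'a \<Rightarrow> real) \<Rightarrow> 'a set \<Rightarrow> 'a \<Rightarrow> 'a \<Rightarrow> 'a \<Rightarrow> real" where
  "coset_dist G d H g x y = (INF h\<in>H. d (g \<otimes>\<^bsub>G\<^esub> x) (g \<otimes>\<^bsub>G\<^esub> y \<otimes>\<^bsub>G\<^esub> h))"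

definition quotient_diam ::
    "('a, 'm) monoid_scheme \<Rightarrow> ('a \<Rightarrow> 'a \<Rightarrow> real) \<Rightarrow> 'a set \<Rightarrow> 'a set \<Rightarrow> 'a \<Rightarrow> real" where
  "quotient_diam G d H' H g = (SUP (x, y)\<in>H' \<times> H'. coset_dist G d H g x y)"

definition chain_length ::
    "('a, 'm) monoid_scheme \<Rightarrow> ('a \<Rightarrow> 'a \<Rightarrow> real) \<Rightarrow> nat \<Rightarrow> (nat \<Rightarrow> 'a set) \<Rightarrow> real" where
  "chain_length G d n K =
     sqrt (\<Sum>i<n. (SUP g\<in>carrier G. quotient_diam G d (K (Suc i)) (K i) g)\<^sup>2)"

text \<open>
  Meant for a topological group \<open>(G, \<tau>)\<close> and a bounded, continuous, right-invariant pseudo-metric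
  \<open>d\<close> on \<open>G\<close>. The infimum of the empty set is \<open>\<infinity>\<close>.
\<close>

definition amenable_length ::
    "('a, 'm) monoid_scheme \<Rightarrow> 'a topology \<Rightarrow> ('a \<Rightarrow> 'a \<Rightarrow> real) \<Rightarrow> ennreal" where
  "amenable_length G \<tau> d =
     Inf {ennreal (chain_length G d n K) | n K. amenable_chain G \<tau> n K}"

end

(*
  The group 1 + Lev R_E is filtered by the subgroups G_e = 1 + {a in Lev R_E | ae = a} (e in E).
  For e <= f, right multiplication by e moves an element of G_f into G_e, at distance at most
  rank f - rank e.  The rank maps a maximal nest E onto [0, 1]: sups and infs of subsets of E are
  computed in the continuous geometry, the rank is continuous along them by a comparability
  argument, and a gap of E would yield a minimal idempotent and thus a discrete ring.  Hence each
  G_e has, for every N, a chain of length N whose steps have diameter at most 1/N.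

  Each G_e has an invariant mean as a discrete group, because a finitely generated subring of
  Lev R_E is nilpotent.  Averaging a Lipschitz function successively over the subgroups of the chain
  bounds its variance by a multiple of N (1/N)^2 = 1/N, so the function is almost constant on some
  translate of any given finite set, which yields a common fixed point in every compact action.
  So each G_e is extremely amenable, in particular amenable (by Dirac measures), and the chains
  show that the amenable length vanishes.
*)

theory Submission
  imports Defs "HOL-Algebra.Subrings"
begin

section \<open>Principal right ideals of a regular ring\<close>

text \<open>The main difficulty is the continuity of the rank along a nest. The rank function is
  given only by finite additivity on orthogonal idempotents, so a supremum could a priori have
  larger rank than the limit of the ranks. Such a jump is excluded by size: a tail of the nest has
  smaller rank than a fixed difference \<open>u\<close> of two earlier members and embeds in
  \<open>u R\<close> step by step. The embeddings converge in the continuous geometry, so the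
  supremum of the tail has rank at most that of \<open>u\<close>, which can be chosen below the
  jump. The embeddings exist because irreducibility makes the ring prime. An idempotent is a pair of
  complementary right ideals that move in opposite directions along a nest; hence both chain
  conditions of a continuous geometry are used.

  Means are finitely additive and ignore the topology, so averaging requires no compact groups. The
  metric enters through Lipschitz functions: right-invariance keeps their constants under averaging,
  and left-invariance bounds the increments by the steps of the chain.\<close>

locale von_neumann_regular = ring +
  assumes quasi_inverse: "a \<in> carrier R \<Longrightarrow> \<exists>b\<in>carrier R. a \<otimes> b \<otimes> a = a"
begin

abbreviation pr :: "'a \<Rightarrow> 'a set" where "pr \<equiv> principal_right_ideal R"

abbreviation PR :: "'a set set" where "PR \<equiv> pr ` carrier R"

lemma mem_pr: "x \<in> pr a \<longleftrightarrow> (\<exists>y\<in>carrier R. x = a \<otimes> y)"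
  unfolding principal_right_ideal_def by blast

lemma PR_carrier: "A \<in> PR \<Longrightarrow> A \<subseteq> carrier R"
  by (auto simp: mem_pr)

lemma PR_mem_carrier: "A \<in> PR \<Longrightarrow> x \<in> A \<Longrightarrow> x \<in> carrier R"
  using PR_carrier by blast

lemma add_compl: "e \<in> carrier R \<Longrightarrow> e \<oplus> (\<one> \<ominus> e) = \<one>"
  using a_lcomm[of e "\<one>" "\<ominus> e"] by (simp add: minus_eq r_neg)

lemma minus_eq_zero_iff: "a \<in> carrier R \<Longrightarrow> b \<in> carrier R \<Longrightarrow> a \<ominus> b = \<zero> \<longleftrightarrow> a = b"
  using minus_equality[of a "\<ominus> b"] by (auto simp: minus_eq r_neg)

lemma mult_compl:
  assumes "e \<in> carrier R" "x \<in> carrier R"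
  shows "(\<one> \<ominus> e) \<otimes> x = x \<ominus> e \<otimes> x" "x \<otimes> (\<one> \<ominus> e) = x \<ominus> x \<otimes> e"
  using assms by (simp_all add: minus_eq l_distr l_minus r_distr r_minus)

lemma PR_zero: "A \<in> PR \<Longrightarrow> \<zero> \<in> A"
  by (auto simp: mem_pr intro!: bexI[of _ \<zero>])

lemma PR_add: assumes "A \<in> PR" "x \<in> A" "y \<in> A" shows "x \<oplus> y \<in> A"
proof -
  obtain a where a: "a \<in> carrier R" "A = pr a" using assms by auto
  with assms obtain u v where "u \<in> carrier R" "x = a \<otimes> u" "v \<in> carrier R" "y = a \<otimes> v"
    by (auto simp: mem_pr)
  then have "x \<oplus> y = a \<otimes> (u \<oplus> v)" using a by (simp add: r_distr)
  then show ?thesis using a \<open>u \<in> carrier R\<close> \<open>v \<in> carrier R\<close> by (auto simp: mem_pr)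
qed

lemma PR_rmult: assumes "A \<in> PR" "x \<in> A" "y \<in> carrier R" shows "x \<otimes> y \<in> A"
proof -
  obtain a where a: "a \<in> carrier R" "A = pr a" using assms by auto
  with assms obtain u where "u \<in> carrier R" "x = a \<otimes> u" by (auto simp: mem_pr)
  then have "x \<otimes> y = a \<otimes> (u \<otimes> y)" using a assms by (simp add: m_assoc)
  then show ?thesis using a \<open>u \<in> carrier R\<close> assms by (auto simp: mem_pr)
qed

lemma PR_neg: assumes "A \<in> PR" "x \<in> A" shows "\<ominus> x \<in> A"
  using PR_rmult[OF assms, of "\<ominus> \<one>"] PR_mem_carrier[OF assms] by (simp add: r_minus)

lemma PR_minus: assumes "A \<in> PR" "x \<in> A" "y \<in> A" shows "x \<ominus> y \<in> A"
  unfolding minus_eq using assms by (intro PR_add PR_neg)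

lemma mem_pr_self: "a \<in> carrier R \<Longrightarrow> a \<in> pr a"
  by (auto simp: mem_pr intro!: bexI[of _ \<one>])

lemma pr_subset_iff: assumes "b \<in> carrier R" "A \<in> PR" shows "pr b \<subseteq> A \<longleftrightarrow> b \<in> A"
proof
  show "b \<in> A \<Longrightarrow> pr b \<subseteq> A"
    using PR_rmult[OF assms(2)] assms(1) by (auto simp: mem_pr)
qed (use mem_pr_self[OF assms(1)] in blast)

lemma pr_zero: "pr \<zero> = {\<zero>}"
  using mem_pr_self[OF zero_closed] by (auto simp: mem_pr)

lemma zero_PR: "{\<zero>} \<in> PR"
  using pr_zero zero_closed by blast

lemma carrier_PR: "carrier R \<in> PR"
  by (rule image_eqI[of _ _ \<one>]) (auto simp: mem_pr)

lemma mem_pr_idem: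
  assumes "e \<in> idempotents R" shows "x \<in> pr e \<longleftrightarrow> x \<in> carrier R \<and> e \<otimes> x = x"
proof
  have c: "e \<in> carrier R" "e \<otimes> e = e" using assms by (auto simp: idempotents_def)
  show "x \<in> pr e \<Longrightarrow> x \<in> carrier R \<and> e \<otimes> x = x"
    using c by (auto simp: mem_pr m_assoc[symmetric])
  show "x \<in> carrier R \<and> e \<otimes> x = x \<Longrightarrow> x \<in> pr e"
    by (auto simp: mem_pr intro: bexI[of _ x])
qed

lemma idempotentsD: "e \<in> idempotents R \<Longrightarrow> e \<in> carrier R" "e \<in> idempotents R \<Longrightarrow> e \<otimes> e = e"
  by (auto simp: idempotents_def)

text \<open>For a quasi-inverse \<open>b\<close> of \<open>a\<close>, the element
  \<open>a \<otimes> b\<close> is idempotent, and \<open>a\<close> and \<open>a \<otimes> b\<close>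
  are right multiples of each other.\<close>

lemma PR_idem:
  assumes "A \<in> PR" obtains e where "e \<in> idempotents R" "A = pr e"
proof -
  obtain a where a: "a \<in> carrier R" "A = pr a" using assms by auto
  obtain b where b: "b \<in> carrier R" "a \<otimes> b \<otimes> a = a" using quasi_inverse a by blast
  have i: "a \<otimes> b \<in> idempotents R"
    using a b by (simp add: idempotents_def m_assoc[symmetric])
  have "pr a = pr (a \<otimes> b)"
  proof
    show "pr a \<subseteq> pr (a \<otimes> b)"
      using a b i by (subst pr_subset_iff) (auto simp: mem_pr_idem)
    show "pr (a \<otimes> b) \<subseteq> pr a"
      using a b by (subst pr_subset_iff) (auto simp: mem_pr)
  qed
  then show thesis using that i a by blast
qed

lemma idem_compl:
  assumes "e \<in> idempotents R" shows "\<one> \<ominus> e \<in> idempotents R" "e \<otimes> (\<one> \<ominus> e) = \<zero>" "(\<one> \<ominus> e) \<otimes> e = \<zero>"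
proof -
  have c: "e \<in> carrier R" "e \<otimes> e = e" using assms by (auto simp: idempotents_def)
  show 1: "e \<otimes> (\<one> \<ominus> e) = \<zero>" "(\<one> \<ominus> e) \<otimes> e = \<zero>"
    using c by (simp_all add: minus_eq r_distr l_distr r_minus l_minus r_neg)
  have "(\<one> \<ominus> e) \<otimes> (\<one> \<ominus> e) = \<one> \<ominus> e"
    using c 1 by (simp add: minus_eq l_distr l_minus)
  then show "\<one> \<ominus> e \<in> idempotents R" using c by (simp add: idempotents_def)
qed

lemma mem_pr_compl:
  assumes "e \<in> idempotents R" shows "x \<in> pr (\<one> \<ominus> e) \<longleftrightarrow> x \<in> carrier R \<and> e \<otimes> x = \<zero>"
proof -
  have c: "e \<in> carrier R" using assms by (auto simp: idempotents_def)
  have "x \<in> carrier R \<Longrightarrow> (\<one> \<ominus> e) \<otimes> x = x \<longleftrightarrow> e \<otimes> x = \<zero>"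
    using c by (simp add: minus_eq l_distr l_minus add.inv_eq_1_iff)
  then show ?thesis by (auto simp: mem_pr_idem[OF idem_compl(1)[OF assms]])
qed

text \<open>With a quasi-inverse \<open>b\<close>, the idempotent \<open>b \<otimes> a\<close>
  annihilates the same elements as \<open>a\<close>, so the annihilator is generated by the
  complement of \<open>b \<otimes> a\<close>.\<close>

lemma annihilator_PR:
  assumes "a \<in> carrier R" shows "{x \<in> carrier R. a \<otimes> x = \<zero>} \<in> PR"
proof -
  obtain b where b: "b \<in> carrier R" "a \<otimes> b \<otimes> a = a" using quasi_inverse assms by blast
  have e: "b \<otimes> a \<in> idempotents R"
    using assms b m_assoc[of b a "b \<otimes> a"] m_assoc[of a b a] by (simp add: idempotents_def)
  have "a \<otimes> x = \<zero> \<longleftrightarrow> b \<otimes> a \<otimes> x = \<zero>" if "x \<in> carrier R" for x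
  proof
    assume "b \<otimes> a \<otimes> x = \<zero>"
    then have "a \<otimes> (b \<otimes> a \<otimes> x) = \<zero>" using assms by simp
    then show "a \<otimes> x = \<zero>" using assms b that by (simp add: m_assoc[symmetric])
  qed (use assms b that in \<open>simp add: m_assoc\<close>)
  then have "{x \<in> carrier R. a \<otimes> x = \<zero>} = pr (\<one> \<ominus> b \<otimes> a)"
    using mem_pr_compl[OF e] by auto
  moreover have "\<one> \<ominus> b \<otimes> a \<in> carrier R" using assms b by simp
  ultimately show ?thesis by blast
qed

section \<open>Sums of principal right ideals\<close>

lemma mem_set_add: "x \<in> A <+>\<^bsub>R\<^esub> B \<longleftrightarrow> (\<exists>a\<in>A. \<exists>b\<in>B. x = a \<oplus> b)"
  by (auto simp: set_add_def')

lemma set_add_upper: assumes "A \<in> PR" "B \<in> PR" shows "A \<subseteq> A <+>\<^bsub>R\<^esub> B" "B \<subseteq> A <+>\<^bsub>R\<^esub> B"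
proof -
  show "A \<subseteq> A <+>\<^bsub>R\<^esub> B"
    using PR_zero[OF assms(2)] PR_mem_carrier[OF assms(1)] by (force simp: mem_set_add)
  show "B \<subseteq> A <+>\<^bsub>R\<^esub> B"
    using PR_zero[OF assms(1)] PR_mem_carrier[OF assms(2)] by (force simp: mem_set_add)
qed

lemma set_add_least: "C \<in> PR \<Longrightarrow> A \<subseteq> C \<Longrightarrow> B \<subseteq> C \<Longrightarrow> A <+>\<^bsub>R\<^esub> B \<subseteq> C"
  using PR_add by (auto simp: mem_set_add) blast

lemma set_add_mono: "A \<subseteq> A' \<Longrightarrow> B \<subseteq> B' \<Longrightarrow> A <+>\<^bsub>R\<^esub> B \<subseteq> A' <+>\<^bsub>R\<^esub> B'"
  by (auto simp: mem_set_add) blast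

text \<open>Modulo \<open>e R\<close> only the component
  \<open>(\<one> \<ominus> e) \<otimes> b\<close> of \<open>b\<close> counts, and its right ideal is
  independent of \<open>e R\<close>. The orthogonal idempotent \<open>f\<close> later turns
  additivity of the rank on idempotents into additivity on right ideals.\<close>

lemma set_add_idem:
  assumes e: "e \<in> idempotents R" and b: "b \<in> carrier R"
  obtains f where "f \<in> idempotents R" "e \<otimes> f = \<zero>" "f \<otimes> e = \<zero>" "pr f = pr ((\<one> \<ominus> e) \<otimes> b)"
    "e \<oplus> f \<in> idempotents R" "pr e <+>\<^bsub>R\<^esub> pr b = pr (e \<oplus> f)"
proof -
  have c: "e \<in> carrier R" "e \<otimes> e = e" using e by (auto simp: idempotents_def)
  define e' where "e' = \<one> \<ominus> e"
  have e'c: "e' \<in> carrier R" and e'i: "e' \<otimes> e' = e'" and ee: "e \<otimes> e' = \<zero>" "e' \<otimes> e = \<zero>"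
    and e1: "e \<oplus> e' = \<one>"
    using idem_compl[OF e] c by (auto simp: e'_def idempotents_def add_compl)
  have bc: "e' \<otimes> b \<in> carrier R" using e'c b by simp
  then obtain g where g: "g \<in> idempotents R" "pr (e' \<otimes> b) = pr g"
    using PR_idem by blast
  have gc: "g \<in> carrier R" "g \<otimes> g = g" using g by (auto simp: idempotents_def)
  have "g \<in> pr (e' \<otimes> b)" using g mem_pr_self gc by simp
  then have e'g: "e' \<otimes> g = g"
    using e'c e'i b by (auto simp: mem_pr m_assoc[symmetric])
  have eg: "e \<otimes> g = \<zero>"
    using e'g ee e'c gc c m_assoc[of e e' g] by simp
  \<comment> \<open>An idempotent generator \<open>g\<close> of this ideal satisfies only
    \<open>e \<otimes> g = \<zero>\<close>. Multiplying by \<open>e'\<close> on the right also gives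
    \<open>f \<otimes> e = \<zero>\<close> and keeps the right ideal, because
    \<open>e' \<otimes> g = g\<close>.\<close>
  define f where "f = g \<otimes> e'"
  have fc: "f \<in> carrier R" using gc e'c by (simp add: f_def)
  have ff: "f \<otimes> f = f"
    using gc e'c e'g m_assoc[of g e' "g \<otimes> e'"] m_assoc[of e' g e'] m_assoc[of g g e']
    by (simp add: f_def)
  have fi: "f \<in> idempotents R" using fc ff by (simp add: idempotents_def)
  have ef: "e \<otimes> f = \<zero>" using eg c gc e'c by (simp add: f_def m_assoc[symmetric])
  have fe: "f \<otimes> e = \<zero>" using ee c gc e'c by (simp add: f_def m_assoc)
  have fg: "f \<otimes> g = g" using e'g gc e'c by (simp add: f_def m_assoc)
  have "g \<otimes> f = f" using gc e'c by (simp add: f_def m_assoc[symmetric])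
  have pr_f: "pr f = pr (e' \<otimes> b)"
    unfolding g(2)
  proof
    show "pr f \<subseteq> pr g" using \<open>g \<otimes> f = f\<close> fc gc g by (subst pr_subset_iff) (auto simp: mem_pr_idem)
    show "pr g \<subseteq> pr f" using fg fc gc fi by (subst pr_subset_iff) (auto simp: mem_pr_idem)
  qed
  have si: "e \<oplus> f \<in> idempotents R"
    using c fc ff ef fe by (simp add: idempotents_def l_distr r_distr)
  have "pr e <+>\<^bsub>R\<^esub> pr b = pr (e \<oplus> f)"
  proof
    have "b = e \<otimes> b \<oplus> e' \<otimes> b" using c e'c b e1 by (simp add: l_distr[symmetric])
    moreover have "e \<otimes> b \<in> pr (e \<oplus> f)"
      using c fc fe b by (simp add: mem_pr_idem[OF si] l_distr m_assoc[symmetric])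
    moreover have "e' \<otimes> b \<in> pr f" using pr_f mem_pr_self bc by simp
    then have "f \<otimes> (e' \<otimes> b) = e' \<otimes> b" by (simp add: mem_pr_idem[OF fi])
    moreover have "e \<otimes> (e' \<otimes> b) = \<zero>"
      using ee c e'c b by (simp add: m_assoc[symmetric])
    ultimately have "e' \<otimes> b \<in> pr (e \<oplus> f)"
      using bc c fc by (simp add: mem_pr_idem[OF si] l_distr)
    with \<open>e \<otimes> b \<in> pr (e \<oplus> f)\<close> have "e \<otimes> b \<oplus> e' \<otimes> b \<in> pr (e \<oplus> f)"
      using c fc by (intro PR_add) auto
    then have "b \<in> pr (e \<oplus> f)" using \<open>b = e \<otimes> b \<oplus> e' \<otimes> b\<close> by simp
    moreover have "e \<in> pr (e \<oplus> f)" using c fe fc by (simp add: mem_pr_idem[OF si] l_distr)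
    ultimately show "pr e <+>\<^bsub>R\<^esub> pr b \<subseteq> pr (e \<oplus> f)"
      using c fc b by (intro set_add_least) (auto simp: pr_subset_iff)
  next
    have "f \<in> pr (e' \<otimes> b)" using mem_pr_self[OF fc] by (simp add: pr_f)
    then obtain y where y: "y \<in> carrier R" "f = e' \<otimes> b \<otimes> y" by (auto simp: mem_pr)
    have "e' \<otimes> b \<otimes> y = b \<otimes> y \<oplus> (\<ominus> (e \<otimes> (b \<otimes> y)))"
      using c b y by (simp add: e'_def minus_eq l_distr l_minus m_assoc)
    show "pr (e \<oplus> f) \<subseteq> pr e <+>\<^bsub>R\<^esub> pr b"
    proof
      fix x assume "x \<in> pr (e \<oplus> f)"
      then obtain z where z: "z \<in> carrier R" "x = (e \<oplus> f) \<otimes> z" by (auto simp: mem_pr)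
      have "x = e \<otimes> z \<oplus> (b \<otimes> y \<oplus> \<ominus> (e \<otimes> (b \<otimes> y))) \<otimes> z"
        using z y \<open>e' \<otimes> b \<otimes> y = _\<close> c fc by (simp add: l_distr)
      also have "\<dots> = e \<otimes> (z \<ominus> b \<otimes> y \<otimes> z) \<oplus> b \<otimes> (y \<otimes> z)"
        using z y c b a_comm[of "b \<otimes> (y \<otimes> z)" "\<ominus> (e \<otimes> (b \<otimes> (y \<otimes> z)))"]
        by (simp add: l_distr r_distr minus_eq l_minus r_minus m_assoc a_assoc)
      finally show "x \<in> pr e <+>\<^bsub>R\<^esub> pr b"
        unfolding mem_set_add using z y b c
        by (intro bexI[of _ "e \<otimes> (z \<ominus> b \<otimes> y \<otimes> z)"] bexI[of _ "b \<otimes> (y \<otimes> z)"])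
          (auto simp: mem_pr)
    qed
  qed
  then show thesis using that[of f] fi ef fe pr_f si by (simp add: e'_def)
qed

lemma set_add_PR: assumes "A \<in> PR" "B \<in> PR" shows "A <+>\<^bsub>R\<^esub> B \<in> PR"
proof -
  obtain e where "e \<in> idempotents R" "A = pr e" using PR_idem[OF assms(1)] .
  moreover obtain b where "b \<in> carrier R" "B = pr b" using assms by auto
  ultimately obtain f where "e \<oplus> f \<in> idempotents R" "A <+>\<^bsub>R\<^esub> B = pr (e \<oplus> f)"
    using set_add_idem by metis
  then show ?thesis by (auto simp: idempotents_def)
qed

lemma set_add_comm: assumes "A \<in> PR" "B \<in> PR" shows "A <+>\<^bsub>R\<^esub> B = B <+>\<^bsub>R\<^esub> A"
  using set_add_least[OF set_add_PR[OF assms] set_add_upper(2,1)[OF assms]]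
    set_add_least[OF set_add_PR[OF assms(2,1)] set_add_upper(2,1)[OF assms(2,1)]] by blast

text \<open>\<open>f \<otimes> e = e\<close> places \<open>e R\<close> inside \<open>f R\<close>,
  and \<open>e \<otimes> f = e\<close> places the right annihilator \<open>(1 - f) R\<close> of
  \<open>f\<close> inside that of \<open>e\<close>. So the order compares both ideals of the
  complementary pair of an idempotent.\<close>

lemma idem_le_pr:
  assumes "e \<in> idempotents R" "f \<in> idempotents R"
  shows "idem_le R e f \<longleftrightarrow> pr e \<subseteq> pr f \<and> pr (\<one> \<ominus> f) \<subseteq> pr (\<one> \<ominus> e)"
proof -
  have c: "e \<in> carrier R" "f \<in> carrier R" using assms idempotentsD by auto
  have 1: "pr e \<subseteq> pr f \<longleftrightarrow> f \<otimes> e = e"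
    using c assms by (subst pr_subset_iff) (auto simp: mem_pr_idem)
  have "pr (\<one> \<ominus> f) \<subseteq> pr (\<one> \<ominus> e) \<longleftrightarrow> e \<otimes> (\<one> \<ominus> f) = \<zero>"
    using c assms by (subst pr_subset_iff) (auto simp: mem_pr_compl)
  also have "\<dots> \<longleftrightarrow> e \<otimes> f = e"
    using c by (auto simp: mult_compl minus_eq_zero_iff)
  finally show ?thesis using 1 by (auto simp: idem_le_def)
qed

lemma compl_compl: "e \<in> carrier R \<Longrightarrow> \<one> \<ominus> (\<one> \<ominus> e) = e"
  by (simp add: minus_eq minus_add a_assoc[symmetric] r_neg)

lemma pr_compl_disjoint:
  assumes "e \<in> idempotents R" shows "pr e \<inter> pr (\<one> \<ominus> e) = {\<zero>}"
  using assms idempotentsD[OF assms] by (auto simp: mem_pr_idem mem_pr_compl)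

lemma pr_compl_sum:
  assumes "e \<in> idempotents R" shows "pr e <+>\<^bsub>R\<^esub> pr (\<one> \<ominus> e) = carrier R"
proof -
  have c: "e \<in> carrier R" using assms idempotentsD by blast
  have "\<one> = e \<oplus> (\<one> \<ominus> e)" using c by (simp add: add_compl)
  then have "\<one> \<in> pr e <+>\<^bsub>R\<^esub> pr (\<one> \<ominus> e)"
    using c mem_pr_self by (force simp: mem_set_add)
  then have "pr \<one> \<subseteq> pr e <+>\<^bsub>R\<^esub> pr (\<one> \<ominus> e)"
    using c by (subst pr_subset_iff) (auto intro!: set_add_PR)
  then show ?thesis
    using PR_carrier[OF set_add_PR, of "pr e" "pr (\<one> \<ominus> e)"] c by (auto simp: mem_pr)
qed

text \<open>The idempotent is the \<open>A\<close>-component of \<open>\<one>\<close> in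
  \<open>\<one> = e \<oplus> b\<close>. For \<open>x\<close> in \<open>A\<close>, the element
  \<open>b \<otimes> x = x \<ominus> e \<otimes> x\<close> lies in both ideals and vanishes;
  likewise \<open>e \<otimes> x\<close> for \<open>x\<close> in \<open>B\<close>.\<close>

lemma complementary_idem:
  assumes "A \<in> PR" "B \<in> PR" "A \<inter> B = {\<zero>}" "A <+>\<^bsub>R\<^esub> B = carrier R"
  obtains e where "e \<in> idempotents R" "A = pr e" "B = pr (\<one> \<ominus> e)"
proof -
  obtain e b where eb: "e \<in> A" "b \<in> B" "\<one> = e \<oplus> b"
    using assms(4) one_closed by (metis mem_set_add)
  have c: "e \<in> carrier R" "b \<in> carrier R"
    using PR_mem_carrier[OF assms(1) eb(1)] PR_mem_carrier[OF assms(2) eb(2)] .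
  have be: "b = \<one> \<ominus> e" unfolding eb(3) using c a_comm[of e b] by (simp add: minus_eq a_assoc r_neg)
  have dec: "x = e \<otimes> x \<oplus> b \<otimes> x" if "x \<in> carrier R" for x
    using that c l_distr[of e b x] by (simp flip: eb(3))
  have A: "e \<otimes> x = x \<and> b \<otimes> x = \<zero>" if x: "x \<in> A" for x
  proof -
    have xc: "x \<in> carrier R" using PR_mem_carrier[OF assms(1) x] .
    have "b \<otimes> x = x \<ominus> e \<otimes> x" using xc c be by (simp add: mult_compl)
    moreover have "e \<otimes> x \<in> A" using PR_rmult[OF assms(1) eb(1) xc] .
    ultimately have "b \<otimes> x \<in> A" using PR_minus[OF assms(1) x] by simp
    then have "b \<otimes> x = \<zero>" using PR_rmult[OF assms(2) eb(2) xc] assms(3) by blast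
    then show ?thesis using dec[OF xc] xc c by simp
  qed
  have B: "e \<otimes> x = \<zero>" if x: "x \<in> B" for x
  proof -
    have xc: "x \<in> carrier R" using PR_mem_carrier[OF assms(2) x] .
    have "e \<otimes> x = x \<ominus> b \<otimes> x"
      using xc c be compl_compl[OF c(1)] by (metis mult_compl(1))
    moreover have "b \<otimes> x \<in> B" using PR_rmult[OF assms(2) eb(2) xc] .
    ultimately have "e \<otimes> x \<in> B" using PR_minus[OF assms(2) x] by simp
    then show ?thesis using PR_rmult[OF assms(1) eb(1) xc] assms(3) by blast
  qed
  have ei: "e \<in> idempotents R" using A[OF eb(1)] c by (simp add: idempotents_def)
  have "A = pr e"
  proof
    show "A \<subseteq> pr e"
      by (rule subsetI) (simp add: mem_pr_idem[OF ei] A PR_mem_carrier[OF assms(1)])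
    show "pr e \<subseteq> A" using eb(1) c assms(1) by (subst pr_subset_iff) auto
  qed
  moreover have "B = pr (\<one> \<ominus> e)"
  proof
    show "B \<subseteq> pr (\<one> \<ominus> e)"
      by (rule subsetI) (simp add: mem_pr_compl[OF ei] B PR_mem_carrier[OF assms(2)])
    show "pr (\<one> \<ominus> e) \<subseteq> B" using eb(2) c be assms(2) by (subst pr_subset_iff) auto
  qed
  ultimately show thesis using that ei by blast
qed

end

section \<open>The continuous geometry of principal right ideals\<close>

locale regular_continuous = von_neumann_regular +
  assumes continuous: "continuous_geometry (right_ideal_lattice R)"
begin

abbreviation Lat :: "'a set gorder" where "Lat \<equiv> right_ideal_lattice R"

definition lub :: "'a set set \<Rightarrow> 'a set" where "lub C = \<Squnion>\<^bsub>Lat\<^esub>C"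

lemma Lat_simps [simp]: "carrier Lat = PR" "le Lat = (\<subseteq>)"
  by (auto simp: right_ideal_lattice_def)

lemma complete_Lat: "complete_lattice Lat"
  using continuous by (simp add: continuous_geometry_def)

lemma lub_PR: assumes "C \<subseteq> PR" shows "lub C \<in> PR"
proof -
  interpret Lt: complete_lattice Lat by (rule complete_Lat)
  show ?thesis using Lt.sup_closed[of C] assms by (simp add: lub_def)
qed

lemma lub_upper: assumes "C \<subseteq> PR" "A \<in> C" shows "A \<subseteq> lub C"
proof -
  interpret Lt: complete_lattice Lat by (rule complete_Lat)
  show ?thesis using Lt.sup_upper[of C A] assms by (simp add: lub_def)
qed

lemma lub_least:
  assumes "C \<subseteq> PR" "B \<in> PR" "\<And>A. A \<in> C \<Longrightarrow> A \<subseteq> B" shows "lub C \<subseteq> B"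
proof -
  interpret Lt: complete_lattice Lat by (rule complete_Lat)
  have "B \<in> Upper Lat C" using assms by (auto simp: Upper_def)
  then show ?thesis using Lt.sup_least[of C B] assms by (simp add: lub_def)
qed

text \<open>Any \<open>x\<close> in the intersection generates a lower bound \<open>pr x\<close> of
  \<open>C\<close>. The intersection with \<open>carrier R\<close> covers the empty family.\<close>

lemma inf_Lat_eq: assumes "C \<subseteq> PR" shows "\<Sqinter>\<^bsub>Lat\<^esub>C = carrier R \<inter> \<Inter>C"
proof
  interpret Lt: complete_lattice Lat by (rule complete_Lat)
  have PRi: "\<Sqinter>\<^bsub>Lat\<^esub>C \<in> PR" using Lt.inf_closed[of C] assms by simp
  show "\<Sqinter>\<^bsub>Lat\<^esub>C \<subseteq> carrier R \<inter> \<Inter>C"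
    using Lt.inf_lower[of C] assms PR_carrier[OF PRi] by auto
  show "carrier R \<inter> \<Inter>C \<subseteq> \<Sqinter>\<^bsub>Lat\<^esub>C"
  proof
    fix x assume x: "x \<in> carrier R \<inter> \<Inter>C"
    have "pr x \<subseteq> A" if "A \<in> C" for A
      using x that assms by (subst pr_subset_iff) auto
    moreover have "pr x \<in> PR" using x by simp
    ultimately have "pr x \<subseteq> \<Sqinter>\<^bsub>Lat\<^esub>C"
      using Lt.inf_greatest[of C "pr x", unfolded Lat_simps] assms by blast
    then show "x \<in> \<Sqinter>\<^bsub>Lat\<^esub>C" using mem_pr_self x by blast
  qed
qed

lemma Inter_PR: assumes "C \<subseteq> PR" shows "carrier R \<inter> \<Inter>C \<in> PR"
proof -
  interpret Lt: complete_lattice Lat by (rule complete_Lat)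
  show ?thesis using Lt.inf_closed[of C] assms by (simp add: inf_Lat_eq)
qed

lemma meet_eq: assumes "A \<in> PR" "B \<in> PR" shows "A \<sqinter>\<^bsub>Lat\<^esub> B = A \<inter> B"
  using assms PR_carrier[OF assms(1)] by (subst meet_def) (subst inf_Lat_eq, auto)

lemma Int_PR: assumes "A \<in> PR" "B \<in> PR" shows "A \<inter> B \<in> PR"
proof -
  have "carrier R \<inter> \<Inter>{A, B} = A \<inter> B" using PR_carrier[OF assms(1)] by auto
  then show ?thesis using Inter_PR[of "{A, B}"] assms by simp
qed

lemma join_eq: assumes "A \<in> PR" "B \<in> PR" shows "A \<squnion>\<^bsub>Lat\<^esub> B = A <+>\<^bsub>R\<^esub> B"
proof -
  have sub: "{A, B} \<subseteq> PR" using assms by simp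
  have "lub {A, B} = A <+>\<^bsub>R\<^esub> B"
  proof
    show "lub {A, B} \<subseteq> A <+>\<^bsub>R\<^esub> B"
      using set_add_upper[OF assms] by (intro lub_least sub set_add_PR assms) auto
    show "A <+>\<^bsub>R\<^esub> B \<subseteq> lub {A, B}"
      by (intro set_add_least lub_PR lub_upper sub) auto
  qed
  then show ?thesis by (simp add: Lattice.join_def lub_def)
qed

lemma chain_in_Lat: "chain_in Lat C \<longleftrightarrow> C \<subseteq> PR \<and> (\<forall>A\<in>C. \<forall>B\<in>C. A \<subseteq> B \<or> B \<subseteq> A)"
  by (simp add: chain_in_def)

text \<open>By upper continuity the intersection with the supremum is the supremum of the zero
  ideals \<open>B \<inter> A\<close>. The chain conditions of the continuous geometry enter the
  proof only here and, in dual form, in the next lemma.\<close>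

lemma lub_disjoint:
  assumes C: "C \<subseteq> PR" "\<And>A B. A \<in> C \<Longrightarrow> B \<in> C \<Longrightarrow> A \<subseteq> B \<or> B \<subseteq> A"
    and B: "B \<in> PR" and dis: "\<And>A. A \<in> C \<Longrightarrow> B \<inter> A = {\<zero>}"
  shows "B \<inter> lub C = {\<zero>}"
proof -
  have "chain_in Lat C" using C by (simp add: chain_in_Lat)
  then have "B \<sqinter>\<^bsub>Lat\<^esub> \<Squnion>\<^bsub>Lat\<^esub>C = \<Squnion>\<^bsub>Lat\<^esub>((\<lambda>y. B \<sqinter>\<^bsub>Lat\<^esub> y) ` C)"
    using continuous B unfolding continuous_geometry_def by simp
  moreover have im: "(\<lambda>y. B \<sqinter>\<^bsub>Lat\<^esub> y) ` C \<subseteq> {{\<zero>}}"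
    using C(1) B dis meet_eq by blast
  ultimately have "B \<inter> lub C = lub ((\<lambda>y. B \<sqinter>\<^bsub>Lat\<^esub> y) ` C)"
    using meet_eq[OF B lub_PR[OF C(1)]] by (simp add: lub_def)
  moreover have "lub ((\<lambda>y. B \<sqinter>\<^bsub>Lat\<^esub> y) ` C) \<subseteq> {\<zero>}"
    by (rule lub_least) (use im zero_PR in blast)+
  ultimately show ?thesis using PR_zero[OF B] PR_zero[OF lub_PR[OF C(1)]] by blast
qed

lemma Inter_codisjoint:
  assumes C: "C \<subseteq> PR" "\<And>A B. A \<in> C \<Longrightarrow> B \<in> C \<Longrightarrow> A \<subseteq> B \<or> B \<subseteq> A"
    and B: "B \<in> PR" and dis: "\<And>A. A \<in> C \<Longrightarrow> B <+>\<^bsub>R\<^esub> A = carrier R"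
  shows "B <+>\<^bsub>R\<^esub> (carrier R \<inter> \<Inter>C) = carrier R"
proof -
  have "chain_in Lat C" using C by (simp add: chain_in_Lat)
  then have "B \<squnion>\<^bsub>Lat\<^esub> \<Sqinter>\<^bsub>Lat\<^esub>C = \<Sqinter>\<^bsub>Lat\<^esub>((\<lambda>y. B \<squnion>\<^bsub>Lat\<^esub> y) ` C)"
    using continuous B unfolding continuous_geometry_def by simp
  moreover have im: "(\<lambda>y. B \<squnion>\<^bsub>Lat\<^esub> y) ` C \<subseteq> {carrier R}"
    using C(1) B dis join_eq by blast
  then have "\<Sqinter>\<^bsub>Lat\<^esub>((\<lambda>y. B \<squnion>\<^bsub>Lat\<^esub> y) ` C) = carrier R"
    using carrier_PR by (subst inf_Lat_eq) auto
  ultimately show ?thesis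
    using join_eq[OF B Inter_PR[OF C(1)]] inf_Lat_eq[OF C(1)] by simp
qed

text \<open>
  The largest right ideal \<open>cR\<close> with \<open>a R (cR) = 0\<close> is two-sided, so its idempotent generator
  \<open>c\<close> is central and irreducibility applies.
\<close>

lemma irreducible_prime:
  assumes irr: "irreducible_ring R" and ab: "a \<in> carrier R" "b \<in> carrier R"
    and zero: "\<And>x. x \<in> carrier R \<Longrightarrow> a \<otimes> x \<otimes> b = \<zero>"
  shows "a = \<zero> \<or> b = \<zero>"
proof (rule ccontr)
  assume "\<not> (a = \<zero> \<or> b = \<zero>)"
  then have nz: "a \<noteq> \<zero>" "b \<noteq> \<zero>" by auto
  define \<J> where "\<J> = {A \<in> PR. \<forall>x\<in>carrier R. \<forall>y\<in>A. a \<otimes> x \<otimes> y = \<zero>}"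
  have sub: "\<J> \<subseteq> PR" by (auto simp: \<J>_def)
  define J where "J = lub \<J>"
  have JPR: "J \<in> PR" unfolding J_def by (rule lub_PR[OF sub])
  obtain c where c: "c \<in> idempotents R" "J = pr c" using PR_idem[OF JPR] .
  have cc: "c \<in> carrier R" "c \<otimes> c = c" using idempotentsD c by auto
  have J0: "a \<otimes> x \<otimes> y = \<zero>" if x: "x \<in> carrier R" and y: "y \<in> J" for x y
  proof -
    have "J \<subseteq> {y \<in> carrier R. a \<otimes> x \<otimes> y = \<zero>}"
      unfolding J_def
    proof (intro lub_least sub annihilator_PR subsetI CollectI conjI)
      fix A y assume A: "A \<in> \<J>" "y \<in> A"
      then show "y \<in> carrier R" using sub PR_mem_carrier by blast
      show "a \<otimes> x \<otimes> y = \<zero>" using A x by (simp add: \<J>_def)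
    qed (use x ab in simp)
    then show ?thesis using y by auto
  qed
  have Jmax: "y \<in> J" if y: "y \<in> carrier R" "\<And>x. x \<in> carrier R \<Longrightarrow> a \<otimes> x \<otimes> y = \<zero>" for y
  proof -
    have "a \<otimes> x \<otimes> (y \<otimes> z) = \<zero>" if "x \<in> carrier R" "z \<in> carrier R" for x z
    proof -
      have "a \<otimes> x \<otimes> (y \<otimes> z) = a \<otimes> x \<otimes> y \<otimes> z" using that y(1) ab by (simp add: m_assoc)
      then show ?thesis using that y by simp
    qed
    then have "pr y \<in> \<J>" using y(1) by (auto simp: \<J>_def mem_pr)
    then show ?thesis using lub_upper[OF sub] mem_pr_self[OF y(1)] by (auto simp: J_def)
  qed
  have cyc: "c \<otimes> (y \<otimes> c) = y \<otimes> c" if y: "y \<in> carrier R" for y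
  proof -
    have "a \<otimes> x \<otimes> (y \<otimes> c) = \<zero>" if "x \<in> carrier R" for x
    proof -
      have "a \<otimes> (x \<otimes> y) \<otimes> c = \<zero>" using that y J0 c mem_pr_self cc by simp
      then show ?thesis using that y cc ab by (simp add: m_assoc)
    qed
    then have "y \<otimes> c \<in> J" using y cc by (intro Jmax) auto
    then show ?thesis using c by (simp add: mem_pr_idem)
  qed
  have central: "c \<otimes> y = y \<otimes> c" if y: "y \<in> carrier R" for y
  proof -
    \<comment> \<open>\<open>z\<close> is \<open>c y (1 - c)\<close>, so
      \<open>z \<otimes> c = \<zero>\<close> and \<open>c \<otimes> z = z\<close>. Left
      multiplication by \<open>c\<close> fixes \<open>w \<otimes> c\<close>, hence also
      \<open>w \<otimes> z\<close>, whence \<open>z = z \<otimes> w \<otimes> z = z \<otimes> c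
      \<otimes> w \<otimes> z = \<zero>\<close>.\<close>
    define z where "z = c \<otimes> y \<ominus> c \<otimes> y \<otimes> c"
    have zc: "z \<in> carrier R" using y cc by (simp add: z_def)
    have "z \<otimes> c = \<zero>" using y cc
      by (simp add: z_def minus_eq l_distr l_minus m_assoc r_neg)
    obtain w where w: "w \<in> carrier R" "z \<otimes> w \<otimes> z = z" using quasi_inverse[OF zc] by blast
    have cz: "c \<otimes> z = z" using y cc
      by (simp add: z_def minus_eq r_distr r_minus m_assoc[symmetric])
    have "c \<otimes> (w \<otimes> c) = w \<otimes> c" using cyc w by simp
    have "w \<otimes> z = c \<otimes> w \<otimes> z"
      using cz cyc[OF w(1)] w zc cc by (metis m_assoc m_closed)
    then have "z = z \<otimes> c \<otimes> w \<otimes> z" using w zc cc by (metis m_assoc m_closed)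
    then have "z = \<zero>" using \<open>z \<otimes> c = \<zero>\<close> w zc by simp
    then have "c \<otimes> y = c \<otimes> y \<otimes> c" using y cc by (simp add: z_def minus_eq_zero_iff)
    then show ?thesis using cyc[OF y] y cc by (simp add: m_assoc)
  qed
  have c0: "c \<noteq> \<zero>"
  proof
    assume "c = \<zero>"
    then have "J = {\<zero>}" using c pr_zero by simp
    then show False using Jmax[OF ab(2) zero] nz by simp
  qed
  have c1: "c \<noteq> \<one>"
    using J0[of \<one> c] c cc mem_pr_self[of c] ab nz by auto
  define d where "d = \<one> \<ominus> c"
  have d: "d \<in> carrier R" "d \<otimes> d = d" "c \<otimes> d = \<zero>" "d \<otimes> c = \<zero>" "c \<oplus> d = \<one>"
    using idem_compl[OF c(1)] cc by (auto simp: d_def idempotents_def add_compl)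
  have dcentral: "d \<otimes> y = y \<otimes> d" if y: "y \<in> carrier R" for y
    using y cc central[OF y] by (simp add: d_def mult_compl)
  have d0: "d \<noteq> \<zero>" using c1 cc by (simp add: d_def minus_eq_zero_iff)
  \<comment> \<open>For a central idempotent \<open>p\<close> the ideal \<open>p R\<close> is a ring
    with unit \<open>p\<close>. The truncation discards extra record fields, since the factors in
    \<open>irreducible_ring\<close> have type \<open>'a ring\<close>.\<close>
  define corner :: "'a \<Rightarrow> 'a ring" where
    "corner p = ring.truncate (R\<lparr>carrier := pr p, one := p\<rparr>)" for p
  have corner_simps: "carrier (corner p) = pr p" "\<one>\<^bsub>corner p\<^esub> = p" "\<zero>\<^bsub>corner p\<^esub> = \<zero>"
    "x \<otimes>\<^bsub>corner p\<^esub> y = x \<otimes> y" "x \<oplus>\<^bsub>corner p\<^esub> y = x \<oplus> y" for p x y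
    by (simp_all add: corner_def ring.defs)
  have ringc: "ring (corner p) \<and> carrier (corner p) \<noteq> {\<zero>\<^bsub>corner p\<^esub>}"
    if p: "p \<in> idempotents R" "\<And>y. y \<in> carrier R \<Longrightarrow> p \<otimes> y = y \<otimes> p" "p \<noteq> \<zero>" for p
  proof
    have pc: "p \<in> carrier R" "pr p \<in> PR" using idempotentsD p by auto
    note cl = PR_mem_carrier[OF pc(2)]
    show "ring (corner p)"
    proof (rule ringI)
      show "abelian_group (corner p)"
      proof (rule abelian_groupI)
        fix x assume "x \<in> carrier (corner p)"
        then show "\<exists>y\<in>carrier (corner p). y \<oplus>\<^bsub>corner p\<^esub> x = \<zero>\<^bsub>corner p\<^esub>"
          using cl PR_neg[OF pc(2)] by (auto simp: corner_simps intro!: bexI[of _ "\<ominus> x"] l_neg)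
      qed (use cl PR_add[OF pc(2)] PR_zero[OF pc(2)] in \<open>auto simp: corner_simps a_assoc intro: a_comm\<close>)
      show "monoid (corner p)"
      proof (rule monoidI)
        fix x assume "x \<in> carrier (corner p)"
        then show "\<one>\<^bsub>corner p\<^esub> \<otimes>\<^bsub>corner p\<^esub> x = x" "x \<otimes>\<^bsub>corner p\<^esub> \<one>\<^bsub>corner p\<^esub> = x"
          using p by (auto simp: corner_simps mem_pr_idem)
      qed (use cl PR_rmult[OF pc(2)] mem_pr_self[OF pc(1)] in \<open>auto simp: corner_simps m_assoc\<close>)
    qed (use cl in \<open>auto simp: corner_simps l_distr r_distr\<close>)
    show "carrier (corner p) \<noteq> {\<zero>\<^bsub>corner p\<^esub>}"
      using mem_pr_self[OF pc(1)] p(3) by (auto simp: corner_simps)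
  qed
  have di: "d \<in> idempotents R" using d by (simp add: idempotents_def)
  define h where "h y = (c \<otimes> y, d \<otimes> y)" for y
  have "h \<in> ring_iso R (RDirProd (corner c) (corner d))"
  proof (rule ring_iso_memI)
    fix x y assume xy: "x \<in> carrier R" "y \<in> carrier R"
    show "h x \<in> carrier (RDirProd (corner c) (corner d))"
      using xy by (auto simp: h_def RDirProd_carrier corner_simps mem_pr)
    have "c \<otimes> (x \<otimes> y) = c \<otimes> x \<otimes> (c \<otimes> y)"
      using xy cc cyc[of x] central by (metis m_assoc m_closed)
    moreover have "d \<otimes> (x \<otimes> y) = d \<otimes> x \<otimes> (d \<otimes> y)"
      using xy d dcentral by (metis m_assoc m_closed)
    ultimately show "h (x \<otimes> y) = h x \<otimes>\<^bsub>RDirProd (corner c) (corner d)\<^esub> h y"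
      by (simp add: h_def RDirProd_def DirProd_def monoid.defs corner_simps)
    show "h (x \<oplus> y) = h x \<oplus>\<^bsub>RDirProd (corner c) (corner d)\<^esub> h y"
      using xy cc d by (simp add: h_def RDirProd_def DirProd_def monoid.defs corner_simps r_distr)
  next
    show "h \<one> = \<one>\<^bsub>RDirProd (corner c) (corner d)\<^esub>"
      using cc d by (simp add: h_def RDirProd_def DirProd_def monoid.defs corner_simps)
    show "bij_betw h (carrier R) (carrier (RDirProd (corner c) (corner d)))"
    proof (rule bij_betw_byWitness[where f' = "\<lambda>(x, y). x \<oplus> y"])
      show "\<forall>x\<in>carrier R. (case h x of (x, y) \<Rightarrow> x \<oplus> y) = x"
        using cc d by (simp add: h_def l_distr[symmetric])
      have "h (x \<oplus> y) = (x, y)" if "x \<in> pr c" "y \<in> pr d" for x y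
      proof -
        have x: "x \<in> carrier R" "c \<otimes> x = x" and y: "y \<in> carrier R" "d \<otimes> y = y"
          using that c di by (auto simp: mem_pr_idem)
        have "d \<otimes> x = d \<otimes> c \<otimes> x" "c \<otimes> y = c \<otimes> d \<otimes> y"
          using x y d(1) cc(1) by (simp_all add: m_assoc)
        then have "d \<otimes> x = \<zero>" "c \<otimes> y = \<zero>" using x y d by simp_all
        then show ?thesis using x y cc d by (simp add: h_def r_distr)
      qed
      then show "\<forall>z\<in>carrier (RDirProd (corner c) (corner d)). h (case z of (x, y) \<Rightarrow> x \<oplus> y) = z"
        by (auto simp: RDirProd_carrier corner_simps)
      show "h ` carrier R \<subseteq> carrier (RDirProd (corner c) (corner d))"
        by (auto simp: h_def RDirProd_carrier corner_simps mem_pr)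
      show "(\<lambda>(x, y). x \<oplus> y) ` carrier (RDirProd (corner c) (corner d)) \<subseteq> carrier R"
        using cc d by (auto simp: RDirProd_carrier corner_simps mem_pr)
    qed
  qed
  then have "R \<simeq> RDirProd (corner c) (corner d)" by (auto simp: is_ring_iso_def)
  then show False
    using irr ringc[OF c(1) central c0] ringc[OF di dcentral d0]
    unfolding irreducible_ring_def by blast
qed

end

section \<open>The rank of right ideals\<close>

text \<open>Irreducibility is recorded as primeness, supplied by \<open>irreducible_prime\<close>:
  any two nonzero elements are connected by a nonzero product, which is the form that comparability
  and minimal idempotents use.\<close>

locale ranked_continuous = regular_continuous +
  fixes \<rho> :: "'a \<Rightarrow> real"
  assumes rank: "rank_function R \<rho>"
    and prime: "\<lbrakk>a \<in> carrier R; b \<in> carrier R; \<And>x. x \<in> carrier R \<Longrightarrow> a \<otimes> x \<otimes> b = \<zero>\<rbrakk>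
      \<Longrightarrow> a = \<zero> \<or> b = \<zero>"
begin

lemma rho_nonneg: "a \<in> carrier R \<Longrightarrow> 0 \<le> \<rho> a"
  and rho_le_1: "a \<in> carrier R \<Longrightarrow> \<rho> a \<le> 1"
  using rank by (auto simp: rank_function_def)

lemma rho_one: "\<rho> \<one> = 1" using rank by (simp add: rank_function_def)

lemma rho_mult:
  assumes "a \<in> carrier R" "b \<in> carrier R" shows "\<rho> (a \<otimes> b) \<le> \<rho> a" "\<rho> (a \<otimes> b) \<le> \<rho> b"
  using rank assms by (auto simp: rank_function_def)

lemma rho_add_orthogonal:
  assumes "e \<in> idempotents R" "f \<in> idempotents R" "e \<otimes> f = \<zero>" "f \<otimes> e = \<zero>"
  shows "\<rho> (e \<oplus> f) = \<rho> e + \<rho> f"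
  using rank assms by (auto simp: rank_function_def)

lemma rho_zero: "\<rho> \<zero> = 0"
  using rho_add_orthogonal[of \<zero> \<zero>] by (simp add: idempotents_def)

lemma rho_pos: "a \<in> carrier R \<Longrightarrow> a \<noteq> \<zero> \<Longrightarrow> 0 < \<rho> a"
  using rank by (auto simp: rank_function_def)

lemma rho_eq_0_iff: "a \<in> carrier R \<Longrightarrow> \<rho> a = 0 \<longleftrightarrow> a = \<zero>"
  using rho_pos rho_zero by fastforce

text \<open>Generators of the same right ideal are right multiples of each other and have equal
  rank, so the choice is immaterial (\<open>rk_pr\<close>).\<close>

definition rk :: "'a set \<Rightarrow> real" where
  "rk A = \<rho> (SOME a. a \<in> carrier R \<and> A = pr a)"

lemma rho_mono: assumes "a \<in> carrier R" "b \<in> carrier R" "pr a \<subseteq> pr b" shows "\<rho> a \<le> \<rho> b"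
proof -
  have "a \<in> pr b" using assms mem_pr_self by blast
  then show ?thesis using assms rho_mult by (auto simp: mem_pr)
qed

lemma rk_pr: assumes "a \<in> carrier R" shows "rk (pr a) = \<rho> a"
proof -
  define b where "b = (SOME b. b \<in> carrier R \<and> pr a = pr b)"
  have "b \<in> carrier R \<and> pr a = pr b" unfolding b_def by (rule someI[of _ a]) (simp add: assms)
  then have "\<rho> b = \<rho> a" using rho_mono assms by (intro antisym) auto
  then show ?thesis by (simp add: rk_def b_def)
qed

lemma rk_mono: assumes "A \<in> PR" "B \<in> PR" "A \<subseteq> B" shows "rk A \<le> rk B"
  using assms by (auto simp: rk_pr rho_mono)

lemma rk_eq_0: assumes "A \<in> PR" "rk A = 0" shows "A = {\<zero>}"
proof -
  obtain a where a: "a \<in> carrier R" "A = pr a" using assms by auto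
  then have "a = \<zero>" using assms(2) rk_pr rho_eq_0_iff by auto
  then show ?thesis using a pr_zero by simp
qed

text \<open>By \<open>set_add_idem\<close> the rank of the sum is
  \<open>\<rho> e + \<rho> c\<close>, where \<open>c\<close> is the component of \<open>b\<close> in
  the complement of \<open>e\<close>. For independent ideals \<open>\<rho> c = \<rho> b\<close>,
  since left multiplication by \<open>1 - e\<close> is then injective on \<open>B\<close>.\<close>

lemma rk_set_add_le: assumes A: "A \<in> PR" and B: "B \<in> PR" shows "rk (A <+>\<^bsub>R\<^esub> B) \<le> rk A + rk B"
  and rk_set_add: "A \<inter> B = {\<zero>} \<Longrightarrow> rk (A <+>\<^bsub>R\<^esub> B) = rk A + rk B"
proof -
  obtain e where e: "e \<in> idempotents R" "A = pr e" using PR_idem[OF A] .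
  have ec: "e \<in> carrier R" using e idempotentsD by auto
  obtain b where b: "b \<in> carrier R" "B = pr b" using B by auto
  define c where "c = (\<one> \<ominus> e) \<otimes> b"
  have cc: "c \<in> carrier R" using b ec by (simp add: c_def)
  obtain f where f: "f \<in> idempotents R" "e \<otimes> f = \<zero>" "f \<otimes> e = \<zero>" "pr f = pr c"
    "e \<oplus> f \<in> idempotents R" "A <+>\<^bsub>R\<^esub> B = pr (e \<oplus> f)"
    using set_add_idem[OF e(1) b(1)] e b by (metis c_def)
  have fc: "f \<in> carrier R" using f idempotentsD by auto
  have rf: "\<rho> f = \<rho> c" using rk_pr[OF fc] rk_pr[OF cc] f by simp
  have sum: "rk (A <+>\<^bsub>R\<^esub> B) = \<rho> e + \<rho> c"
    using rk_pr[of "e \<oplus> f"] ec fc f rho_add_orthogonal[OF e(1) f(1)] rf by simp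
  have cb: "\<rho> c \<le> \<rho> b" unfolding c_def using b ec by (intro rho_mult) auto
  show "rk (A <+>\<^bsub>R\<^esub> B) \<le> rk A + rk B"
    using sum cb e b ec by (simp add: rk_pr)
  assume dis: "A \<inter> B = {\<zero>}"
  obtain w where w: "w \<in> carrier R" "c \<otimes> w \<otimes> c = c" using quasi_inverse[OF cc] by blast
  \<comment> \<open>\<open>z\<close> is annihilated by \<open>1 - e\<close>, hence lies in
    \<open>A\<close> as well as in \<open>B\<close>; its vanishing recovers \<open>b\<close> as a
    left multiple of \<open>c\<close>.\<close>
  define z where "z = b \<otimes> w \<otimes> c \<ominus> b"
  have zc: "z \<in> carrier R" using b w cc by (simp add: z_def)
  have "(\<one> \<ominus> e) \<otimes> z = c \<otimes> w \<otimes> c \<ominus> c"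
    using b w cc ec by (simp add: z_def minus_eq r_distr r_minus m_assoc[symmetric] c_def)
  also have "\<dots> = \<zero>" using w cc by (simp add: minus_eq_zero_iff)
  finally have "e \<otimes> z = z" using zc ec by (simp add: mult_compl minus_eq_zero_iff)
  then have "z \<in> A" using zc e by (simp add: mem_pr_idem)
  moreover have "b \<otimes> (w \<otimes> c) \<in> B" "b \<in> B" using b w cc mem_pr_self by (auto simp: mem_pr)
  then have "z \<in> B" using PR_minus[OF B] b w cc by (simp add: z_def m_assoc)
  ultimately have "z = \<zero>" using dis by blast
  then have "b = b \<otimes> w \<otimes> c" using b w cc by (simp add: z_def minus_eq_zero_iff)
  then have "\<rho> b \<le> \<rho> c" using rho_mult(2)[of "b \<otimes> w" c] b w cc by simp
  then show "rk (A <+>\<^bsub>R\<^esub> B) = rk A + rk B"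
    using sum cb e b ec by (simp add: rk_pr)
qed

lemma rho_add: assumes "a \<in> carrier R" "b \<in> carrier R" shows "\<rho> (a \<oplus> b) \<le> \<rho> a + \<rho> b"
proof -
  have P: "pr a \<in> PR" "pr b \<in> PR" using assms by auto
  have "a \<oplus> b \<in> pr a <+>\<^bsub>R\<^esub> pr b" using assms mem_pr_self by (auto simp: mem_set_add)
  then have "pr (a \<oplus> b) \<subseteq> pr a <+>\<^bsub>R\<^esub> pr b"
    using assms by (subst pr_subset_iff) (auto intro: set_add_PR)
  then have "rk (pr (a \<oplus> b)) \<le> rk (pr a <+>\<^bsub>R\<^esub> pr b)"
    using assms by (intro rk_mono set_add_PR P) auto
  also have "\<dots> \<le> rk (pr a) + rk (pr b)" by (rule rk_set_add_le[OF P])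
  finally show ?thesis using assms by (simp add: rk_pr)
qed

lemma rho_neg: assumes "a \<in> carrier R" shows "\<rho> (\<ominus> a) = \<rho> a"
proof -
  have "\<ominus> \<one> \<otimes> a = \<ominus> a" "\<ominus> \<one> \<otimes> \<ominus> a = a" using assms by (simp_all add: l_minus r_minus)
  then show ?thesis using rho_mult(2)[of "\<ominus> \<one>" a] rho_mult(2)[of "\<ominus> \<one>" "\<ominus> a"] assms
    by (intro antisym) auto
qed

text \<open>Intersecting a complement of \<open>A\<close> with \<open>B\<close> works by modularity:
  for \<open>x\<close> in \<open>B\<close>, both components of
  \<open>x = e \<otimes> x \<oplus> (\<one> \<ominus> e) \<otimes> x\<close> stay in
  \<open>B\<close>, because \<open>e \<otimes> x\<close> lies in \<open>A\<close>.\<close>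

lemma relative_complement:
  assumes A: "A \<in> PR" and B: "B \<in> PR" and AB: "A \<subseteq> B"
  obtains A' where "A' \<in> PR" "A' \<subseteq> B" "A \<inter> A' = {\<zero>}" "A <+>\<^bsub>R\<^esub> A' = B" "rk A' = rk B - rk A"
proof -
  obtain e where e: "e \<in> idempotents R" "A = pr e" using PR_idem[OF A] .
  have ec: "e \<in> carrier R" using e idempotentsD by auto
  define A' where "A' = pr (\<one> \<ominus> e) \<inter> B"
  have A'PR: "A' \<in> PR" unfolding A'_def using ec by (intro Int_PR B) auto
  have dis: "A \<inter> A' = {\<zero>}"
    using pr_compl_disjoint[OF e(1)] PR_zero[OF A] PR_zero[OF A'PR] e(2)
    unfolding A'_def by blast
  have sum: "A <+>\<^bsub>R\<^esub> A' = B"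
  proof
    show "A <+>\<^bsub>R\<^esub> A' \<subseteq> B" using AB by (intro set_add_least B) (auto simp: A'_def)
    show "B \<subseteq> A <+>\<^bsub>R\<^esub> A'"
    proof
      fix x assume x: "x \<in> B"
      then have xc: "x \<in> carrier R" using PR_mem_carrier[OF B] by simp
      have ex: "e \<otimes> x \<in> A" using xc by (auto simp: e mem_pr)
      have "(\<one> \<ominus> e) \<otimes> x \<in> A'"
        using PR_minus[OF B x, of "e \<otimes> x"] ex AB xc ec
        unfolding A'_def by (auto simp: mem_pr) (auto simp: mult_compl)
      moreover have "x = e \<otimes> x \<oplus> (\<one> \<ominus> e) \<otimes> x"
        using xc ec l_distr[of e "\<one> \<ominus> e" x] add_compl[OF ec] by simp
      ultimately show "x \<in> A <+>\<^bsub>R\<^esub> A'" using ex unfolding mem_set_add by blast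
    qed
  qed
  show thesis
    using that[of A'] A'PR dis sum rk_set_add[OF A A'PR dis] by (simp add: A'_def)
qed

lemma rk_eqI: assumes "A \<in> PR" "B \<in> PR" "A \<subseteq> B" "rk A = rk B" shows "A = B"
proof -
  obtain A' where A': "A' \<in> PR" "A <+>\<^bsub>R\<^esub> A' = B" "rk A' = rk B - rk A"
    using relative_complement[OF assms(1-3)] by metis
  then have "A' = {\<zero>}" using assms rk_eq_0 by simp
  then have "A <+>\<^bsub>R\<^esub> A' \<subseteq> A" using PR_zero[OF assms(1)] by (intro set_add_least assms) auto
  then show ?thesis using A' assms by blast
qed

section \<open>Comparability of independent right ideals\<close>

text \<open>
  A \<open>link\<close> from \<open>P\<close> to \<open>Q\<close> is the graph of an isomorphism between submodules of the independent
  right ideals \<open>P\<close> and \<open>Q\<close>.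
\<close>

definition link :: "'a set \<Rightarrow> 'a set \<Rightarrow> 'a set \<Rightarrow> bool" where
  "link P Q X \<longleftrightarrow> X \<in> PR \<and> X \<subseteq> P <+>\<^bsub>R\<^esub> Q \<and> P \<inter> X = {\<zero>} \<and> Q \<inter> X = {\<zero>}"

lemma link_sym: "P \<in> PR \<Longrightarrow> Q \<in> PR \<Longrightarrow> link P Q X \<longleftrightarrow> link Q P X"
  by (auto simp: link_def set_add_comm)

text \<open>The independent sum of \<open>Q\<close> and the graph \<open>X\<close> lies in that of
  \<open>P\<close> and \<open>Q\<close>; cancelling \<open>rk Q\<close> bounds \<open>rk X\<close>.
  The premise that \<open>P\<close> lies in the sum of \<open>Q\<close> and \<open>X\<close> says
  that the isomorphism with graph \<open>X\<close> is defined on all of \<open>P\<close>.\<close>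

lemma link_rk:
  assumes P: "P \<in> PR" and Q: "Q \<in> PR" and PQ: "P \<inter> Q = {\<zero>}" and X: "link P Q X"
  shows "rk X \<le> rk P" "P \<subseteq> Q <+>\<^bsub>R\<^esub> X \<Longrightarrow> rk X = rk P"
proof -
  have X': "X \<in> PR" "X \<subseteq> P <+>\<^bsub>R\<^esub> Q" "Q \<inter> X = {\<zero>}" using X by (auto simp: link_def)
  have 1: "rk (Q <+>\<^bsub>R\<^esub> X) = rk Q + rk X" using rk_set_add[OF Q X'(1,3)] .
  have 2: "rk (P <+>\<^bsub>R\<^esub> Q) = rk P + rk Q" using rk_set_add[OF P Q PQ] .
  have 3: "Q <+>\<^bsub>R\<^esub> X \<subseteq> P <+>\<^bsub>R\<^esub> Q"
    by (intro set_add_least set_add_PR P Q X'(2) set_add_upper)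
  show le: "rk X \<le> rk P"
    using rk_mono[OF set_add_PR[OF Q X'(1)] set_add_PR[OF P Q] 3] 1 2 by simp
  assume "P \<subseteq> Q <+>\<^bsub>R\<^esub> X"
  then have "P <+>\<^bsub>R\<^esub> Q \<subseteq> Q <+>\<^bsub>R\<^esub> X"
    by (intro set_add_least set_add_PR Q X' set_add_upper)
  then show "rk X = rk P"
    using rk_mono[OF set_add_PR[OF P Q] set_add_PR[OF Q X'(1)]] 1 2 le by simp
qed

text \<open>The graph of left multiplication by an element of \<open>f R e\<close>, where \<open>P = eR\<close> and \<open>Q = fR\<close>.\<close>

lemma link_nonzero:
  assumes P: "P \<in> PR" and Q: "Q \<in> PR" and PQ: "P \<inter> Q = {\<zero>}"
    and nz: "P \<noteq> {\<zero>}" "Q \<noteq> {\<zero>}"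
  obtains X where "link P Q X" "X \<noteq> {\<zero>}"
proof -
  obtain e where e: "e \<in> idempotents R" "P = pr e" using PR_idem[OF P] .
  obtain f where f: "f \<in> idempotents R" "Q = pr f" using PR_idem[OF Q] .
  have c: "e \<in> carrier R" "f \<in> carrier R" "e \<otimes> e = e" "f \<otimes> f = f" using e f idempotentsD by auto
  have "e \<noteq> \<zero>" "f \<noteq> \<zero>" using nz e f pr_zero by auto
  then obtain x where x: "x \<in> carrier R" "f \<otimes> x \<otimes> e \<noteq> \<zero>" using prime[of f e] c by blast
  define t where "t = f \<otimes> x \<otimes> e"
  have t: "t \<in> carrier R" "t \<noteq> \<zero>" "f \<otimes> t = t" "t \<otimes> e = t"
    using x c by (simp_all add: t_def m_assoc[symmetric]) (simp add: m_assoc)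
  obtain w where w: "w \<in> carrier R" "t \<otimes> w \<otimes> t = t" using quasi_inverse[OF t(1)] by blast
  \<comment> \<open>\<open>u\<close> is an idempotent with \<open>t \<otimes> u = t\<close>, and
    \<open>u = e \<otimes> w \<otimes> t\<close> makes left multiplication by \<open>t\<close>
    injective on \<open>u R\<close>. The right ideal of \<open>g = u \<oplus> t\<close> is the graph
    of that restriction.\<close>
  define u where "u = e \<otimes> w \<otimes> t"
  have u: "u \<in> carrier R" "e \<otimes> u = u" "t \<otimes> u = t"
    using w t c by (simp_all add: u_def m_assoc[symmetric])
  have uu: "u \<otimes> u = u"
    using u w t c m_assoc[of "e \<otimes> w" t u] by (simp add: u_def)
  define g where "g = u \<oplus> t"
  have g: "g \<in> carrier R" using u t by (simp add: g_def)
  have z: "\<zero> \<in> pr g" using PR_zero g by simp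
  have uP: "u \<otimes> y \<in> P" "t \<otimes> y \<in> Q" if "y \<in> carrier R" for y
    using that e f u t c by (auto simp: mem_pr_idem m_assoc[symmetric])
  have dec: "g \<otimes> y = u \<otimes> y \<oplus> t \<otimes> y" if "y \<in> carrier R" for y
    using that u t by (simp add: g_def l_distr)
  have tuy: "t \<otimes> (u \<otimes> y) = t \<otimes> y" if "y \<in> carrier R" for y
    using that u t m_assoc[of t u y] by simp
  have "link P Q (pr g)"
    unfolding link_def
  proof (intro conjI)
    show "pr g \<in> PR" using g by simp
    show "pr g \<subseteq> P <+>\<^bsub>R\<^esub> Q"
    proof
      fix x assume "x \<in> pr g"
      then obtain y where "y \<in> carrier R" "x = g \<otimes> y" by (auto simp: mem_pr)
      then show "x \<in> P <+>\<^bsub>R\<^esub> Q"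
        using dec uP unfolding mem_set_add by blast
    qed
    have "g \<otimes> y = \<zero>" if y: "y \<in> carrier R" "g \<otimes> y \<in> P" for y
    proof -
      have "g \<otimes> y \<ominus> u \<otimes> y \<in> P" using PR_minus[OF P] y uP by blast
      moreover have "g \<otimes> y \<ominus> u \<otimes> y = t \<otimes> y"
        using y u t a_comm[of "u \<otimes> y" "t \<otimes> y"] by (simp add: dec minus_eq a_assoc r_neg)
      ultimately have ty: "t \<otimes> y = \<zero>" using uP[OF y(1)] PQ by auto
      have "u \<otimes> y = e \<otimes> w \<otimes> (t \<otimes> y)" using y w t c by (simp add: u_def m_assoc)
      then show ?thesis using ty dec y w c by simp
    qed
    then have "x = \<zero>" if "x \<in> P" "x \<in> pr g" for x using that unfolding mem_pr by blast
    then show "P \<inter> pr g = {\<zero>}" using PR_zero[OF P] z by blast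
    have "g \<otimes> y = \<zero>" if y: "y \<in> carrier R" "g \<otimes> y \<in> Q" for y
    proof -
      have "g \<otimes> y \<ominus> t \<otimes> y \<in> Q" using PR_minus[OF Q] y uP by blast
      moreover have "g \<otimes> y \<ominus> t \<otimes> y = u \<otimes> y"
        using y u t by (simp add: dec minus_eq a_assoc r_neg)
      ultimately have "u \<otimes> y = \<zero>" using uP[OF y(1)] PQ by auto
      then show ?thesis using tuy[OF y(1)] dec y t u by simp
    qed
    then have "x = \<zero>" if "x \<in> Q" "x \<in> pr g" for x using that unfolding mem_pr by blast
    then show "Q \<inter> pr g = {\<zero>}" using PR_zero[OF Q] z by blast
  qed
  moreover have "pr g \<noteq> {\<zero>}"
  proof
    assume "pr g = {\<zero>}"
    then have "u \<oplus> t = \<zero>" using mem_pr_self[OF g] by (simp add: g_def)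
    then have "t = \<ominus> u" using u(1) t(1) minus_equality[of t u] a_comm[of u t] by simp
    moreover have "u \<in> P" "t \<in> Q" using uP[of \<one>] u(1) t(1) by simp_all
    ultimately have "t \<in> P" using PR_neg[OF P] by simp
    then show False using \<open>t \<in> Q\<close> t(2) PQ by blast
  qed
  ultimately show thesis using that by blast
qed

text \<open>If \<open>x = p \<oplus> q\<close> lies in \<open>P'\<close> and in the graph, then
  \<open>q = x \<ominus> p\<close> lies in \<open>P' \<inter> Q\<close> and vanishes, so
  \<open>x\<close> already lies in \<open>P\<close>.\<close>

lemma link_mono:
  assumes PR: "P \<in> PR" "Q \<in> PR" "P' \<in> PR" and PP': "P \<subseteq> P'" "P' \<inter> Q = {\<zero>}" and X: "link P Q X"
  shows "link P' Q X"
proof -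
  have X': "X \<in> PR" "X \<subseteq> P <+>\<^bsub>R\<^esub> Q" "P \<inter> X = {\<zero>}" "Q \<inter> X = {\<zero>}" using X by (auto simp: link_def)
  have "x = \<zero>" if x: "x \<in> P'" "x \<in> X" for x
  proof -
    obtain p q where pq: "p \<in> P" "q \<in> Q" "x = p \<oplus> q"
      using subsetD[OF X'(2) x(2)] unfolding mem_set_add by blast
    have c: "p \<in> carrier R" "q \<in> carrier R"
      using PR_mem_carrier[OF PR(1) pq(1)] PR_mem_carrier[OF PR(2) pq(2)] .
    have "x \<ominus> p = q" using c a_comm[of p q] by (simp add: pq(3) minus_eq a_assoc r_neg)
    moreover have "x \<ominus> p \<in> P'" using PR_minus[OF PR(3) x(1)] pq(1) PP'(1) by blast
    ultimately have "q = \<zero>" using pq(2) PP'(2) by blast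
    then have "x \<in> P" using pq c by simp
    then show ?thesis using x X'(3) by blast
  qed
  then have "P' \<inter> X = {\<zero>}" using PR_zero[OF PR(3)] PR_zero[OF X'(1)] by blast
  moreover have "X \<subseteq> P' <+>\<^bsub>R\<^esub> Q" using X'(2) set_add_mono[OF PP'(1) subset_refl] by blast
  ultimately show ?thesis using X' by (simp add: link_def)
qed

text \<open>\<open>P2\<close> avoids the domain of the isomorphism with graph \<open>M\<close> and
  \<open>Q2\<close> avoids its image, so the two graphs add up to that of a larger isomorphism. The
  conclusion is one half of this; the other half follows by exchanging \<open>P\<close> and
  \<open>Q\<close>.\<close>

lemma link_extend:
  assumes PR: "P \<in> PR" "Q \<in> PR" and PQ: "P \<inter> Q = {\<zero>}" and M: "link P Q M"
    and P2: "P2 \<in> PR" "P2 \<subseteq> P" "P2 \<inter> (Q <+>\<^bsub>R\<^esub> M) = {\<zero>}"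
    and Q2: "Q2 \<in> PR" "Q2 \<subseteq> Q" "Q2 \<inter> (P <+>\<^bsub>R\<^esub> M) = {\<zero>}"
    and Y: "link P2 Q2 Y"
  shows "P \<inter> (M <+>\<^bsub>R\<^esub> Y) = {\<zero>}"
proof -
  have M': "M \<in> PR" "M \<subseteq> P <+>\<^bsub>R\<^esub> Q" "P \<inter> M = {\<zero>}" using M by (auto simp: link_def)
  have Y': "Y \<in> PR" "Y \<subseteq> P2 <+>\<^bsub>R\<^esub> Q2" "P2 \<inter> Y = {\<zero>}" using Y by (auto simp: link_def)
  have "z = \<zero>" if z: "z \<in> P" "z \<in> M <+>\<^bsub>R\<^esub> Y" for z
  proof -
    obtain m y where my: "m \<in> M" "y \<in> Y" "z = m \<oplus> y" using z(2) by (auto simp: mem_set_add)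
    obtain p q where pq: "p \<in> P" "q \<in> Q" "m = p \<oplus> q"
      using subsetD[OF M'(2) my(1)] unfolding mem_set_add by blast
    obtain p2 q2 where pq2: "p2 \<in> P2" "q2 \<in> Q2" "y = p2 \<oplus> q2"
      using subsetD[OF Y'(2) my(2)] unfolding mem_set_add by blast
    have c: "p \<in> carrier R" "q \<in> carrier R" "p2 \<in> carrier R" "q2 \<in> carrier R"
      using PR_mem_carrier[OF PR(1) pq(1)] PR_mem_carrier[OF PR(2) pq(2)]
        PR_mem_carrier[OF P2(1) pq2(1)] PR_mem_carrier[OF Q2(1) pq2(2)] .
    have "z = (p \<oplus> p2) \<oplus> (q \<oplus> q2)" using c by (simp add: my(3) pq(3) pq2(3) a_ac)
    then have "z \<ominus> (p \<oplus> p2) = q \<oplus> q2"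
      using c a_comm[of "p \<oplus> p2" "q \<oplus> q2"] a_assoc[of "q \<oplus> q2" "p \<oplus> p2" "\<ominus> (p \<oplus> p2)"]
      by (simp add: minus_eq r_neg)
    moreover have "z \<ominus> (p \<oplus> p2) \<in> P"
      using pq(1) pq2(1) P2(2) z(1) by (intro PR_minus PR_add PR(1)) auto
    moreover have "q \<oplus> q2 \<in> Q" using pq(2) pq2(2) Q2(2) by (intro PR_add PR(2)) auto
    \<comment> \<open>The \<open>Q\<close>-components cancel, so \<open>q2 = p \<ominus> m\<close>
      lies in the sum of \<open>P\<close> and \<open>M\<close>, which meets \<open>Q2\<close>
      trivially.\<close>
    ultimately have s: "q \<oplus> q2 = \<zero>" using PQ by auto
    then have "q2 = \<ominus> q" using c minus_equality[of q2 q] a_comm[of q q2] by simp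
    also have "\<dots> = p \<oplus> \<ominus> m"
      using c by (simp add: pq(3) minus_add a_assoc[symmetric] r_neg)
    finally have "q2 \<in> P <+>\<^bsub>R\<^esub> M" using pq(1) PR_neg[OF M'(1) my(1)] by (auto simp: mem_set_add)
    then have q2: "q2 = \<zero>" using pq2(2) Q2(3) by blast
    then have "q = \<zero>" using s c by simp
    then have "m = \<zero>" using pq c my(1) M'(3) by auto
    moreover have "y = \<zero>" using q2 pq2 c my(2) Y'(3) by auto
    ultimately show ?thesis using my(3) by simp
  qed
  then show ?thesis using PR_zero[OF PR(1)] PR_zero[OF set_add_PR[OF M'(1) Y'(1)]] by blast
qed

text \<open>Zorn's lemma gives a maximal link, as the lattice supremum of a chain of links is a link
  by \<open>lub_disjoint\<close>. Were neither the domain all of \<open>P\<close> nor the image all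
  of \<open>Q\<close>, a nonzero link between relative complements would enlarge it. Starting from
  \<open>X0\<close> lets later links extend earlier ones.\<close>

lemma link_comparability:
  assumes PR: "P \<in> PR" "Q \<in> PR" and PQ: "P \<inter> Q = {\<zero>}" and X0: "link P Q X0"
  obtains X where "link P Q X" "X0 \<subseteq> X" "P \<subseteq> Q <+>\<^bsub>R\<^esub> X \<or> Q \<subseteq> P <+>\<^bsub>R\<^esub> X"
proof -
  define \<A> where "\<A> = {X. link P Q X \<and> X0 \<subseteq> X}"
  have "\<exists>M\<in>\<A>. \<forall>X\<in>\<A>. M \<subseteq> X \<longrightarrow> X = M"
  proof (rule subset_Zorn)
    fix C assume "subset.chain \<A> C"
    then have CA: "C \<subseteq> \<A>" and ch: "\<And>A B. A \<in> C \<Longrightarrow> B \<in> C \<Longrightarrow> A \<subseteq> B \<or> B \<subseteq> A"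
      by (auto simp: subset_chain_def)
    show "\<exists>U\<in>\<A>. \<forall>X\<in>C. X \<subseteq> U"
    proof (cases "C = {}")
      case True then show ?thesis using X0 by (auto simp: \<A>_def)
    next
      case False
      have CP: "C \<subseteq> PR" using CA unfolding \<A>_def link_def by blast
      have "P \<inter> lub C = {\<zero>}" "Q \<inter> lub C = {\<zero>}"
        by (rule lub_disjoint[OF CP ch]; use PR CA in \<open>auto simp: \<A>_def link_def\<close>)+
      moreover have "lub C \<subseteq> P <+>\<^bsub>R\<^esub> Q"
        by (rule lub_least[OF CP set_add_PR[OF PR]]) (use CA in \<open>auto simp: \<A>_def link_def\<close>)
      moreover have "X0 \<subseteq> lub C"
      proof -
        obtain A where "A \<in> C" using False by blast
        then have "X0 \<subseteq> A" "A \<subseteq> lub C" using CA lub_upper[OF CP] by (auto simp: \<A>_def)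
        then show ?thesis by blast
      qed
      ultimately have "lub C \<in> \<A>" using lub_PR[OF CP] by (simp add: \<A>_def link_def)
      then show ?thesis using lub_upper[OF CP] by blast
    qed
  qed
  then obtain M where M: "link P Q M" "X0 \<subseteq> M"
    and Mmax: "\<And>X. link P Q X \<Longrightarrow> M \<subseteq> X \<Longrightarrow> X = M" by (auto simp: \<A>_def)
  have M': "M \<in> PR" using M by (simp add: link_def)
  have "P \<subseteq> Q <+>\<^bsub>R\<^esub> M \<or> Q \<subseteq> P <+>\<^bsub>R\<^esub> M"
  proof (rule ccontr)
    assume nc: "\<not> (P \<subseteq> Q <+>\<^bsub>R\<^esub> M \<or> Q \<subseteq> P <+>\<^bsub>R\<^esub> M)"
    have *: "\<exists>A'\<in>PR. A' \<subseteq> A \<and> A' \<inter> S = {\<zero>} \<and> A' \<noteq> {\<zero>}"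
      if AS: "A \<in> PR" "S \<in> PR" "\<not> A \<subseteq> S" for A S
    proof -
      obtain A' where A': "A' \<in> PR" "A' \<subseteq> A" "(S \<inter> A) \<inter> A' = {\<zero>}" "(S \<inter> A) <+>\<^bsub>R\<^esub> A' = A"
        by (rule relative_complement[OF Int_PR[OF AS(2,1)] AS(1)]) auto
      have "A' \<noteq> {\<zero>}"
      proof
        assume "A' = {\<zero>}"
        then have "(S \<inter> A) <+>\<^bsub>R\<^esub> A' \<subseteq> S \<inter> A"
          using PR_zero[OF Int_PR[OF AS(2,1)]] by (intro set_add_least Int_PR AS) auto
        then show False using A'(4) AS(3) by blast
      qed
      then show ?thesis using A' by blast
    qed
    obtain P2 where P2: "P2 \<in> PR" "P2 \<subseteq> P" "P2 \<inter> (Q <+>\<^bsub>R\<^esub> M) = {\<zero>}" "P2 \<noteq> {\<zero>}"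
      using *[OF PR(1) set_add_PR[OF PR(2) M']] nc by blast
    obtain Q2 where Q2: "Q2 \<in> PR" "Q2 \<subseteq> Q" "Q2 \<inter> (P <+>\<^bsub>R\<^esub> M) = {\<zero>}" "Q2 \<noteq> {\<zero>}"
      using *[OF PR(2) set_add_PR[OF PR(1) M']] nc by blast
    have dis2: "P2 \<inter> Q2 = {\<zero>}"
      using PQ P2(2) Q2(2) PR_zero[OF P2(1)] PR_zero[OF Q2(1)] by blast
    obtain Y where Y: "link P2 Q2 Y" "Y \<noteq> {\<zero>}"
      using link_nonzero[OF P2(1) Q2(1) dis2 P2(4) Q2(4)] .
    have Y': "Y \<in> PR" "Y \<subseteq> P2 <+>\<^bsub>R\<^esub> Q2" "P2 \<inter> Y = {\<zero>}" using Y(1) by (auto simp: link_def)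
    have QP: "Q \<inter> P = {\<zero>}" using PQ by blast
    have "P \<inter> (M <+>\<^bsub>R\<^esub> Y) = {\<zero>}"
      by (rule link_extend[OF PR PQ M(1) P2(1-3) Q2(1-3) Y(1)])
    moreover have "Q \<inter> (M <+>\<^bsub>R\<^esub> Y) = {\<zero>}"
      by (rule link_extend[OF PR(2,1) QP _ Q2(1-3) P2(1-3)])
        (use M(1) Y(1) link_sym PR P2(1) Q2(1) in auto)
    moreover have "M <+>\<^bsub>R\<^esub> Y \<subseteq> P <+>\<^bsub>R\<^esub> Q"
      using M(1) Y'(2) set_add_mono[OF P2(2) Q2(2)]
      by (intro set_add_least set_add_PR PR) (auto simp: link_def)
    ultimately have "link P Q (M <+>\<^bsub>R\<^esub> Y)"
      using set_add_PR[OF M' Y'(1)] by (simp add: link_def)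
    then have YM: "Y \<subseteq> M" using Mmax set_add_upper[OF M' Y'(1)] by blast
    \<comment> \<open>By maximality \<open>Y\<close> lies in \<open>M\<close>, so the
      \<open>Q2\<close>-component of \<open>y\<close> lies in the sum of \<open>P\<close> and
      \<open>M\<close> and vanishes; \<open>y\<close> is then in
      \<open>P2 \<inter> Y\<close>.\<close>
    have "y = \<zero>" if y: "y \<in> Y" for y
    proof -
      obtain p q where pq: "p \<in> P2" "q \<in> Q2" "y = p \<oplus> q"
        using subsetD[OF Y'(2) y] unfolding mem_set_add by blast
      have c: "p \<in> carrier R" "q \<in> carrier R"
        using PR_mem_carrier[OF P2(1) pq(1)] PR_mem_carrier[OF Q2(1) pq(2)] .
      have "q = \<ominus> p \<oplus> y" using c by (simp add: pq(3) a_assoc[symmetric] l_neg)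
      moreover have "\<ominus> p \<in> P" using PR_neg[OF P2(1) pq(1)] P2(2) by blast
      ultimately have "q \<in> P <+>\<^bsub>R\<^esub> M" using y YM by (auto simp: mem_set_add)
      then have "q = \<zero>" using pq(2) Q2(3) by blast
      then show ?thesis using pq c y Y'(3) by auto
    qed
    then show False using Y(2) PR_zero[OF Y'(1)] by blast
  qed
  then show thesis using that M by blast
qed

text \<open>
  Links between the \<open>P n\<close> and \<open>U\<close> are extended one after the other, and their supremum links the
  supremum of the \<open>P n\<close> to \<open>U\<close>.
\<close>

lemma rk_lub_le:
  fixes P :: "nat \<Rightarrow> 'a set"
  assumes P: "\<And>n. P n \<in> PR" "\<And>n. P n \<subseteq> P (Suc n)" and U: "U \<in> PR"
    and dis: "lub (range P) \<inter> U = {\<zero>}" and less: "\<And>n. rk (P n) < rk U"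
  shows "rk (lub (range P)) \<le> rk U"
proof -
  define H where "H = lub (range P)"
  have rP: "range P \<subseteq> PR" using P by blast
  have H: "H \<in> PR" unfolding H_def by (rule lub_PR[OF rP])
  have PH: "P n \<subseteq> H" for n unfolding H_def by (rule lub_upper[OF rP]) auto
  have PU: "P n \<inter> U = {\<zero>}" for n
    using dis PH[of n] PR_zero[OF P(1)] PR_zero[OF U] unfolding H_def by blast
  have extend: "\<exists>Y. (link (P n) U Y \<and> P n \<subseteq> U <+>\<^bsub>R\<^esub> Y) \<and> X \<subseteq> Y" if X: "link (P n) U X" for X n
  proof -
    obtain Y where Y: "link (P n) U Y" "X \<subseteq> Y" "P n \<subseteq> U <+>\<^bsub>R\<^esub> Y \<or> U \<subseteq> P n <+>\<^bsub>R\<^esub> Y"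
      using link_comparability[OF P(1) U PU X] by blast
    \<comment> \<open>A link that exhausts \<open>U\<close> has rank \<open>rk U\<close>, but its
      rank is at most \<open>rk (P n)\<close>, which is smaller. So comparability always decides for
      \<open>P n\<close>.\<close>
    have "\<not> U \<subseteq> P n <+>\<^bsub>R\<^esub> Y"
    proof
      assume "U \<subseteq> P n <+>\<^bsub>R\<^esub> Y"
      moreover have "U \<inter> P n = {\<zero>}" using PU by blast
      ultimately have "rk Y = rk U"
        using link_rk(2)[OF U P(1)] Y(1) link_sym[OF U P(1)] by blast
      then show False using link_rk(1)[OF P(1) U PU Y(1)] less[of n] by simp
    qed
    then show ?thesis using Y by blast
  qed
  have "link (P 0) U {\<zero>}"
    using zero_PR PR_zero[OF P(1)] PR_zero[OF U] PR_zero[OF set_add_PR[OF P(1) U]]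
    by (simp add: link_def)
  then have "\<exists>Y. link (P 0) U Y \<and> P 0 \<subseteq> U <+>\<^bsub>R\<^esub> Y" using extend by blast
  moreover have "\<exists>Y. (link (P (Suc n)) U Y \<and> P (Suc n) \<subseteq> U <+>\<^bsub>R\<^esub> Y) \<and> X \<subseteq> Y"
    if "link (P n) U X \<and> P n \<subseteq> U <+>\<^bsub>R\<^esub> X" for X n
    using that extend link_mono[OF P(1) U P(1) P(2) PU] by blast
  ultimately obtain X where X: "\<And>n. link (P n) U (X n)" "\<And>n. P n \<subseteq> U <+>\<^bsub>R\<^esub> X n"
    and Xs: "\<And>n. X n \<subseteq> X (Suc n)"
    using dependent_nat_choice[of "\<lambda>n Y. link (P n) U Y \<and> P n \<subseteq> U <+>\<^bsub>R\<^esub> Y" "\<lambda>n. (\<subseteq>)"] by metis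
  have rX: "range X \<subseteq> PR" using X(1) by (auto simp: link_def)
  have chain: "A \<subseteq> B \<or> B \<subseteq> A" if "A \<in> range X" "B \<in> range X" for A B
  proof -
    obtain m n where "A = X m" "B = X n" using \<open>A \<in> range X\<close> \<open>B \<in> range X\<close> by auto
    then show ?thesis using lift_Suc_mono_le[of X, OF Xs] linear[of m n] by blast
  qed
  have XH: "link H U (X n)" for n
    using link_mono[OF P(1) U H PH _ X(1)] dis by (simp add: H_def)
  define Z where "Z = lub (range X)"
  have Z: "Z \<in> PR" unfolding Z_def by (rule lub_PR[OF rX])
  have "U \<inter> Z = {\<zero>}" "H \<inter> Z = {\<zero>}"
    unfolding Z_def by (rule lub_disjoint[OF rX chain]; use U H XH in \<open>auto simp: link_def\<close>)+
  moreover have "Z \<subseteq> H <+>\<^bsub>R\<^esub> U"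
    unfolding Z_def
    by (rule lub_least[OF rX set_add_PR[OF H U]]) (use XH in \<open>auto simp: link_def\<close>)
  ultimately have lZ: "link H U Z" using Z by (simp add: link_def)
  have XZ: "X n \<subseteq> Z" for n unfolding Z_def by (rule lub_upper[OF rX]) auto
  have HZ: "H \<subseteq> U <+>\<^bsub>R\<^esub> Z"
    unfolding H_def
  proof (rule lub_least[OF rP set_add_PR[OF U Z]])
    fix A assume "A \<in> range P"
    then show "A \<subseteq> U <+>\<^bsub>R\<^esub> Z" using X(2) set_add_mono[OF subset_refl XZ] by blast
  qed
  have HU: "H \<inter> U = {\<zero>}" "U \<inter> H = {\<zero>}" using dis by (auto simp: H_def)
  have "rk H = rk Z" using link_rk(2)[OF H U HU(1) lZ HZ] by simp
  also have "\<dots> \<le> rk U" using link_rk(1)[OF U H HU(2)] lZ link_sym[OF U H] by blast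
  finally show ?thesis by (simp add: H_def)
qed

section \<open>Maximal nests\<close>

lemma rank_metric_space:
  assumes "A \<subseteq> carrier R" shows "Metric_space A (rank_metric R \<rho>)"
proof
  fix x y
  show "0 \<le> rank_metric R \<rho> x y" using rho_nonneg by (simp add: rank_metric_def)
  have "\<rho> (x \<ominus> y) = \<rho> (y \<ominus> x)" if "x \<in> carrier R" "y \<in> carrier R"
    using rho_neg[of "x \<ominus> y"] that by (simp add: minus_eq minus_add a_comm)
  then show "rank_metric R \<rho> x y = rank_metric R \<rho> y x" by (simp add: rank_metric_def)
next
  fix x y assume "x \<in> A" "y \<in> A"
  then have "x \<in> carrier R" "y \<in> carrier R" using assms by auto
  then show "rank_metric R \<rho> x y = 0 \<longleftrightarrow> x = y"
    by (simp add: rank_metric_def rho_eq_0_iff minus_eq_zero_iff)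
next
  fix x y z assume "x \<in> A" "y \<in> A" "z \<in> A"
  then have c: "x \<in> carrier R" "y \<in> carrier R" "z \<in> carrier R" using assms by auto
  have "x \<ominus> z = (x \<ominus> y) \<oplus> (y \<ominus> z)"
    using c a_assoc[of "\<ominus> y" y "\<ominus> z"] by (simp add: minus_eq a_assoc l_neg)
  then show "rank_metric R \<rho> x z \<le> rank_metric R \<rho> x y + rank_metric R \<rho> y z"
    using rho_add[of "x \<ominus> y" "y \<ominus> z"] c by (simp add: rank_metric_def)
qed

lemma idem_le_trans:
  assumes "e \<in> idempotents R" "f \<in> idempotents R" "g \<in> idempotents R"
    "idem_le R e f" "idem_le R f g"
  shows "idem_le R e g"
  using assms by (auto simp: idem_le_pr)

lemma idem_le_rho: "e \<in> carrier R \<Longrightarrow> f \<in> carrier R \<Longrightarrow> idem_le R e f \<Longrightarrow> \<rho> e \<le> \<rho> f"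
  using rho_mult(2)[of e f] by (simp add: idem_le_def)

lemma idem_le_rho_eq:
  assumes "e \<in> idempotents R" "f \<in> idempotents R" "idem_le R e f" "\<rho> f \<le> \<rho> e"
  shows "e = f"
proof -
  have c: "e \<in> carrier R" "f \<in> carrier R" using assms idempotentsD by auto
  have "\<rho> e = \<rho> f" using assms(4) idem_le_rho[OF c assms(3)] by simp
  then have "pr e = pr f"
    using c assms by (intro rk_eqI) (auto simp: rk_pr idem_le_pr)
  then have "f \<in> pr e" using mem_pr_self c by simp
  then have "e \<otimes> f = f" using assms by (simp add: mem_pr_idem)
  then show ?thesis using assms(3) by (simp add: idem_le_def)
qed

lemma idem_diff:
  assumes "e \<in> idempotents R" "f \<in> idempotents R" "idem_le R e f"
  shows "f \<ominus> e \<in> idempotents R" "\<rho> (f \<ominus> e) = \<rho> f - \<rho> e" "e \<oplus> (f \<ominus> e) = f"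
    "e \<otimes> (f \<ominus> e) = \<zero>" "(f \<ominus> e) \<otimes> e = \<zero>"
proof -
  have c: "e \<in> carrier R" "f \<in> carrier R" "e \<otimes> e = e" "f \<otimes> f = f" using assms idempotentsD by auto
  have l: "e \<otimes> f = e" "f \<otimes> e = e" using assms(3) by (auto simp: idem_le_def)
  show o: "e \<otimes> (f \<ominus> e) = \<zero>" "(f \<ominus> e) \<otimes> e = \<zero>"
    using c l by (simp_all add: minus_eq r_distr l_distr r_minus l_minus r_neg)
  show i: "f \<ominus> e \<in> idempotents R"
    using c l o by (simp add: idempotents_def) (simp add: minus_eq l_distr l_minus r_distr r_minus l_neg)
  show s: "e \<oplus> (f \<ominus> e) = f"
    using c a_lcomm[of e f "\<ominus> e"] by (simp add: minus_eq r_neg)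
  show "\<rho> (f \<ominus> e) = \<rho> f - \<rho> e" using rho_add_orthogonal[OF assms(1) i o] s by simp
qed

lemma idem_le_compl:
  assumes "e \<in> idempotents R" "f \<in> idempotents R"
  shows "idem_le R (\<one> \<ominus> f) (\<one> \<ominus> e) \<longleftrightarrow> idem_le R e f"
  using idempotentsD[OF assms(1)] idempotentsD[OF assms(2)]
  by (auto simp: idem_le_pr assms idem_compl(1) compl_compl)

lemma rho_compl: "e \<in> idempotents R \<Longrightarrow> \<rho> (\<one> \<ominus> e) = 1 - \<rho> e"
  using idem_diff(2)[of e \<one>] idempotentsD(1)[of e] rho_one
  by (simp add: idem_le_def idempotents_def)

section \<open>Order and rank along a maximal nest\<close>

lemma nest_idem: "maximal_nest R E \<Longrightarrow> e \<in> E \<Longrightarrow> e \<in> idempotents R"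
  by (auto simp: maximal_nest_def nest_def)

lemma nest_carrier: "maximal_nest R E \<Longrightarrow> e \<in> E \<Longrightarrow> e \<in> carrier R"
  using nest_idem idempotentsD by blast

lemma nest_linear: "maximal_nest R E \<Longrightarrow> e \<in> E \<Longrightarrow> f \<in> E \<Longrightarrow> idem_le R e f \<or> idem_le R f e"
  by (auto simp: maximal_nest_def nest_def)

text \<open>Comparable idempotents of equal rank coincide (\<open>idem_le_rho_eq\<close>), so the
  rank is injective on a nest and determines its order.\<close>

lemma nest_rho_le:
  assumes "maximal_nest R E" "e \<in> E" "f \<in> E" shows "idem_le R e f \<longleftrightarrow> \<rho> e \<le> \<rho> f"
proof
  show "idem_le R e f \<Longrightarrow> \<rho> e \<le> \<rho> f" using idem_le_rho nest_carrier assms by blast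
  assume le: "\<rho> e \<le> \<rho> f"
  show "idem_le R e f"
    using nest_linear[OF assms] idem_le_rho_eq[OF _ _ _ le] nest_idem assms by blast
qed

lemma nest_memI:
  assumes E: "maximal_nest R E" and x: "x \<in> idempotents R"
    and comp: "\<And>e. e \<in> E \<Longrightarrow> idem_le R x e \<or> idem_le R e x"
  shows "x \<in> E"
proof -
  have "idem_le R x x" using x by (simp add: idem_le_def idempotents_def)
  then have "nest R (insert x E)"
    using E x comp by (auto simp: maximal_nest_def nest_def)
  then show ?thesis using E unfolding maximal_nest_def by blast
qed

text \<open>A supremum of idempotents needs both families of ideals: the supremum \<open>J\<close>
  of the \<open>c R\<close> and the intersection \<open>K\<close> of the \<open>(1 - c) R\<close>.
  Upper continuity makes them independent, lower continuity makes them span \<open>R\<close>, and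
  \<open>complementary_idem\<close> returns an idempotent with these two ideals.\<close>

lemma nest_Sup:
  assumes E: "maximal_nest R E" and C: "C \<subseteq> E"
  obtains s where "s \<in> E" "\<And>c. c \<in> C \<Longrightarrow> idem_le R c s"
    "\<And>f. f \<in> E \<Longrightarrow> (\<And>c. c \<in> C \<Longrightarrow> idem_le R c f) \<Longrightarrow> idem_le R s f"
    "pr s = lub (pr ` C)"
proof -
  have Ci: "c \<in> idempotents R" "c \<in> carrier R" if "c \<in> C" for c
    using that C nest_idem[OF E] nest_carrier[OF E] by auto
  have lin: "idem_le R c d \<or> idem_le R d c" if "c \<in> C" "d \<in> C" for c d
    using that C nest_linear[OF E] by blast
  define K where "K = carrier R \<inter> \<Inter>((\<lambda>c. pr (\<one> \<ominus> c)) ` C)"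
  define J where "J = lub (pr ` C)"
  have P1: "pr ` C \<subseteq> PR" using Ci by blast
  have P2: "(\<lambda>c. pr (\<one> \<ominus> c)) ` C \<subseteq> PR" using Ci by blast
  have ch1: "A \<subseteq> B \<or> B \<subseteq> A" if AB: "A \<in> pr ` C" "B \<in> pr ` C" for A B
  proof -
    obtain c d where "c \<in> C" "d \<in> C" "A = pr c" "B = pr d" using AB by blast
    then show ?thesis using lin[of c d] Ci idem_le_pr by blast
  qed
  have ch2: "A \<subseteq> B \<or> B \<subseteq> A"
    if AB: "A \<in> (\<lambda>c. pr (\<one> \<ominus> c)) ` C" "B \<in> (\<lambda>c. pr (\<one> \<ominus> c)) ` C" for A B
  proof -
    obtain c d where "c \<in> C" "d \<in> C" "A = pr (\<one> \<ominus> c)" "B = pr (\<one> \<ominus> d)" using AB by blast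
    then show ?thesis using lin[of c d] Ci idem_le_pr by blast
  qed
  have J: "J \<in> PR" unfolding J_def by (rule lub_PR[OF P1])
  have K: "K \<in> PR" unfolding K_def by (rule Inter_PR[OF P2])
  have "K \<inter> J = {\<zero>}"
    unfolding J_def
  proof (rule lub_disjoint[OF P1 ch1 K])
    fix A assume "A \<in> pr ` C"
    then obtain c where c: "c \<in> C" "A = pr c" by blast
    have "pr c \<inter> pr (\<one> \<ominus> c) = {\<zero>}" using pr_compl_disjoint Ci c by blast
    moreover have "K \<subseteq> pr (\<one> \<ominus> c)" using c unfolding K_def by blast
    moreover have "A \<in> PR" using c Ci by blast
    ultimately show "K \<inter> A = {\<zero>}" using PR_zero[OF K] PR_zero c by blast
  qed
  then have dis: "J \<inter> K = {\<zero>}" by blast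
  have "J <+>\<^bsub>R\<^esub> K = carrier R"
    unfolding K_def
  proof (rule Inter_codisjoint[OF P2 ch2 J])
    fix A assume "A \<in> (\<lambda>c. pr (\<one> \<ominus> c)) ` C"
    then obtain c where c: "c \<in> C" "A = pr (\<one> \<ominus> c)" by blast
    have A: "A \<in> PR" using c Ci P2 by blast
    have "pr c \<subseteq> J" unfolding J_def using c by (intro lub_upper[OF P1]) auto
    then have "carrier R \<subseteq> J <+>\<^bsub>R\<^esub> A"
      using set_add_mono[of "pr c" J A A] pr_compl_sum[of c] Ci c by auto
    then show "J <+>\<^bsub>R\<^esub> A = carrier R" using PR_carrier[OF set_add_PR[OF J A]] by blast
  qed
  then obtain s where s: "s \<in> idempotents R" "J = pr s" "K = pr (\<one> \<ominus> s)"
    using complementary_idem[OF J K dis] by metis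
  have up: "idem_le R c s" if "c \<in> C" for c
  proof -
    have "pr c \<subseteq> J" unfolding J_def using that by (intro lub_upper[OF P1]) auto
    moreover have "K \<subseteq> pr (\<one> \<ominus> c)" using that unfolding K_def by blast
    ultimately show ?thesis using s Ci that by (simp add: idem_le_pr)
  qed
  have least: "idem_le R s f" if f: "f \<in> idempotents R" "\<And>c. c \<in> C \<Longrightarrow> idem_le R c f" for f
  proof -
    have fc: "f \<in> carrier R" using f idempotentsD by auto
    have le: "pr c \<subseteq> pr f \<and> pr (\<one> \<ominus> f) \<subseteq> pr (\<one> \<ominus> c)" if "c \<in> C" for c
      using f(2)[OF that] idem_le_pr[OF Ci(1)[OF that] f(1)] by blast
    have "J \<subseteq> pr f" unfolding J_def by (rule lub_least[OF P1]) (use fc le in auto)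
    moreover have "pr (\<one> \<ominus> f) \<subseteq> K"
      using le PR_carrier[of "pr (\<one> \<ominus> f)"] fc unfolding K_def by auto
    ultimately show ?thesis using s f by (simp add: idem_le_pr)
  qed
  have "s \<in> E"
  proof (rule nest_memI[OF E s(1)])
    fix e assume e: "e \<in> E"
    have ei: "e \<in> idempotents R" using e nest_idem[OF E] by blast
    show "idem_le R s e \<or> idem_le R e s"
    proof (cases "\<forall>c\<in>C. idem_le R c e")
      case True then show ?thesis using least[OF ei] by blast
    next
      case False
      then obtain c where c: "c \<in> C" "idem_le R e c" using nest_linear[OF E e] C by blast
      then show ?thesis using idem_le_trans[OF ei Ci(1) s(1)] up by blast
    qed
  qed
  then show thesis using that up least nest_idem[OF E] s(2) J_def by blast
qed

text \<open>Suppose the rank jumped from \<open>t\<close>, the supremum of the ranks on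
  \<open>C\<close>, to \<open>\<rho> s\<close>. Then some difference \<open>u\<close> of two members
  of \<open>C\<close> has rank below the jump, and above some member \<open>c2\<close> the ranks on
  \<open>C\<close> grow by less than \<open>\<rho> u\<close>. By \<open>rk_lub_le\<close> the whole
  part above \<open>c2\<close> contributes at most \<open>\<rho> u\<close>, so
  \<open>\<rho> s \<le> \<rho> c2 + \<rho> u < \<rho> s\<close>.\<close>

lemma nest_Sup_rho:
  assumes E: "maximal_nest R E" and C: "C \<subseteq> E" and s: "s \<in> E" "\<And>c. c \<in> C \<Longrightarrow> idem_le R c s"
    "pr s = lub (pr ` C)" and r: "0 \<le> r" "\<And>c. c \<in> C \<Longrightarrow> \<rho> c \<le> r"
  shows "\<rho> s \<le> r"
proof (rule ccontr)
  assume "\<not> \<rho> s \<le> r"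
  then have rs: "r < \<rho> s" by simp
  have Cc: "c \<in> carrier R" "c \<in> idempotents R" if "c \<in> C" for c
    using that C nest_carrier[OF E] nest_idem[OF E] by auto
  have sc: "s \<in> carrier R" "s \<in> idempotents R" using s nest_carrier[OF E] nest_idem[OF E] by auto
  have P1: "pr ` C \<subseteq> PR" using Cc by blast
  have lin: "idem_le R c d \<longleftrightarrow> \<rho> c \<le> \<rho> d" if "c \<in> C" "d \<in> C" for c d
    using nest_rho_le[OF E] that C by blast
  \<comment> \<open>The supremum of the empty set is \<open>\<zero>\<close>, of rank
    \<open>0\<close>; this is where \<open>0 \<le> r\<close> enters.\<close>
  have ne: "C \<noteq> {}"
  proof
    assume "C = {}"
    then have "pr s \<subseteq> {\<zero>}" using s(3) lub_least[OF P1 zero_PR] by simp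
    then have "s = \<zero>" using mem_pr_self[OF sc(1)] by blast
    then show False using rs r(1) rho_zero by simp
  qed
  define t where "t = (SUP c\<in>C. \<rho> c)"
  have bdd: "bdd_above (\<rho> ` C)" using r(2) by (intro bdd_aboveI[of _ r]) auto
  have ct: "\<rho> c \<le> t" if "c \<in> C" for c unfolding t_def by (rule cSUP_upper[OF that bdd])
  have tr: "t \<le> r" unfolding t_def by (rule cSUP_least[OF ne r(2)])
  have approx: "\<exists>c\<in>C. x < \<rho> c" if "x < t" for x
    using that less_cSUP_iff[OF ne bdd] unfolding t_def by blast
  \<comment> \<open>A member of rank \<open>t\<close> would be the largest element of
    \<open>C\<close> and hence its supremum, so there would be no jump.\<close>
  have lt: "\<rho> c < t" if c: "c \<in> C" for c
  proof (rule ccontr)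
    assume "\<not> \<rho> c < t"
    then have ct': "\<rho> c = t" using ct[OF c] by simp
    have "pr d \<subseteq> pr c" if "d \<in> C" for d
      using lin[OF that c] ct[OF that] ct' Cc that c idem_le_pr by blast
    then have "pr s \<subseteq> pr c" unfolding s(3) using Cc[OF c] by (intro lub_least[OF P1]) auto
    then have "\<rho> s \<le> \<rho> c" by (rule rho_mono[OF sc(1) Cc(1)[OF c]])
    then show False using ct' tr rs by simp
  qed
  \<comment> \<open>\<open>c0\<close> is closer to \<open>t\<close> than the height
    \<open>\<rho> s - t\<close> of the jump, so \<open>u = c1 \<ominus> c0\<close> has rank below
    the jump; \<open>c2\<close> is then chosen closer to \<open>t\<close> than
    \<open>\<rho> u\<close>.\<close>
  obtain c0 where c0: "c0 \<in> C" "t - (\<rho> s - t) < \<rho> c0" using approx[of "t - (\<rho> s - t)"] tr rs by auto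
  obtain c1 where c1: "c1 \<in> C" "\<rho> c0 < \<rho> c1" using approx lt[OF c0(1)] by blast
  have le01: "idem_le R c0 c1" using lin c0 c1 by simp
  define u where "u = c1 \<ominus> c0"
  note u = idem_diff[OF Cc(2)[OF c0(1)] Cc(2)[OF c1(1)] le01, folded u_def]
  have uc: "u \<in> carrier R" using u(1) idempotentsD by blast
  obtain c2 where c2: "c2 \<in> C" "max (\<rho> c1) (t - \<rho> u) < \<rho> c2"
    using approx[of "max (\<rho> c1) (t - \<rho> u)"] lt[OF c1(1)] u(2) c1(2) by auto
  \<comment> \<open>A sequence in \<open>C\<close> above \<open>c2\<close> that is cofinal because
    its ranks tend to \<open>t\<close>. It replaces the chain \<open>C\<close>, of arbitrary order
    type, by a countable one along which links can be extended successively.\<close>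
  have "\<exists>d. d \<in> C \<and> \<rho> c2 \<le> \<rho> d \<and> t - 1 / Suc 0 < \<rho> d"
    using approx[of "max (\<rho> c2) (t - 1)"] lt[OF c2(1)] by auto
  moreover have "\<exists>d'. (d' \<in> C \<and> \<rho> c2 \<le> \<rho> d' \<and> t - 1 / Suc (Suc n) < \<rho> d') \<and> \<rho> d \<le> \<rho> d'"
    if "d \<in> C \<and> \<rho> c2 \<le> \<rho> d \<and> t - 1 / Suc n < \<rho> d" for d n
    using approx[of "max (\<rho> d) (t - 1 / Suc (Suc n))"] lt[of d] that
    by (auto simp del: of_nat_Suc)
  ultimately obtain d :: "nat \<Rightarrow> 'a" where d: "\<And>n. d n \<in> C" "\<And>n. \<rho> c2 \<le> \<rho> (d n)"
      "\<And>n. t - 1 / Suc n < \<rho> (d n)" "\<And>n. \<rho> (d n) \<le> \<rho> (d (Suc n))"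
    using dependent_nat_choice[of "\<lambda>n d. d \<in> C \<and> \<rho> c2 \<le> \<rho> d \<and> t - 1 / Suc n < \<rho> d" "\<lambda>n d d'. \<rho> d \<le> \<rho> d'"]
    by metis
  define P where "P n = pr (d n \<ominus> c2)" for n
  have le2: "idem_le R c2 (d n)" for n using lin[OF c2(1) d(1)] d(2) by simp
  note dd = idem_diff[OF Cc(2)[OF c2(1)] Cc(2)[OF d(1)] le2]
  have dc: "d n \<ominus> c2 \<in> carrier R" for n using Cc d c2 by simp
  have PPR: "P n \<in> PR" for n using dc by (simp add: P_def)
  have Psub: "P n \<subseteq> P (Suc n)" for n
  proof -
    have le: "d (Suc n) \<otimes> d n = d n" using lin[OF d(1)[of n] d(1)[of "Suc n"]] d(4)[of n] by (simp add: idem_le_def)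
    have "(d (Suc n) \<ominus> c2) \<otimes> (d n \<ominus> c2) = d (Suc n) \<otimes> (d n \<ominus> c2) \<ominus> c2 \<otimes> (d n \<ominus> c2)"
      using Cc d(1) c2(1) dc by (simp add: minus_eq l_distr l_minus)
    also have "\<dots> = d n \<ominus> c2"
      using dd(4)[of n] le le2[of "Suc n"] Cc d(1) c2(1)
      by (simp add: idem_le_def) (simp add: minus_eq r_distr r_minus)
    finally have "d n \<ominus> c2 \<in> P (Suc n)"
      using dc by (simp add: P_def mem_pr_idem[OF dd(1)])
    then show ?thesis
      using dc[of n] PPR[of "Suc n"] unfolding P_def[of n] by (subst pr_subset_iff) auto
  qed
  define T where "T = lub (range P)"
  have rP: "range P \<subseteq> PR" using PPR by blast
  have T: "T \<in> PR" unfolding T_def by (rule lub_PR[OF rP])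
  have c2i: "c2 \<in> idempotents R" "c2 \<in> carrier R" using Cc c2 by auto
  \<comment> \<open>\<open>u R\<close> lies in \<open>c2 R\<close> while the tail \<open>T\<close>
    lies in \<open>(1 - c2) R\<close>, so the two are independent, as \<open>rk_lub_le\<close>
    requires.\<close>
  have Uc2: "pr u \<subseteq> pr c2"
  proof -
    have "c2 \<otimes> c1 = c1" "c2 \<otimes> c0 = c0"
      using lin[OF c1(1) c2(1)] lin[OF c0(1) c2(1)] c2(2) c1(2) by (auto simp: idem_le_def)
    then have "c2 \<otimes> u = u" using Cc c0 c1 c2i by (simp add: u_def minus_eq r_distr r_minus)
    then show ?thesis using uc c2i by (subst pr_subset_iff) (auto simp: mem_pr_idem)
  qed
  have "T \<subseteq> pr (\<one> \<ominus> c2)"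
    unfolding T_def
  proof (rule lub_least[OF rP])
    fix A assume "A \<in> range P"
    then obtain n where n: "A = P n" by blast
    have "pr (d n \<ominus> c2) \<subseteq> pr (\<one> \<ominus> c2)"
      using dc[of n] c2i dd(4)[of n] by (subst pr_subset_iff) (auto simp: mem_pr_compl)
    then show "A \<subseteq> pr (\<one> \<ominus> c2)" by (simp add: n P_def)
  qed (use c2i in simp)
  then have TU: "lub (range P) \<inter> pr u = {\<zero>}"
    using Uc2 pr_compl_disjoint[OF c2i(1)] PR_zero[OF T] PR_zero[of "pr u"] uc
    unfolding T_def by blast
  have rkP: "rk (P n) < rk (pr u)" for n
    using rk_pr[OF dc[of n]] dd(2)[of n] lt[OF d(1)[of n]] c2(2) rk_pr[OF uc]
    by (simp add: P_def)
  have rkT: "rk T \<le> rk (pr u)"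
    unfolding T_def using uc by (intro rk_lub_le PPR Psub TU rkP) auto
  have c2T: "pr c2 <+>\<^bsub>R\<^esub> T \<in> PR" using c2i by (intro set_add_PR T) auto
  have "pr s \<subseteq> pr c2 <+>\<^bsub>R\<^esub> T"
    unfolding s(3)
  proof (rule lub_least[OF P1 c2T])
    fix A assume "A \<in> pr ` C"
    then obtain c where c: "c \<in> C" "A = pr c" by blast
    obtain n where n: "1 / Suc n < t - \<rho> c"
      using lt[OF c(1)] nat_approx_posE[of "t - \<rho> c"] by auto
    have "idem_le R c (d n)" using lin[OF c(1) d(1)] d(3)[of n] n by simp
    then have "A \<subseteq> pr (d n)" using c Cc d(1) idem_le_pr by blast
    also have "\<dots> \<subseteq> pr c2 <+>\<^bsub>R\<^esub> T"
    proof -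
      have "P n \<subseteq> T" unfolding T_def by (rule lub_upper[OF rP]) auto
      then have "d n \<ominus> c2 \<in> T" using mem_pr_self[OF dc] unfolding P_def by blast
      then have "d n \<in> pr c2 <+>\<^bsub>R\<^esub> T"
        using dd(3)[of n] mem_pr_self[OF c2i(2)] unfolding mem_set_add by metis
      then show ?thesis using Cc d(1) c2T by (subst pr_subset_iff) auto
    qed
    finally show "A \<subseteq> pr c2 <+>\<^bsub>R\<^esub> T" .
  qed
  then have "\<rho> s \<le> rk (pr c2 <+>\<^bsub>R\<^esub> T)" using rk_mono[OF _ c2T, of "pr s"] rk_pr[OF sc(1)] sc(1) by auto
  also have "\<dots> \<le> \<rho> c2 + rk T" using rk_set_add_le[OF _ T, of "pr c2"] c2i rk_pr by auto
  also have "\<dots> \<le> \<rho> c2 + \<rho> u" using rkT rk_pr[OF uc] by simp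
  finally show False using u(2) c0(2) lt[OF c1(1)] lt[OF c2(1)] by simp
qed

text \<open>Taking complements reverses the order of idempotents; it turns the results on suprema
  into results on infima.\<close>

lemma maximal_nest_compl:
  assumes E: "maximal_nest R E" shows "maximal_nest R ((\<lambda>e. \<one> \<ominus> e) ` E)"
proof -
  have Ei: "e \<in> idempotents R" if "e \<in> E" for e using nest_idem[OF E that] .
  have "nest R ((\<lambda>e. \<one> \<ominus> e) ` E)"
    using nest_linear[OF E] by (auto simp: nest_def Ei idem_le_compl idem_compl(1))
  moreover have "E' = (\<lambda>e. \<one> \<ominus> e) ` E" if E': "nest R E'" "(\<lambda>e. \<one> \<ominus> e) ` E \<subseteq> E'" for E'
  proof
    have E'i: "x \<in> idempotents R" if "x \<in> E'" for x using E' that by (auto simp: nest_def)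
    show "E' \<subseteq> (\<lambda>e. \<one> \<ominus> e) ` E"
    proof
      fix x assume x: "x \<in> E'"
      have xi: "x \<in> idempotents R" using E'i[OF x] .
      have xc: "x = \<one> \<ominus> (\<one> \<ominus> x)" using compl_compl idempotentsD(1)[OF xi] by simp
      have "\<one> \<ominus> x \<in> E"
      proof (rule nest_memI[OF E idem_compl(1)[OF xi]])
        fix e assume e: "e \<in> E"
        then have "idem_le R x (\<one> \<ominus> e) \<or> idem_le R (\<one> \<ominus> e) x" using E' x by (auto simp: nest_def)
        then show "idem_le R (\<one> \<ominus> x) e \<or> idem_le R e (\<one> \<ominus> x)"
          using idem_le_compl[OF idem_compl(1)[OF xi] Ei[OF e]] idem_le_compl[OF Ei[OF e] idem_compl(1)[OF xi]]
            xc by auto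
      qed
      then show "x \<in> (\<lambda>e. \<one> \<ominus> e) ` E" using xc by blast
    qed
  qed (use E' in blast)
  ultimately show ?thesis by (simp add: maximal_nest_def)
qed

lemma nest_Inf:
  assumes E: "maximal_nest R E" and C: "C \<subseteq> E"
  obtains s where "s \<in> E" "\<And>c. c \<in> C \<Longrightarrow> idem_le R s c"
    "\<And>f. f \<in> E \<Longrightarrow> (\<And>c. c \<in> C \<Longrightarrow> idem_le R f c) \<Longrightarrow> idem_le R f s"
    "\<And>r. r \<le> 1 \<Longrightarrow> (\<And>c. c \<in> C \<Longrightarrow> r \<le> \<rho> c) \<Longrightarrow> r \<le> \<rho> s"
proof -
  let ?c = "\<lambda>e. \<one> \<ominus> e"
  note E' = maximal_nest_compl[OF E]
  have Ei: "e \<in> idempotents R" if "e \<in> E" for e using nest_idem[OF E that] .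
  have C': "?c ` C \<subseteq> ?c ` E" using C by blast
  obtain s' where s': "s' \<in> ?c ` E" "\<And>c. c \<in> ?c ` C \<Longrightarrow> idem_le R c s'"
    "\<And>f. f \<in> ?c ` E \<Longrightarrow> (\<And>c. c \<in> ?c ` C \<Longrightarrow> idem_le R c f) \<Longrightarrow> idem_le R s' f"
    "pr s' = lub (pr ` ?c ` C)"
    using nest_Sup[OF E' C'] by metis
  obtain s where s: "s \<in> E" "s' = \<one> \<ominus> s" using s'(1) by blast
  show thesis
  proof (rule that[OF s(1)])
    show "idem_le R s c" if "c \<in> C" for c
      using s'(2)[of "?c c"] that s C Ei by (simp add: idem_le_compl subset_iff)
    show "idem_le R f s" if f: "f \<in> E" "\<And>c. c \<in> C \<Longrightarrow> idem_le R f c" for f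
    proof -
      have "idem_le R s' (?c f)"
      proof (rule s'(3))
        fix c assume "c \<in> ?c ` C"
        then obtain d where "d \<in> C" "c = ?c d" by blast
        then show "idem_le R c (?c f)" using f C Ei by (simp add: idem_le_compl subset_iff)
      qed (use f in blast)
      then show ?thesis using s f Ei by (simp add: idem_le_compl)
    qed
    show "r \<le> \<rho> s" if r: "r \<le> 1" "\<And>c. c \<in> C \<Longrightarrow> r \<le> \<rho> c" for r
    proof -
      have "\<rho> s' \<le> 1 - r"
        using r(1) by (intro nest_Sup_rho[OF E' C' s'(1,2,4)])
          (use r C Ei in \<open>auto simp: rho_compl subset_iff\<close>)
      then show ?thesis using s Ei by (simp add: rho_compl)
    qed
  qed
qed

text \<open>Primeness yields a nonzero \<open>a = h \<otimes> y \<otimes> x\<close> in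
  \<open>h R\<close>; minimality forces \<open>a R = h R\<close>, and
  \<open>\<rho> a \<le> \<rho> x\<close>.\<close>

lemma minimal_idempotent_rho:
  assumes h: "h \<in> idempotents R" "h \<noteq> \<zero>"
    and min: "\<And>h'. h' \<in> idempotents R \<Longrightarrow> idem_le R h' h \<Longrightarrow> h' \<noteq> \<zero> \<Longrightarrow> h' = h"
    and x: "x \<in> carrier R" "x \<noteq> \<zero>"
  shows "\<rho> h \<le> \<rho> x"
proof -
  have hc: "h \<in> carrier R" "h \<otimes> h = h" using idempotentsD h by auto
  obtain y where y: "y \<in> carrier R" "h \<otimes> y \<otimes> x \<noteq> \<zero>" using prime[of h x] hc x h(2) by blast
  define a where "a = h \<otimes> y \<otimes> x"
  have ac: "a \<in> carrier R" "a \<noteq> \<zero>" using y hc x by (auto simp: a_def)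
  have "pr a \<in> PR" using ac by simp
  then obtain e where e: "e \<in> idempotents R" "pr a = pr e" using PR_idem by blast
  have ec: "e \<in> carrier R" "e \<otimes> e = e" using idempotentsD e by auto
  have "h \<otimes> a = a" using hc y x by (simp add: a_def m_assoc[symmetric])
  then have "pr a \<subseteq> pr h" using ac hc h by (subst pr_subset_iff) (auto simp: mem_pr_idem)
  then have "e \<in> pr h" using e mem_pr_self[OF ec(1)] by auto
  then have he: "h \<otimes> e = e" using h by (simp add: mem_pr_idem)
  \<comment> \<open>Only \<open>h \<otimes> e = e\<close> is known, so \<open>e\<close> need not be
    below \<open>h\<close>; the product \<open>e \<otimes> h\<close> generates the same right ideal
    and is below \<open>h\<close> on both sides.\<close>
  define h' where "h' = e \<otimes> h"
  have h'c: "h' \<in> carrier R" using ec hc by (simp add: h'_def)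
  have h'e: "h' \<otimes> e = e" using he ec hc by (simp add: h'_def m_assoc)
  have "h' \<otimes> h' = h'" using h'e ec hc m_assoc[OF h'c ec(1) hc(1)] by (simp add: h'_def)
  moreover have "h' \<otimes> h = h'" "h \<otimes> h' = h'"
    using ec hc he by (simp_all add: h'_def m_assoc) (simp add: m_assoc[symmetric])
  moreover have "e \<noteq> \<zero>" using e ac pr_zero mem_pr_self[OF ac(1)] by auto
  then have "h' \<noteq> \<zero>" using h'e ec by auto
  ultimately have "h' = h" using min[of h'] h'c by (simp add: idempotents_def idem_le_def)
  then have "h \<in> pr a" using e hc by (simp add: mem_pr_idem[OF e(1)] h'_def)
  then have "pr h \<subseteq> pr a" using hc ac by (subst pr_subset_iff) auto
  then have "\<rho> h \<le> \<rho> a" using rho_mono hc ac by blast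
  also have "\<dots> \<le> \<rho> x" unfolding a_def using hc y x by (intro rho_mult) auto
  finally show ?thesis .
qed

lemma discrete_if_bounded_below:
  assumes "0 < \<delta>" "\<And>x. x \<in> carrier R \<Longrightarrow> x \<noteq> \<zero> \<Longrightarrow> \<delta> \<le> \<rho> x"
  shows "rank_topology_on R \<rho> (carrier R) = discrete_topology (carrier R)"
proof -
  interpret M: Metric_space "carrier R" "rank_metric R \<rho>" by (rule rank_metric_space) simp
  have "openin M.mtopology {x}" if x: "x \<in> carrier R" for x
    unfolding M.openin_mtopology
  proof (intro conjI allI impI)
    fix y assume y: "y \<in> {x}"
    have "M.mball y \<delta> \<subseteq> {x}"
    proof
      fix z assume "z \<in> M.mball y \<delta>"
      then have z: "z \<in> carrier R" "\<rho> (x \<ominus> z) < \<delta>" using x y by (auto simp: rank_metric_def)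
      then have "x \<ominus> z = \<zero>" using assms(2)[of "x \<ominus> z"] x by force
      then show "z \<in> {x}" using x z by (simp add: minus_eq_zero_iff)
    qed
    then show "\<exists>r>0. M.mball y r \<subseteq> {x}" using assms(1) by blast
  qed (use x in simp)
  then show ?thesis
    unfolding rank_topology_on_def using discrete_topology_unique[of "carrier R" M.mtopology] by simp
qed

text \<open>\<open>s\<close> is the largest member of rank at most \<open>r\<close> and
  \<open>f\<close> the smallest of rank at least \<open>r\<close>. If their ranks differ,
  \<open>h = f \<ominus> s\<close> is a minimal idempotent: for a smaller nonzero \<open>h'\<close>,
  maximality would put \<open>s \<oplus> h'\<close> into the nest, strictly between \<open>s\<close>
  and \<open>f\<close>. A minimal idempotent bounds all nonzero ranks from below, which makes the
  topology discrete.\<close>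

lemma nest_rho_surj:
  assumes E: "maximal_nest R E" and nd: "non_discrete_ring R \<rho>" and r: "0 \<le> r" "r \<le> 1"
  obtains e where "e \<in> E" "\<rho> e = r"
proof -
  have Ei: "e \<in> idempotents R" "e \<in> carrier R" if "e \<in> E" for e
    using nest_idem[OF E that] nest_carrier[OF E that] .
  note le = nest_rho_le[OF E]
  define A where "A = {c \<in> E. \<rho> c \<le> r}"
  define B where "B = {c \<in> E. r \<le> \<rho> c}"
  have AE: "A \<subseteq> E" and BE: "B \<subseteq> E" by (auto simp: A_def B_def)
  obtain s where s: "s \<in> E" "\<And>c. c \<in> A \<Longrightarrow> idem_le R c s" "pr s = lub (pr ` A)"
    using nest_Sup[OF E AE] by metis
  have sr: "\<rho> s \<le> r" by (rule nest_Sup_rho[OF E AE s(1) s(2) s(3) r(1)]) (simp_all add: A_def)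
  obtain f where f: "f \<in> E" "\<And>c. c \<in> B \<Longrightarrow> idem_le R f c"
    "\<And>r. r \<le> 1 \<Longrightarrow> (\<And>c. c \<in> B \<Longrightarrow> r \<le> \<rho> c) \<Longrightarrow> r \<le> \<rho> f"
    using nest_Inf[OF E BE] by metis
  have fr: "r \<le> \<rho> f" using f(3)[of r] r by (simp add: B_def)
  have sf: "idem_le R s f" using le s f sr fr by simp
  show thesis
  proof (cases "\<rho> s = \<rho> f")
    case True then show ?thesis using that s sr fr by simp
  next
    case False
    define h where "h = f \<ominus> s"
    note h = idem_diff[OF Ei(1)[OF s(1)] Ei(1)[OF f(1)] sf, folded h_def]
    have sc: "s \<in> carrier R" and fc: "f \<in> carrier R" and hc: "h \<in> carrier R"
      using Ei s f by (auto simp: h_def)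
    have h0: "h \<noteq> \<zero>" using False h(2) rho_zero by auto
    have "h' = h" if h': "h' \<in> idempotents R" "idem_le R h' h" "h' \<noteq> \<zero>" for h'
    proof -
      have h'c: "h' \<in> carrier R" "h' \<otimes> h' = h'" using idempotentsD h' by auto
      have hh: "h' \<otimes> h = h'" "h \<otimes> h' = h'" using h'(2) by (auto simp: idem_le_def)
      have "s \<otimes> h' = s \<otimes> h \<otimes> h'" "h' \<otimes> s = h' \<otimes> (h \<otimes> s)"
        using hh sc hc h'c(1) by (simp add: m_assoc, simp add: m_assoc[symmetric])
      then have sh: "s \<otimes> h' = \<zero>" "h' \<otimes> s = \<zero>" using h(4,5) h'c(1) by simp_all
      have ss: "s \<otimes> s = s" using Ei s idempotentsD by blast
      define g where "g = s \<oplus> h'"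
      have gc: "g \<in> carrier R" using sc h'c by (simp add: g_def)
      have g: "g \<in> idempotents R" "idem_le R s g" "idem_le R g f"
        using sc h'c sh ss hh h(4,5) hc
        by (auto simp: idempotents_def idem_le_def g_def l_distr r_distr h(3)[symmetric])
      have rg: "\<rho> g = \<rho> s + \<rho> h'"
        unfolding g_def using Ei s(1) h' sh by (intro rho_add_orthogonal) auto
      have "g \<in> E"
      proof (rule nest_memI[OF E g(1)])
        fix e assume e: "e \<in> E"
        show "idem_le R g e \<or> idem_le R e g"
        proof (cases "\<rho> e \<le> r")
          case True
          then have "idem_le R e s" using s(2) e by (simp add: A_def)
          then show ?thesis using idem_le_trans[OF _ _ g(1) _ g(2)] Ei e s(1) by blast
        next
          case False
          then have "idem_le R f e" using f(2) e by (simp add: B_def)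
          then show ?thesis using idem_le_trans[OF g(1) _ _ g(3)] Ei e f(1) by blast
        qed
      qed
      have "\<rho> h' > 0" using rho_pos h'c h' by blast
      have "\<rho> h \<le> \<rho> h'"
      proof (cases "\<rho> g \<le> r")
        case True
        then have "idem_le R g s" using s(2) \<open>g \<in> E\<close> by (simp add: A_def)
        then have "\<rho> g \<le> \<rho> s" using idem_le_rho gc sc by blast
        then show ?thesis using rg \<open>\<rho> h' > 0\<close> by simp
      next
        case False
        then have "idem_le R f g" using f(2) \<open>g \<in> E\<close> by (simp add: B_def)
        then have "\<rho> f \<le> \<rho> g" using idem_le_rho gc fc by blast
        then show ?thesis using rg h(2) by simp
      qed
      then show ?thesis by (rule idem_le_rho_eq[OF h'(1) h(1) h'(2)])
    qed
    then have "\<rho> h \<le> \<rho> x" if "x \<in> carrier R" "x \<noteq> \<zero>" for x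
      using minimal_idempotent_rho[OF h(1) h0] that by blast
    then show ?thesis
      using nd discrete_if_bounded_below[of "\<rho> h"] rho_pos[OF hc h0]
      by (simp add: non_discrete_ring_def)
  qed
qed

end

section \<open>The Levitzki radical\<close>

context ring
begin

definition word_prod :: "'a list \<Rightarrow> 'a" where "word_prod xs = foldr (\<otimes>) xs \<one>"

text \<open>For subsets of the carrier this is local nilpotency, expressed by generators only.\<close>

definition loc_nil :: "'a set \<Rightarrow> bool" where
  "loc_nil N \<longleftrightarrow> (\<forall>F. finite F \<longrightarrow> F \<subseteq> N \<longrightarrow>
     (\<exists>k. \<forall>xs. length xs = k \<longrightarrow> set xs \<subseteq> F \<longrightarrow> word_prod xs = \<zero>))"

lemma word_prod_simps [simp]: "word_prod [] = \<one>" "word_prod (x # xs) = x \<otimes> word_prod xs"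
  by (simp_all add: word_prod_def)

lemma word_prod_closed [simp]: "set xs \<subseteq> carrier R \<Longrightarrow> word_prod xs \<in> carrier R"
  by (induction xs) auto

lemma word_prod_append:
  "set xs \<subseteq> carrier R \<Longrightarrow> set ys \<subseteq> carrier R \<Longrightarrow> word_prod (xs @ ys) = word_prod xs \<otimes> word_prod ys"
  by (induction xs) (auto simp: m_assoc)

lemma locally_nilpotent_imp_loc_nil:
  assumes "locally_nilpotent R N" shows "loc_nil N"
  unfolding loc_nil_def
proof (intro allI impI)
  fix F assume F: "finite F" "F \<subseteq> N"
  then have "nilpotent_subring R (generated_nonunital_subring R F)"
    using assms by (simp add: locally_nilpotent_def)
  then obtain k where k: "\<And>xs. length xs = k \<Longrightarrow> set xs \<subseteq> generated_nonunital_subring R F \<Longrightarrow>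
      foldr (\<otimes>) xs \<one> = \<zero>"
    unfolding nilpotent_subring_def by metis
  moreover have "F \<subseteq> generated_nonunital_subring R F"
    by (auto simp: generated_nonunital_subring_def)
  ultimately show "\<exists>k. \<forall>xs. length xs = k \<longrightarrow> set xs \<subseteq> F \<longrightarrow> word_prod xs = \<zero>"
    unfolding word_prod_def by (metis subset_trans)
qed

lemma loc_nil_subset: "loc_nil N \<Longrightarrow> M \<subseteq> N \<Longrightarrow> loc_nil M"
  unfolding loc_nil_def by (meson subset_trans)

text \<open>Modulo the ideal \<open>J\<close>, every letter \<open>x\<close> may be replaced by its
  component \<open>i x\<close>.\<close>

lemma word_prod_congruent:
  assumes J: "ideal J R" and "set xs \<subseteq> S" "i ` S \<subseteq> carrier R" "j ` S \<subseteq> J"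
    and dec: "\<And>x. x \<in> S \<Longrightarrow> x = i x \<oplus> j x"
  shows "\<exists>y\<in>J. word_prod xs = word_prod (map i xs) \<oplus> y"
  using assms(2)
proof (induction xs)
  interpret J: ideal J R by (rule J)
  case Nil
  then show ?case by (intro bexI[of _ \<zero>]) auto
next
  interpret J: ideal J R by (rule J)
  case (Cons x xs)
  then obtain y where y: "y \<in> J" "word_prod xs = word_prod (map i xs) \<oplus> y" by auto
  have x: "x \<in> S" using Cons by simp
  have c: "i x \<in> carrier R" "j x \<in> J" "j x \<in> carrier R" "y \<in> carrier R"
    using x assms(3,4) J.Icarr y(1) by blast+
  have w: "word_prod (map i xs) \<in> carrier R" using Cons.prems assms(3) by (intro word_prod_closed) auto
  have "word_prod (x # xs) = i x \<otimes> word_prod (map i xs) \<oplus> (i x \<otimes> y \<oplus> j x \<otimes> (word_prod (map i xs) \<oplus> y))"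
    using c w dec[OF x] y(2) l_distr[of "i x" "j x" "word_prod (map i xs) \<oplus> y"]
    by (simp add: r_distr a_assoc)
  moreover have "i x \<otimes> y \<oplus> j x \<otimes> (word_prod (map i xs) \<oplus> y) \<in> J"
    using c w y(1) by (intro J.a_closed J.I_l_closed J.I_r_closed) auto
  ultimately show ?case by auto
qed

text \<open>A long word is read as a word of \<open>m\<close> letters, each the product of a block
  of length \<open>k\<close>.\<close>

lemma word_prod_chunks:
  assumes "S \<subseteq> carrier R" "length xs = m * k" "set xs \<subseteq> S"
  shows "\<exists>ys. length ys = m \<and> set ys \<subseteq> word_prod ` {zs. set zs \<subseteq> S \<and> length zs = k} \<and>
    word_prod xs = word_prod ys"
  using assms(2,3)
proof (induction m arbitrary: xs)
  case (Suc m)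
  have t: "set (take k xs) \<subseteq> S" "set (drop k xs) \<subseteq> S"
    using Suc.prems(2) set_take_subset[of k xs] set_drop_subset[of k xs] by auto
  have "length (drop k xs) = m * k" using Suc.prems by simp
  from Suc.IH[OF this t(2)] obtain ys where ys: "length ys = m"
    "set ys \<subseteq> word_prod ` {zs. set zs \<subseteq> S \<and> length zs = k}" "word_prod (drop k xs) = word_prod ys" by blast
  have "word_prod xs = word_prod (take k xs) \<otimes> word_prod (drop k xs)"
    using word_prod_append[of "take k xs" "drop k xs"] t assms(1) by auto
  then have "word_prod xs = word_prod (word_prod (take k xs) # ys)" using ys by simp
  moreover have "word_prod (take k xs) \<in> word_prod ` {zs. set zs \<subseteq> S \<and> length zs = k}"
    using t Suc.prems by auto
  ultimately show ?case using ys by (intro exI[of _ "word_prod (take k xs) # ys"]) auto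
qed simp

text \<open>Words of a suitable length \<open>k\<close> over \<open>F\<close> lie in
  \<open>J\<close>, since the words formed by their \<open>I\<close>-components vanish. Their
  products form a finite subset \<open>W\<close> of \<open>J\<close>, so words made of sufficiently
  many such blocks vanish.\<close>

lemma loc_nil_sum:
  assumes I: "ideal I R" "loc_nil I" and J: "ideal J R" "loc_nil J"
  shows "loc_nil (I <+>\<^bsub>R\<^esub> J)"
  unfolding loc_nil_def
proof (intro allI impI)
  interpret I: ideal I R by (rule I)
  interpret J: ideal J R by (rule J)
  fix F assume F: "finite F" "F \<subseteq> I <+>\<^bsub>R\<^esub> J"
  have "\<forall>x\<in>F. \<exists>y. fst y \<in> I \<and> snd y \<in> J \<and> x = fst y \<oplus> snd y"
    using F(2) by (force simp: set_add_def')
  then obtain g where g: "\<And>x. x \<in> F \<Longrightarrow> fst (g x) \<in> I \<and> snd (g x) \<in> J \<and> x = fst (g x) \<oplus> snd (g x)"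
    by metis
  define i j where "i x = fst (g x)" and "j x = snd (g x)" for x
  have ij: "i x \<in> I" "j x \<in> J" "x = i x \<oplus> j x" if "x \<in> F" for x
    using g[OF that] by (auto simp: i_def j_def)
  have Fc: "F \<subseteq> carrier R" using ij I.Icarr J.Icarr by (metis a_closed subsetI)
  obtain k where k: "\<And>xs. length xs = k \<Longrightarrow> set xs \<subseteq> i ` F \<Longrightarrow> word_prod xs = \<zero>"
    using I(2) F(1) ij(1) unfolding loc_nil_def by (meson finite_imageI image_subsetI)
  define W where "W = word_prod ` {zs. set zs \<subseteq> F \<and> length zs = k}"
  have "W \<subseteq> J"
  proof
    fix w assume "w \<in> W"
    then obtain zs where zs: "set zs \<subseteq> F" "length zs = k" "w = word_prod zs" by (auto simp: W_def)
    have "\<exists>y\<in>J. word_prod zs = word_prod (map i zs) \<oplus> y"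
      by (rule word_prod_congruent[OF J(1) zs(1), of i j]) (use ij I.Icarr in auto)
    then obtain y where y: "y \<in> J" "word_prod zs = word_prod (map i zs) \<oplus> y" by blast
    have "word_prod (map i zs) = \<zero>" using zs by (intro k) auto
    then show "w \<in> J" using zs y J.Icarr by simp
  qed
  moreover have "finite W" unfolding W_def using F(1) by (intro finite_imageI finite_lists_length_eq)
  ultimately obtain m where m: "\<And>xs. length xs = m \<Longrightarrow> set xs \<subseteq> W \<Longrightarrow> word_prod xs = \<zero>"
    using J(2) unfolding loc_nil_def by blast
  have "word_prod xs = \<zero>" if xs: "length xs = m * k" "set xs \<subseteq> F" for xs
  proof -
    obtain ys where "length ys = m" "set ys \<subseteq> W" "word_prod xs = word_prod ys"
      using word_prod_chunks[OF Fc xs] unfolding W_def by blast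
    then show ?thesis using m by simp
  qed
  then show "\<exists>k. \<forall>xs. length xs = k \<longrightarrow> set xs \<subseteq> F \<longrightarrow> word_prod xs = \<zero>" by blast
qed

lemma levitzki_carrier: "levitzki_radical R \<subseteq> carrier R"
  unfolding levitzki_radical_def
  using add.generate_incl[of "\<Union>{I. ideal I R \<and> locally_nilpotent R I}"] ideal.Icarr by fastforce

lemma levitzki_ideal: "ideal (levitzki_radical R) R"
proof (rule idealI[OF ring_axioms])
  let ?U = "\<Union>{I. ideal I R \<and> locally_nilpotent R I}"
  have U: "?U \<subseteq> carrier R" using ideal.Icarr by fastforce
  show "subgroup (levitzki_radical R) (add_monoid R)"
    unfolding levitzki_radical_def using add.generate_is_subgroup U by simp
  have gc: "y \<in> generate (add_monoid R) ?U \<Longrightarrow> y \<in> carrier R" for y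
    using levitzki_carrier by (auto simp: levitzki_radical_def)
  have *: "x \<otimes> a \<in> levitzki_radical R \<and> a \<otimes> x \<in> levitzki_radical R"
    if "a \<in> levitzki_radical R" and x: "x \<in> carrier R" for a x
    using that(1) unfolding levitzki_radical_def
  proof (induction rule: generate.induct)
    case one
    then show ?case using x generate.one[of "add_monoid R" ?U] by simp
  next
    case (incl a)
    then obtain I where "ideal I R" "locally_nilpotent R I" "a \<in> I" by blast
    then have "x \<otimes> a \<in> I" "a \<otimes> x \<in> I"
      using ideal.I_l_closed[OF \<open>ideal I R\<close> \<open>a \<in> I\<close> x] ideal.I_r_closed[OF \<open>ideal I R\<close> \<open>a \<in> I\<close> x] by blast+
    then have "x \<otimes> a \<in> ?U" "a \<otimes> x \<in> ?U"
      using \<open>ideal I R\<close> \<open>locally_nilpotent R I\<close> by blast+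
    then show ?case by (auto intro: generate.incl)
  next
    case (inv a)
    then obtain I where I: "ideal I R" "locally_nilpotent R I" "a \<in> I" by blast
    then interpret I: ideal I R by simp
    have "\<ominus> a \<in> I" using I by simp
    then have "x \<otimes> \<ominus> a \<in> I" "\<ominus> a \<otimes> x \<in> I"
      using x I.I_l_closed I.I_r_closed by simp_all
    then have "x \<otimes> \<ominus> a \<in> ?U" "\<ominus> a \<otimes> x \<in> ?U"
      using I by blast+
    then show ?case by (auto intro: generate.incl simp flip: a_inv_def)
  next
    case (eng a b)
    then show ?case
      using x gc[OF eng.hyps(1)] gc[OF eng.hyps(2)]
        generate.eng[of "x \<otimes> a" "add_monoid R" ?U "x \<otimes> b"] generate.eng[of "a \<otimes> x" "add_monoid R" ?U "b \<otimes> x"]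
      by (simp add: l_distr r_distr)
  qed
  show "x \<otimes> a \<in> levitzki_radical R" "a \<otimes> x \<in> levitzki_radical R"
    if "a \<in> levitzki_radical R" "x \<in> carrier R" for a x using *[OF that] by auto
qed

text \<open>By \<open>loc_nil_sum\<close> the locally nilpotent ideals are closed under binary sums,
  so passing to the sum of all of them adds no element that is not already in one.\<close>

lemma levitzki_mem:
  assumes "x \<in> levitzki_radical R" shows "\<exists>I. ideal I R \<and> loc_nil I \<and> x \<in> I"
  using assms unfolding levitzki_radical_def
proof (induction rule: generate.induct)
  case one
  have "loc_nil {\<zero>}" unfolding loc_nil_def
  proof (intro allI impI exI[of _ 1])
    fix F xs assume "F \<subseteq> {\<zero>}" "length (xs :: 'a list) = 1" "set xs \<subseteq> F"
    then show "word_prod xs = \<zero>" by (cases xs) auto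
  qed
  then show ?case using zeroideal by auto
next
  case (incl a)
  then show ?case using locally_nilpotent_imp_loc_nil by blast
next
  case (inv a)
  then obtain I where I: "ideal I R" "locally_nilpotent R I" "a \<in> I" by blast
  then interpret I: ideal I R by simp
  have "\<ominus> a \<in> I" using I by simp
  then show ?case using I locally_nilpotent_imp_loc_nil by (auto simp flip: a_inv_def)
next
  case (eng a b)
  then obtain I J where IJ: "ideal I R" "loc_nil I" "a \<in> I" "ideal J R" "loc_nil J" "b \<in> J" by blast
  have "a \<oplus> b \<in> I <+>\<^bsub>R\<^esub> J" using IJ by (auto simp: set_add_def')
  then show ?case using loc_nil_sum[OF IJ(1,2,4,5)] add_ideals[OF IJ(1,4)] by auto
qed

text \<open>The same closure under sums puts every finite subset of the radical inside a single
  locally nilpotent ideal.\<close>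

lemma levitzki_loc_nil: "loc_nil (levitzki_radical R)"
proof -
  have "\<exists>I. ideal I R \<and> loc_nil I \<and> F \<subseteq> I" if "finite F" "F \<subseteq> levitzki_radical R" for F
    using that
  proof (induction F rule: finite_induct)
    case empty
    show ?case using levitzki_mem[of \<zero>] levitzki_ideal additive_subgroup.zero_closed ideal.axioms(1) by blast
  next
    case (insert x F)
    then obtain I where I: "ideal I R" "loc_nil I" "F \<subseteq> I" by blast
    obtain J where J: "ideal J R" "loc_nil J" "x \<in> J" using levitzki_mem insert.prems by blast
    interpret I: ideal I R by (rule I)
    interpret J: ideal J R by (rule J)
    have "insert x F \<subseteq> I <+>\<^bsub>R\<^esub> J"
    proof
      fix y assume "y \<in> insert x F"
      then consider "y \<in> J" | "y \<in> I" using I J by blast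
      then show "y \<in> I <+>\<^bsub>R\<^esub> J"
      proof cases
        case 1
        then have "y = \<zero> \<oplus> y" using J.Icarr by simp
        then show ?thesis using 1 I.zero_closed unfolding set_add_def' by blast
      next
        case 2
        then have "y = y \<oplus> \<zero>" using I.Icarr by simp
        then show ?thesis using 2 J.zero_closed unfolding set_add_def' by blast
      qed
    qed
    then show ?case using loc_nil_sum[OF I(1,2) J(1,2)] add_ideals[OF I(1) J(1)] by blast
  qed
  then show ?thesis unfolding loc_nil_def by meson
qed

end

section \<open>Invariant means\<close>

definition bounded_fun :: "'a set \<Rightarrow> ('a \<Rightarrow> real) \<Rightarrow> bool" where
  "bounded_fun A f \<longleftrightarrow> (\<exists>B. \<forall>x\<in>A. \<bar>f x\<bar> \<le> B)"

text \<open>A finitely additive probability measure on all subsets of \<open>A\<close>, given by its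
  integral. Functions are total, but their values outside \<open>A\<close> do not matter
  (\<open>mean_cong\<close>).\<close>

definition mean :: "'a set \<Rightarrow> (('a \<Rightarrow> real) \<Rightarrow> real) \<Rightarrow> bool" where
  "mean A m \<longleftrightarrow>
     (\<forall>f g. bounded_fun A f \<longrightarrow> bounded_fun A g \<longrightarrow> m (\<lambda>x. f x + g x) = m f + m g) \<and>
     (\<forall>f c. bounded_fun A f \<longrightarrow> m (\<lambda>x. c * f x) = c * m f) \<and>
     (\<forall>f. bounded_fun A f \<longrightarrow> (\<forall>x\<in>A. 0 \<le> f x) \<longrightarrow> 0 \<le> m f) \<and>
     m (\<lambda>_. 1) = 1"

lemma bounded_fun_const [simp]: "bounded_fun A (\<lambda>_. c)"
  by (auto simp: bounded_fun_def)

lemma bounded_fun_add [intro]: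
  assumes "bounded_fun A f" "bounded_fun A g" shows "bounded_fun A (\<lambda>x. f x + g x)"
proof -
  obtain B C where "\<forall>x\<in>A. \<bar>f x\<bar> \<le> B" "\<forall>x\<in>A. \<bar>g x\<bar> \<le> C" using assms by (auto simp: bounded_fun_def)
  then have "\<forall>x\<in>A. \<bar>f x + g x\<bar> \<le> B + C" by (meson abs_triangle_ineq add_mono order_trans)
  then show ?thesis by (auto simp: bounded_fun_def)
qed

lemma bounded_fun_mult [intro]:
  assumes "bounded_fun A f" "bounded_fun A g" shows "bounded_fun A (\<lambda>x. f x * g x)"
proof -
  obtain B C where "\<forall>x\<in>A. \<bar>f x\<bar> \<le> B" "\<forall>x\<in>A. \<bar>g x\<bar> \<le> C" using assms by (auto simp: bounded_fun_def)
  then have "\<forall>x\<in>A. \<bar>f x * g x\<bar> \<le> B * C"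
    using order_trans[OF abs_ge_zero] by (auto simp: abs_mult intro!: mult_mono)
  then show ?thesis by (auto simp: bounded_fun_def)
qed

lemma bounded_fun_diff [intro]:
  assumes "bounded_fun A f" "bounded_fun A g" shows "bounded_fun A (\<lambda>x. f x - g x)"
  using bounded_fun_add[OF assms(1) bounded_fun_mult[OF bounded_fun_const[of A "-1"] assms(2)]] by simp

lemma bounded_fun_comp:
  "bounded_fun A f \<Longrightarrow> (\<And>x. x \<in> A \<Longrightarrow> h x \<in> A) \<Longrightarrow> bounded_fun A (\<lambda>x. f (h x))"
  by (auto simp: bounded_fun_def)

lemma mean_add: "mean A m \<Longrightarrow> bounded_fun A f \<Longrightarrow> bounded_fun A g \<Longrightarrow> m (\<lambda>x. f x + g x) = m f + m g"
  and mean_scale: "mean A m \<Longrightarrow> bounded_fun A f \<Longrightarrow> m (\<lambda>x. c * f x) = c * m f"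
  and mean_nonneg: "mean A m \<Longrightarrow> bounded_fun A f \<Longrightarrow> (\<And>x. x \<in> A \<Longrightarrow> 0 \<le> f x) \<Longrightarrow> 0 \<le> m f"
  and mean_one: "mean A m \<Longrightarrow> m (\<lambda>_. 1) = 1"
  by (simp_all add: mean_def)

lemma mean_diff:
  assumes "mean A m" "bounded_fun A f" "bounded_fun A g" shows "m (\<lambda>x. f x - g x) = m f - m g"
proof -
  have "m (\<lambda>x. f x + (-1) * g x) = m f + m (\<lambda>x. (-1) * g x)"
    by (intro mean_add[OF assms(1,2)] bounded_fun_mult assms(3)) simp
  then show ?thesis using mean_scale[OF assms(1,3), of "-1"] by simp
qed

lemma mean_mono:
  assumes "mean A m" "bounded_fun A f" "bounded_fun A g" "\<And>x. x \<in> A \<Longrightarrow> f x \<le> g x" shows "m f \<le> m g"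
  using mean_nonneg[OF assms(1) bounded_fun_diff[OF assms(3,2)]] mean_diff[OF assms(1,3,2)] assms(4)
  by simp

lemma mean_const: "mean A m \<Longrightarrow> m (\<lambda>_. c) = c"
  using mean_scale[of A m "\<lambda>_. 1" c] mean_one[of A m] by simp

lemma mean_cong:
  assumes "mean A m" "bounded_fun A f" "\<And>x. x \<in> A \<Longrightarrow> f x = g x" shows "m f = m g"
proof -
  have "bounded_fun A g" using assms(2,3) by (auto simp: bounded_fun_def)
  then show ?thesis using assms by (intro antisym mean_mono[OF assms(1)]) auto
qed

lemma mean_abs_le:
  assumes "mean A m" "\<And>x. x \<in> A \<Longrightarrow> \<bar>f x\<bar> \<le> B" shows "\<bar>m f\<bar> \<le> B"
proof -
  have f: "bounded_fun A f" using assms(2) by (auto simp: bounded_fun_def)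
  have "m f \<le> B" "- B \<le> m f"
    using mean_mono[OF assms(1) f bounded_fun_const[of A B]] mean_mono[OF assms(1) bounded_fun_const[of A "-B"] f]
      assms(2) mean_const[OF assms(1)] by (force simp: abs_le_iff)+
  then show ?thesis by simp
qed

lemma mean_eval: "a \<in> A \<Longrightarrow> mean A (\<lambda>f. f a)"
  by (auto simp: mean_def)

text \<open>The means on \<open>A\<close> form a closed subset of a product of compact intervals.\<close>

lemma mean_compactness:
  fixes A :: "'a set" and Cs :: "(('a \<Rightarrow> real) \<times> ('a \<Rightarrow> real) \<times> real) set"
  assumes bdd: "\<And>f g e. (f, g, e) \<in> Cs \<Longrightarrow> bounded_fun A f \<and> bounded_fun A g"
    and fin: "\<And>F. finite F \<Longrightarrow> F \<subseteq> Cs \<Longrightarrow> \<exists>m. mean A m \<and> (\<forall>(f, g, e)\<in>F. \<bar>m f - m g\<bar> \<le> e)"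
  shows "\<exists>m. mean A m \<and> (\<forall>(f, g, e)\<in>Cs. \<bar>m f - m g\<bar> \<le> e)"
proof -
  define Bd where "Bd = {f. bounded_fun A f}"
  define X where "X = product_topology (\<lambda>_ :: 'a \<Rightarrow> real. euclideanreal) Bd"
  have "\<forall>f\<in>Bd. \<exists>B. \<forall>x\<in>A. \<bar>f x\<bar> \<le> B" by (simp add: Bd_def bounded_fun_def)
  from bchoice[OF this] obtain N where N: "\<And>f x. f \<in> Bd \<Longrightarrow> x \<in> A \<Longrightarrow> \<bar>f x\<bar> \<le> N f" by blast
  \<comment> \<open>A mean satisfies \<open>\<bar>m f\<bar> \<le> N f\<close>, so all means,
    restricted to \<open>Bd\<close>, lie in this product, which is compact by Tychonoff's
    theorem.\<close>
  define K where "K = PiE Bd (\<lambda>f. {- N f..N f})"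
  have cK: "compactin X K" unfolding X_def K_def by (simp add: compactin_PiE)
  have topX: "topspace X = PiE Bd (\<lambda>_. UNIV)" by (simp add: X_def)
  have proj: "continuous_map X euclideanreal (\<lambda>m. m f)" if "f \<in> Bd" for f
    unfolding X_def using that by (rule continuous_map_product_projection)
  have clos: "closedin X {m \<in> topspace X. \<Phi> m \<in> S}"
    if "continuous_map X euclideanreal \<Phi>" "closed S" for \<Phi> and S :: "real set"
    using closedin_continuous_map_preimage[OF that(1)] that(2) by simp
  \<comment> \<open>Each condition defining a mean, for one choice of functions, is a closed set in
    \<open>V\<close>. A triple \<open>(f, g, e)\<close> of \<open>Cs\<close> imposes the closed
    condition \<open>\<bar>m f - m g\<bar> \<le> e\<close>; exact invariance is the case
    \<open>e = 0\<close>.\<close>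
  define V where "V =
     (\<lambda>(f, g). {m \<in> topspace X. m (\<lambda>x. f x + g x) - (m f + m g) \<in> {0}}) ` (Bd \<times> Bd) \<union>
     (\<lambda>(f, c). {m \<in> topspace X. m (\<lambda>x. c * f x) - c * m f \<in> {0}}) ` (Bd \<times> UNIV) \<union>
     (\<lambda>f. {m \<in> topspace X. m f \<in> {0..}}) ` {f \<in> Bd. \<forall>x\<in>A. 0 \<le> f x} \<union>
     {{m \<in> topspace X. m (\<lambda>_. 1) \<in> {1}}}"
  define W where "W = (\<lambda>(f, g, e). {m \<in> topspace X. \<bar>m f - m g\<bar> \<in> {..e}})"
  have BdI: "(\<lambda>x. f x + g x) \<in> Bd" "(\<lambda>x. c * f x) \<in> Bd" "(\<lambda>_. c) \<in> Bd" if "f \<in> Bd" "g \<in> Bd" for f g c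
    using that by (auto simp: Bd_def)
  have one: "(\<lambda>_. 1) \<in> Bd" by (simp add: Bd_def)
  have "closedin X C" if "C \<in> V \<union> W ` Cs" for C
    using that unfolding V_def W_def
    by (elim UnE imageE; (simp only: split_paired_all prod.case)?)
      (auto simp del: atLeast_iff atMost_iff insert_iff
        intro!: clos continuous_map_diff continuous_map_add continuous_map_real_mult
          continuous_map_real_abs proj BdI one continuous_map_const[THEN iffD2] dest: bdd simp: Bd_def)
  moreover have "K \<inter> \<Inter>F \<noteq> {}" if F: "finite F" "F \<subseteq> V \<union> W ` Cs" for F
  proof -
    obtain F' where F': "finite F'" "F' \<subseteq> Cs" "F - V = W ` F'"
    proof -
      have "finite (F - V)" "F - V \<subseteq> W ` Cs" using F by auto
      from finite_subset_image[OF this] show thesis using that by blast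
    qed
    obtain m where m: "mean A m" "\<And>f g e. (f, g, e) \<in> F' \<Longrightarrow> \<bar>m f - m g\<bar> \<le> e"
      using fin[OF F'(1,2)] by blast
    \<comment> \<open>Points of the product are extensional on \<open>Bd\<close>, so
      \<open>m\<close> is cut down to the bounded functions.\<close>
    define m' where "m' = restrict m Bd"
    have top: "m' \<in> topspace X" by (simp add: topX m'_def)
    have "\<bar>m f\<bar> \<le> N f" if "f \<in> Bd" for f
      by (rule mean_abs_le[OF m(1)]) (rule N[OF that])
    then have "m' \<in> K" by (auto simp: K_def m'_def abs_le_iff minus_le_iff)
    moreover have "m' \<in> C" if "C \<in> V" for C
    proof -
      have m': "m' f = m f" if "f \<in> Bd" for f using that by (simp add: m'_def)
      have "m' (\<lambda>x. f x + g x) = m' f + m' g" "m' (\<lambda>x. c * f x) = c * m' f"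
        if "f \<in> Bd" "g \<in> Bd" for f g c
        using that BdI[OF that] m(1) by (simp_all add: m' mean_add mean_scale Bd_def)
      moreover have "0 \<le> m' f" if "f \<in> Bd" "\<forall>x\<in>A. 0 \<le> f x" for f
        using that mean_nonneg[OF m(1)] by (simp add: m' Bd_def)
      moreover have "m' (\<lambda>_. 1) = 1" using mean_one[OF m(1)] m'[OF one] by simp
      ultimately show ?thesis using \<open>C \<in> V\<close> top unfolding V_def by auto
    qed
    moreover have "m' \<in> C" if "C \<in> W ` F'" for C
    proof -
      obtain f g e where c: "(f, g, e) \<in> F'" "C = W (f, g, e)" using \<open>C \<in> W ` F'\<close> by auto
      then have "f \<in> Bd" "g \<in> Bd" using bdd[of f g e] F'(2) by (auto simp: Bd_def)
      then show ?thesis using m(2)[OF c(1)] top c(2) by (simp add: W_def m'_def)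
    qed
    moreover have "C \<in> V \<or> C \<in> W ` F'" if "C \<in> F" for C
      using that unfolding F'(3)[symmetric] by simp
    ultimately have "m' \<in> K" "\<And>C. C \<in> F \<Longrightarrow> m' \<in> C" by metis+
    then show ?thesis by blast
  qed
  ultimately have *: "(\<forall>C\<in>V \<union> W ` Cs. closedin X C) \<and>
      (\<forall>F. finite F \<and> F \<subseteq> V \<union> W ` Cs \<longrightarrow> K \<inter> \<Inter>F \<noteq> {})" by simp
  have "K \<inter> \<Inter>(V \<union> W ` Cs) \<noteq> {}"
    using cK[unfolded compactin_fip, THEN conjunct2, THEN spec, THEN mp, OF *] .
  then obtain m where m: "\<And>C. C \<in> V \<Longrightarrow> m \<in> C" "\<And>C. C \<in> W ` Cs \<Longrightarrow> m \<in> C" by blast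
  have "mean A m"
    unfolding mean_def
  proof (intro conjI allI impI)
    fix f g assume "bounded_fun A f" "bounded_fun A g"
    then have "(f, g) \<in> Bd \<times> Bd" by (simp add: Bd_def)
    then have "{m \<in> topspace X. m (\<lambda>x. f x + g x) - (m f + m g) \<in> {0}} \<in> V"
      unfolding V_def by (intro UnI1) (rule image_eqI[of _ _ "(f, g)"], simp_all)
    then have "m \<in> {m \<in> topspace X. m (\<lambda>x. f x + g x) - (m f + m g) \<in> {0}}" by (rule m(1))
    then show "m (\<lambda>x. f x + g x) = m f + m g" by simp
  next
    fix f and c :: real assume "bounded_fun A f"
    then have "(f, c) \<in> Bd \<times> UNIV" by (simp add: Bd_def)
    then have "{m \<in> topspace X. m (\<lambda>x. c * f x) - c * m f \<in> {0}} \<in> V"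
      unfolding V_def
      by - (rule UnI1, rule UnI1, rule UnI2, rule image_eqI[of _ _ "(f, c)"], simp_all)
    then have "m \<in> {m \<in> topspace X. m (\<lambda>x. c * f x) - c * m f \<in> {0}}" by (rule m(1))
    then show "m (\<lambda>x. c * f x) = c * m f" by simp
  next
    fix f assume "bounded_fun A f" "\<forall>x\<in>A. 0 \<le> f x"
    then have "f \<in> {f \<in> Bd. \<forall>x\<in>A. 0 \<le> f x}" by (simp add: Bd_def)
    then have "{m \<in> topspace X. m f \<in> {0..}} \<in> V"
      unfolding V_def by - (rule UnI1, rule UnI2, rule imageI)
    then have "m \<in> {m \<in> topspace X. m f \<in> {0..}}" by (rule m(1))
    then show "0 \<le> m f" by simp
  next
    have "m \<in> {m \<in> topspace X. m (\<lambda>_. 1) \<in> {1}}" by (intro m(1)) (simp add: V_def)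
    then show "m (\<lambda>_. 1) = 1" by simp
  qed
  moreover have "\<bar>m f - m g\<bar> \<le> e" if "(f, g, e) \<in> Cs" for f g e
    using m(2)[of "W (f, g, e)"] that by (auto simp: W_def)
  ultimately show ?thesis by blast
qed

section \<open>Invariant means on groups\<close>

context group
begin

definition inv_mean :: "'a set \<Rightarrow> (('a \<Rightarrow> real) \<Rightarrow> real) \<Rightarrow> bool" where
  "inv_mean S m \<longleftrightarrow> mean (carrier G) m \<and>
     (\<forall>h\<in>S. \<forall>f. bounded_fun (carrier G) f \<longrightarrow> m (\<lambda>x. f (h \<otimes> x)) = m f)"

text \<open>Invariance under one \<open>h\<close> at one function is a closed condition, so
  compactness of the space of means reduces an arbitrary set \<open>S\<close> to its finite
  subsets.\<close>

lemma inv_mean_union_finite: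
  assumes S: "S \<subseteq> carrier G" and fin: "\<And>F. finite F \<Longrightarrow> F \<subseteq> S \<Longrightarrow> \<exists>m. inv_mean F m"
  shows "\<exists>m. inv_mean S m"
proof -
  let ?c = "\<lambda>(h, f). (\<lambda>x. f (h \<otimes> x), f, 0 :: real)"
  define Cs where "Cs = ?c ` (S \<times> {f. bounded_fun (carrier G) f})"
  have "\<exists>m. mean (carrier G) m \<and> (\<forall>(f, g, e)\<in>Cs. \<bar>m f - m g\<bar> \<le> e)"
  proof (rule mean_compactness)
    fix f g e assume "(f, g, e) \<in> Cs"
    then show "bounded_fun (carrier G) f \<and> bounded_fun (carrier G) g"
      using S by (auto simp: Cs_def intro!: bounded_fun_comp)
  next
    fix F assume F: "finite F" "F \<subseteq> Cs"
    then obtain F' where F': "finite F'" "F' \<subseteq> S \<times> {f. bounded_fun (carrier G) f}" "F = ?c ` F'"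
      using finite_subset_image[OF F(1) F(2)[unfolded Cs_def]] by blast
    have "fst ` F' \<subseteq> S" using F'(2) by auto
    then obtain m where m: "inv_mean (fst ` F') m" using fin[of "fst ` F'"] F'(1) by auto
    have "case c of (f, g, e) \<Rightarrow> \<bar>m f - m g\<bar> \<le> e" if cF: "c \<in> F" for c
    proof -
      obtain h f where hf: "(h, f) \<in> F'" "c = ?c (h, f)" using cF F'(3) by auto
      then have "h \<in> fst ` F'" "bounded_fun (carrier G) f" using F'(2) by force+
      then have "m (\<lambda>x. f (h \<otimes> x)) = m f" using m unfolding inv_mean_def by blast
      then show ?thesis using hf(2) by simp
    qed
    then show "\<exists>m. mean (carrier G) m \<and> (\<forall>(f, g, e)\<in>F. \<bar>m f - m g\<bar> \<le> e)"
      using m unfolding inv_mean_def by blast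
  qed
  then obtain m where m: "mean (carrier G) m" "\<And>c. c \<in> Cs \<Longrightarrow> case c of (f, g, e) \<Rightarrow> \<bar>m f - m g\<bar> \<le> e"
    by blast
  have "m (\<lambda>x. f (h \<otimes> x)) = m f" if "h \<in> S" "bounded_fun (carrier G) f" for h f
  proof -
    have "?c (h, f) \<in> Cs" unfolding Cs_def by (rule imageI) (simp add: that)
    from m(2)[OF this] show ?thesis by simp
  qed
  then show ?thesis using m(1) by (auto simp: inv_mean_def)
qed

abbreviation translate :: "'a \<Rightarrow> (('a \<Rightarrow> real) \<Rightarrow> real) \<Rightarrow> ('a \<Rightarrow> real) \<Rightarrow> real" where
  "translate g m \<equiv> (\<lambda>f. m (\<lambda>x. f (g \<otimes> x)))"

lemma mean_translate: assumes "mean (carrier G) m" "g \<in> carrier G" shows "mean (carrier G) (translate g m)"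
  using assms bounded_fun_comp[of "carrier G" _ "\<lambda>x. g \<otimes> x"]
  by (auto simp: mean_def)

text \<open>The Markov--Kakutani argument: averages over the powers of \<open>g\<close> are almost \<open>g\<close>-invariant.\<close>

lemma inv_mean_insert:
  assumes S: "S \<subseteq> carrier G" and g: "g \<in> carrier G" and m: "inv_mean S m"
    and trans: "\<And>m. inv_mean S m \<Longrightarrow> inv_mean S (translate g m)"
  shows "\<exists>m. inv_mean (insert g S) m"
proof -
  let ?A = "carrier G"
  define a where "a k = (translate g ^^ k) m" for k
  have a: "inv_mean S (a k)" for k by (induction k) (simp_all add: a_def m trans)
  have aSuc: "a (Suc k) f = a k (\<lambda>x. f (g \<otimes> x))" for k f by (simp add: a_def)
  \<comment> \<open>Averages over the first \<open>n + 1\<close> iterated translates by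
    \<open>g\<close>. They inherit the invariance under \<open>S\<close> from the
    \<open>a k\<close>, and a further translation by \<open>g\<close> changes only the two end terms
    of the sum.\<close>
  define y where "y n f = (\<Sum>k<Suc n. a k f) / Suc n" for n f
  have am: "mean ?A (a k)" for k using a by (simp add: inv_mean_def)
  have ym: "mean ?A (y n)" for n
    unfolding mean_def
  proof (intro conjI allI impI)
    show "y n (\<lambda>x. f x + g x) = y n f + y n g" if "bounded_fun ?A f" "bounded_fun ?A g" for f g
      using mean_add[OF am that] by (simp only: y_def sum.distrib add_divide_distrib)
    show "y n (\<lambda>x. c * f x) = c * y n f" if "bounded_fun ?A f" for f c
      using mean_scale[OF am that] by (simp only: y_def sum_distrib_left[symmetric] times_divide_eq_right)
    show "0 \<le> y n f" if "bounded_fun ?A f" "\<forall>x\<in>?A. 0 \<le> f x" for f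
      unfolding y_def using that mean_nonneg[OF am] by (intro divide_nonneg_nonneg sum_nonneg) auto
    show "y n (\<lambda>_. 1) = 1" using mean_one[OF am] by (simp only: y_def) (simp add: field_simps)
  qed
  have yinv: "y n (\<lambda>x. f (h \<otimes> x)) = y n f" if "h \<in> S" "bounded_fun ?A f" for n h f
    using a that by (simp only: y_def inv_mean_def)
  have ylim: "(\<lambda>n. y n (\<lambda>x. f (g \<otimes> x)) - y n f) \<longlonglongrightarrow> 0" if f: "bounded_fun ?A f" for f
  proof -
    obtain B where B: "\<And>x. x \<in> ?A \<Longrightarrow> \<bar>f x\<bar> \<le> B" using f by (auto simp: bounded_fun_def)
    have "y n (\<lambda>x. f (g \<otimes> x)) - y n f = (a (Suc n) f - a 0 f) / Suc n" for n
      unfolding y_def aSuc[symmetric] diff_divide_distrib[symmetric] sum_subtractf[symmetric]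
      by (simp only: sum_lessThan_telescope[of "\<lambda>k. a k f" "Suc n"])
    moreover have "\<bar>a (Suc n) f - a 0 f\<bar> \<le> 2 * B" for n
    proof -
      have "\<bar>a k f\<bar> \<le> B" for k by (rule mean_abs_le[OF am]) (rule B)
      from this[of "Suc n"] this[of 0] show ?thesis by linarith
    qed
    ultimately have "norm (y n (\<lambda>x. f (g \<otimes> x)) - y n f) \<le> 2 * B / Suc n" for n
      by (simp add: divide_right_mono)
    moreover have "(\<lambda>n. 2 * B / Suc n) \<longlonglongrightarrow> 0"
      by (intro LIMSEQ_Suc[OF lim_const_over_n])
    ultimately show ?thesis by (rule Lim_null_comparison[OF always_eventually[OF allI]])
  qed
  let ?c = "\<lambda>(h, f, e). (\<lambda>x. f (h \<otimes> x), f, e :: real)"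
  \<comment> \<open>Invariance under \<open>S\<close> is exact for every \<open>y n\<close> and
    imposed with error \<open>0\<close>; invariance under \<open>g\<close> holds only in the limit
    and is imposed with all positive errors.\<close>
  define I where "I = S \<times> {f. bounded_fun ?A f} \<times> {0 :: real} \<union> {g} \<times> {f. bounded_fun ?A f} \<times> {0<..}"
  have "\<exists>m. mean ?A m \<and> (\<forall>(f, g, e)\<in>?c ` I. \<bar>m f - m g\<bar> \<le> e)"
  proof (rule mean_compactness)
    fix f1 f2 e assume "(f1, f2, e) \<in> ?c ` I"
    then show "bounded_fun ?A f1 \<and> bounded_fun ?A f2"
      using S g by (auto simp: I_def intro!: bounded_fun_comp)
  next
    fix F assume F: "finite F" "F \<subseteq> ?c ` I"
    have "\<forall>c\<in>F. \<forall>\<^sub>F n in sequentially. case c of (f1, f2, e) \<Rightarrow> \<bar>y n f1 - y n f2\<bar> \<le> e"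
    proof
      fix c assume "c \<in> F"
      then obtain h f e where c: "c = ?c (h, f, e)" "(h, f, e) \<in> I" using F(2) by auto
      show "\<forall>\<^sub>F n in sequentially. case c of (f1, f2, e) \<Rightarrow> \<bar>y n f1 - y n f2\<bar> \<le> e"
      proof (cases "h \<in> S \<and> e = 0")
        case True
        then have "h \<in> S" "e = 0" "bounded_fun ?A f" using c(2) g by (auto simp: I_def)
        then show ?thesis using c(1) yinv[of h f] by simp
      next
        case False
        then have "h = g" "0 < e" "bounded_fun ?A f" using c(2) by (auto simp: I_def)
        then have "\<forall>\<^sub>F n in sequentially. dist (y n (\<lambda>x. f (g \<otimes> x)) - y n f) 0 < e"
          using ylim tendstoD by blast
        then show ?thesis using c(1) \<open>h = g\<close> by (auto elim!: eventually_mono)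
      qed
    qed
    then have "\<forall>\<^sub>F n in sequentially. \<forall>c\<in>F. case c of (f1, f2, e) \<Rightarrow> \<bar>y n f1 - y n f2\<bar> \<le> e"
      by (simp add: eventually_ball_finite_distrib F(1))
    then obtain n where "\<forall>c\<in>F. case c of (f1, f2, e) \<Rightarrow> \<bar>y n f1 - y n f2\<bar> \<le> e"
      by (auto simp: eventually_sequentially)
    then show "\<exists>m. mean ?A m \<and> (\<forall>(f, g, e)\<in>F. \<bar>m f - m g\<bar> \<le> e)" using ym[of n] by blast
  qed
  then obtain m where m: "mean ?A m" "\<And>c. c \<in> ?c ` I \<Longrightarrow> case c of (f, g, e) \<Rightarrow> \<bar>m f - m g\<bar> \<le> e"
    by blast
  have "m (\<lambda>x. f (h \<otimes> x)) = m f" if "h \<in> S" "bounded_fun ?A f" for h f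
  proof -
    have "?c (h, f, 0) \<in> ?c ` I" by (rule imageI) (simp add: I_def that)
    from m(2)[OF this] show ?thesis by simp
  qed
  moreover have "m (\<lambda>x. f (g \<otimes> x)) = m f" if f: "bounded_fun ?A f" for f
  proof -
    have "\<bar>m (\<lambda>x. f (g \<otimes> x)) - m f\<bar> \<le> e" if "0 < e" for e
    proof -
      have "?c (g, f, e) \<in> ?c ` I" by (rule imageI) (simp add: I_def that f)
      from m(2)[OF this] show ?thesis by simp
    qed
    then show ?thesis using field_le_epsilon[of "\<bar>m (\<lambda>x. f (g \<otimes> x)) - m f\<bar>" 0] by simp
  qed
  ultimately show ?thesis using m(1) by (auto simp: inv_mean_def)
qed

text \<open>The step of a solvable series: \<open>B\<close> normalizes \<open>S\<close> and is
  commutative modulo \<open>S\<close>. Hence translation by an element of \<open>B\<close> preserves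
  invariance under \<open>S\<close> and under the elements of \<open>B\<close> treated so far, as
  \<open>inv_mean_insert\<close> requires, and finite subsets of \<open>B\<close> can be added one
  element at a time.\<close>

lemma inv_mean_extend:
  assumes S: "S \<subseteq> carrier G" and B: "B \<subseteq> carrier G" and m: "inv_mean S m"
    and normal: "\<And>g h. g \<in> B \<Longrightarrow> h \<in> S \<Longrightarrow> \<exists>h'\<in>S. h \<otimes> g = g \<otimes> h'"
    and commute: "\<And>g k. g \<in> B \<Longrightarrow> k \<in> B \<Longrightarrow> \<exists>h\<in>S. k \<otimes> g = g \<otimes> k \<otimes> h"
  shows "\<exists>m. inv_mean (S \<union> B) m"
proof (rule inv_mean_union_finite)
  show "S \<union> B \<subseteq> carrier G" using S B by blast
  let ?A = "carrier G"
  have ex: "\<exists>m. inv_mean (S \<union> B') m" if "finite B'" "B' \<subseteq> B" for B'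
    using that
  proof (induction B' rule: finite_induct)
    case empty
    then show ?case using m by auto
  next
    case (insert g B')
    then obtain m where m: "inv_mean (S \<union> B') m" by auto
    have g: "g \<in> B" "g \<in> ?A" using insert.prems B by auto
    have "inv_mean (S \<union> B') (translate g m)" if m: "inv_mean (S \<union> B') m" for m
      unfolding inv_mean_def
    proof (intro conjI ballI allI impI)
      have mm: "mean ?A m" using m by (simp add: inv_mean_def)
      show "mean ?A (translate g m)" by (rule mean_translate[OF mm g(2)])
      fix h f assume h: "h \<in> S \<union> B'" and f: "bounded_fun ?A f"
      define F where "F x = f (g \<otimes> x)" for x
      have F: "bounded_fun ?A F" unfolding F_def by (rule bounded_fun_comp[OF f]) (use g in simp)
      have hA: "h \<in> ?A" using h S B insert.prems by blast
      have mi: "m (\<lambda>x. u (k \<otimes> x)) = m u" if "k \<in> S \<union> B'" "bounded_fun ?A u" for k u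
        using m that by (simp add: inv_mean_def)
      have Fh: "bounded_fun ?A (\<lambda>x. f (h \<otimes> (g \<otimes> x)))" by (rule bounded_fun_comp[OF f]) (use g hA in simp)
      have "m (\<lambda>x. f (h \<otimes> (g \<otimes> x))) = m F"
      proof (cases "h \<in> S")
        case True
        then obtain h' where h': "h' \<in> S" "h \<otimes> g = g \<otimes> h'" using normal g by blast
        have "m (\<lambda>x. f (h \<otimes> (g \<otimes> x))) = m (\<lambda>x. F (h' \<otimes> x))"
        proof (rule mean_cong[OF mm Fh])
          fix x assume "x \<in> ?A"
          then show "f (h \<otimes> (g \<otimes> x)) = F (h' \<otimes> x)"
            using h' hA g S by (simp add: F_def m_assoc[symmetric] subset_iff)
        qed
        then show ?thesis using mi[OF _ F] h' by simp
      next
        case False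
        then have hB: "h \<in> B'" "h \<in> B" using h insert.prems by auto
        then obtain k where k: "k \<in> S" "h \<otimes> g = g \<otimes> h \<otimes> k" using commute g by blast
        have kA: "k \<in> ?A" using k S by blast
        have Fh': "bounded_fun ?A (\<lambda>x. F (h \<otimes> x))" by (rule bounded_fun_comp[OF F]) (use hA in simp)
        have "m (\<lambda>x. f (h \<otimes> (g \<otimes> x))) = m (\<lambda>x. F (h \<otimes> (k \<otimes> x)))"
        proof (rule mean_cong[OF mm Fh])
          fix x assume "x \<in> ?A"
          then show "f (h \<otimes> (g \<otimes> x)) = F (h \<otimes> (k \<otimes> x))"
            using k hA g kA by (simp add: F_def m_assoc[symmetric])
        qed
        also have "\<dots> = m (\<lambda>x. F (h \<otimes> x))" using mi[OF _ Fh'] k(1) by simp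
        also have "\<dots> = m F" using mi[OF _ F] hB by simp
        finally show ?thesis .
      qed
      moreover have "F = (\<lambda>x. f (g \<otimes> x))" by (rule ext) (simp add: F_def)
      ultimately show "translate g m (\<lambda>x. f (h \<otimes> x)) = translate g m f" by simp
    qed
    then have "\<exists>m. inv_mean (insert g (S \<union> B')) m"
      using insert.prems S B by (intro inv_mean_insert[OF _ g(2) m]) auto
    then show ?case by simp
  qed
  fix F assume F: "finite F" "F \<subseteq> S \<union> B"
  then obtain m where "inv_mean (S \<union> (F \<inter> B)) m" using ex[of "F \<inter> B"] by blast
  then have "inv_mean F m" using F(2) unfolding inv_mean_def by blast
  then show "\<exists>m. inv_mean F m" by blast
qed

end

section \<open>Groups of the form \<open>1 + L\<close>\<close>

context ring
begin

text \<open>The same construction as \<open>one_plus_levitzki\<close> with \<open>L\<close> in place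
  of the radical, so that the subgroups of the filtration have the same form as the whole
  group.\<close>

definition unipotent :: "'a set \<Rightarrow> 'a monoid" where
  "unipotent L = (units_of R)\<lparr>carrier := (\<lambda>a. \<one> \<oplus> a) ` L\<rparr>"

lemma unipotent_simps [simp]:
  "carrier (unipotent L) = (\<lambda>a. \<one> \<oplus> a) ` L"
  "x \<otimes>\<^bsub>unipotent L\<^esub> y = x \<otimes> y"
  "\<one>\<^bsub>unipotent L\<^esub> = \<one>"
  by (simp_all add: unipotent_def units_of_def)

lemma nonunital_subringD:
  assumes "nonunital_subring R L"
  shows "L \<subseteq> carrier R" "\<zero> \<in> L" "a \<in> L \<Longrightarrow> b \<in> L \<Longrightarrow> a \<oplus> b \<in> L" "a \<in> L \<Longrightarrow> \<ominus> a \<in> L"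
    "a \<in> L \<Longrightarrow> b \<in> L \<Longrightarrow> a \<otimes> b \<in> L"
proof -
  interpret additive_subgroup L R using assms by (simp add: nonunital_subring_def)
  show "L \<subseteq> carrier R" "\<zero> \<in> L" "a \<in> L \<Longrightarrow> b \<in> L \<Longrightarrow> a \<oplus> b \<in> L" "a \<in> L \<Longrightarrow> \<ominus> a \<in> L"
    by (use a_subset in auto)
  show "a \<in> L \<Longrightarrow> b \<in> L \<Longrightarrow> a \<otimes> b \<in> L" using assms by (simp add: nonunital_subring_def)
qed

lemma word_prod_replicate: "c \<in> carrier R \<Longrightarrow> word_prod (replicate n c) = c [^] n"
proof (induction n)
  case (Suc n)
  then show ?case using nat_pow_Suc2[OF Suc.prems, of n] by simp
qed simp

lemma one_plus_mult:
  "a \<in> carrier R \<Longrightarrow> b \<in> carrier R \<Longrightarrow> (\<one> \<oplus> a) \<otimes> (\<one> \<oplus> b) = \<one> \<oplus> (a \<oplus> b \<oplus> a \<otimes> b)"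
  by (simp add: l_distr r_distr a_ac)

text \<open>The geometric series.\<close>

lemma unipotent_right_inverse:
  assumes L: "nonunital_subring R L" "loc_nil L" and a: "a \<in> L"
  obtains b where "b \<in> L" "(\<one> \<oplus> a) \<otimes> (\<one> \<oplus> b) = \<one>"
proof -
  note LD = nonunital_subringD[OF L(1)]
  define c where "c = \<ominus> a"
  have c: "c \<in> L" "c \<in> carrier R" "\<one> \<oplus> a = \<one> \<ominus> c"
    using a LD by (auto simp: c_def minus_eq subset_iff)
  obtain k where k: "\<And>xs. length xs = k \<Longrightarrow> set xs \<subseteq> {c} \<Longrightarrow> word_prod xs = \<zero>"
    using L(2) c(1) unfolding loc_nil_def by (metis empty_subsetI finite.emptyI finite_insert insert_subset)
  have ck: "c [^] k = \<zero>"
    using k[of "replicate k c"] c word_prod_replicate by (auto simp: set_replicate_conv_if)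
  \<comment> \<open>The witness is given by \<open>\<one> \<oplus> b = \<one> \<oplus> c \<oplus>
    ... \<oplus> c [^] n\<close>. The recursion from \<open>b\<close> to
    \<open>c \<oplus> c \<otimes> b\<close> stays in \<open>L\<close>, which need not contain
    \<open>\<one>\<close>.\<close>
  have "\<exists>b\<in>L. (\<one> \<ominus> c) \<otimes> (\<one> \<oplus> b) = \<one> \<ominus> c [^] Suc n" for n
  proof (induction n)
    case 0
    show ?case using LD(2) c by (intro bexI[of _ \<zero>]) auto
  next
    case (Suc n)
    then obtain b where b: "b \<in> L" "(\<one> \<ominus> c) \<otimes> (\<one> \<oplus> b) = \<one> \<ominus> c [^] Suc n" by blast
    have bc: "b \<in> carrier R" using b LD by blast
    have "(\<one> \<ominus> c) \<otimes> (\<one> \<oplus> (c \<oplus> c \<otimes> b)) = (\<one> \<ominus> c) \<oplus> (\<one> \<ominus> c) \<otimes> (c \<otimes> (\<one> \<oplus> b))"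
      using c bc by (simp add: r_distr)
    also have "(\<one> \<ominus> c) \<otimes> (c \<otimes> (\<one> \<oplus> b)) = c \<otimes> ((\<one> \<ominus> c) \<otimes> (\<one> \<oplus> b))"
      using c bc by (simp add: minus_eq l_distr r_distr l_minus r_minus m_assoc)
    also have "\<dots> = c \<ominus> c [^] Suc (Suc n)"
      unfolding b(2) using c nat_pow_Suc2[of c "Suc n"] by (simp add: minus_eq r_distr r_minus)
    also have "(\<one> \<ominus> c) \<oplus> (c \<ominus> c [^] Suc (Suc n)) = \<one> \<ominus> c [^] Suc (Suc n)"
      using c a_assoc[of "\<ominus> c" c "\<ominus> (c [^] Suc (Suc n))"] by (simp add: minus_eq a_assoc l_neg)
    finally show ?case using b(1) c(1) LD by (intro bexI[of _ "c \<oplus> c \<otimes> b"]) auto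
  qed
  then obtain b where b: "b \<in> L" "(\<one> \<ominus> c) \<otimes> (\<one> \<oplus> b) = \<one> \<ominus> c [^] Suc k" by blast
  moreover have "c [^] Suc k = \<zero>" using ck c by simp
  ultimately show thesis using that c(3) by (simp add: minus_eq)
qed

text \<open>A right inverse that itself has a right inverse is two-sided: \<open>x y = 1\<close> and
  \<open>y z = 1\<close> imply \<open>x = z\<close>.\<close>

lemma unipotent_group:
  assumes L: "nonunital_subring R L" "loc_nil L"
  shows "group (unipotent L)"
proof (rule groupI)
  note LD = nonunital_subringD[OF L(1)]
  fix x assume x: "x \<in> carrier (unipotent L)"
  then obtain a where a: "a \<in> L" "x = \<one> \<oplus> a" by auto
  obtain b where b: "b \<in> L" "x \<otimes> (\<one> \<oplus> b) = \<one>"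
    using unipotent_right_inverse[OF L a(1)] a(2) by metis
  obtain d where d: "d \<in> L" "(\<one> \<oplus> b) \<otimes> (\<one> \<oplus> d) = \<one>"
    using unipotent_right_inverse[OF L b(1)] by metis
  have c: "x \<in> carrier R" "b \<in> carrier R" "d \<in> carrier R" using a b d LD by auto
  have "x = x \<otimes> ((\<one> \<oplus> b) \<otimes> (\<one> \<oplus> d))" using c d by simp
  also have "\<dots> = \<one> \<oplus> d" using c b(2) by (simp add: m_assoc[symmetric])
  finally have "(\<one> \<oplus> b) \<otimes> x = \<one>" using d by simp
  then show "\<exists>y\<in>carrier (unipotent L). y \<otimes>\<^bsub>unipotent L\<^esub> x = \<one>\<^bsub>unipotent L\<^esub>"
    using b by auto
next
  note LD = nonunital_subringD[OF L(1)]
  show "\<one>\<^bsub>unipotent L\<^esub> \<in> carrier (unipotent L)"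
    using LD(2) by (auto intro: image_eqI[of _ _ \<zero>])
  fix x y assume "x \<in> carrier (unipotent L)" "y \<in> carrier (unipotent L)"
  then obtain a b where ab: "a \<in> L" "x = \<one> \<oplus> a" "b \<in> L" "y = \<one> \<oplus> b" by auto
  then have "x \<otimes> y = \<one> \<oplus> (a \<oplus> b \<oplus> a \<otimes> b)" using LD(1) by (simp add: one_plus_mult subset_iff)
  moreover have "a \<oplus> b \<oplus> a \<otimes> b \<in> L" using ab LD by simp
  ultimately show "x \<otimes>\<^bsub>unipotent L\<^esub> y \<in> carrier (unipotent L)" by simp
qed (use nonunital_subringD(1)[OF L(1)] in \<open>auto simp: m_assoc subset_iff\<close>)

text \<open>By distributivity: induction on \<open>b\<close> for a fixed generator \<open>u\<close>,
  then on \<open>a\<close>. It yields that the powers of a generated ring multiply by adding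
  exponents.\<close>

lemma generate_add_mult:
  assumes UVW: "U \<subseteq> carrier R" "V \<subseteq> carrier R" "W \<subseteq> carrier R"
    and mult: "\<And>u v. u \<in> U \<Longrightarrow> v \<in> V \<Longrightarrow> u \<otimes> v \<in> W"
    and a: "a \<in> generate (add_monoid R) U" and b: "b \<in> generate (add_monoid R) V"
  shows "a \<otimes> b \<in> generate (add_monoid R) W"
proof -
  let ?g = "generate (add_monoid R)"
  have W: "additive_subgroup (?g W) R"
    using add.generate_is_subgroup UVW by (intro additive_subgroup.intro) auto
  interpret W: additive_subgroup "?g W" R by (rule W)
  have Vc: "v \<in> carrier R" if "v \<in> ?g V" for v
    using that add.generate_incl[of V] UVW by auto
  have Uc: "u \<in> carrier R" if "u \<in> ?g U" for u
    using that add.generate_incl[of U] UVW by auto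
  have 1: "u \<otimes> b \<in> ?g W" if u: "u \<in> U" for u
    using b
  proof (induction rule: generate.induct)
    case one then show ?case using u UVW by auto
  next
    case (incl v) then show ?case using mult u by (auto intro: generate.incl)
  next
    case (inv v)
    have "u \<otimes> v \<in> ?g W" using inv mult u by (auto intro: generate.incl)
    then have "\<ominus> (u \<otimes> v) \<in> ?g W" by simp
    then show ?case using u inv UVW by (auto simp: r_minus subset_iff simp flip: a_inv_def)
  next
    case (eng v w)
    then have "u \<otimes> v \<oplus> u \<otimes> w \<in> ?g W" by simp
    then show ?case using u Vc[OF eng.hyps(1)] Vc[OF eng.hyps(2)] UVW by (auto simp: r_distr subset_iff)
  qed
  have bc: "b \<in> carrier R" using Vc b by simp
  show ?thesis
    using a
  proof (induction rule: generate.induct)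
    case one then show ?case using bc by auto
  next
    case (incl v) then show ?case using 1 by auto
  next
    case (inv v)
    then have "\<ominus> (v \<otimes> b) \<in> ?g W" using 1 by simp
    then show ?case using bc inv UVW by (auto simp: l_minus subset_iff simp flip: a_inv_def)
  next
    case (eng v w)
    then have "v \<otimes> b \<oplus> w \<otimes> b \<in> ?g W" by simp
    then show ?case using bc Uc[OF eng.hyps(1)] Uc[OF eng.hyps(2)] by (auto simp: l_distr)
  qed
qed

text \<open>
  Every finite subset of \<open>L\<close> generates a nilpotent ring \<open>S 1\<close> with powers \<open>S n\<close>, and
  \<open>1 + S n\<close> is abelian modulo the normal subgroup \<open>1 + S (n + 1)\<close>.
\<close>

lemma unipotent_inv_mean:
  assumes L: "nonunital_subring R L" "loc_nil L"
  shows "\<exists>m. group.inv_mean (unipotent L) (carrier (unipotent L)) m"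
proof -
  note LD = nonunital_subringD[OF L(1)]
  interpret G: group "unipotent L" by (rule unipotent_group[OF L])
  show ?thesis
  proof (rule G.inv_mean_union_finite)
    fix F assume F: "finite F" "F \<subseteq> carrier (unipotent L)"
    then obtain F0 where F0: "finite F0" "F0 \<subseteq> L" "F = (\<lambda>a. \<one> \<oplus> a) ` F0"
      using finite_subset_image[of F "\<lambda>a. \<one> \<oplus> a" L] by auto
    have F0c: "F0 \<subseteq> carrier R" using F0 LD by blast
    obtain k where k: "\<And>xs. length xs = k \<Longrightarrow> set xs \<subseteq> F0 \<Longrightarrow> word_prod xs = \<zero>"
      using L(2) F0(1,2) unfolding loc_nil_def by blast
    \<comment> \<open>Words of length at least \<open>n\<close>, not exactly \<open>n\<close>, so
      that the groups \<open>S n\<close> decrease and \<open>S n\<close> is the \<open>n\<close>-th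
      power of the ring \<open>S 1\<close> for \<open>n \<ge> 1\<close>.\<close>
    define W where "W n = word_prod ` {xs. set xs \<subseteq> F0 \<and> n \<le> length xs}" for n
    define S where "S n = generate (add_monoid R) (W n)" for n
    have Wc: "W n \<subseteq> carrier R" for n using F0c by (auto simp: W_def)
    have Sadd: "additive_subgroup (S n) R" for n
      unfolding S_def using add.generate_is_subgroup Wc by (intro additive_subgroup.intro) auto
    have Sz: "\<zero> \<in> S n" and Sa: "a \<in> S n \<Longrightarrow> b \<in> S n \<Longrightarrow> a \<oplus> b \<in> S n"
      and Sm: "a \<in> S n \<Longrightarrow> \<ominus> a \<in> S n" and Sc: "a \<in> S n \<Longrightarrow> a \<in> carrier R" for a b n
    proof -
      interpret additive_subgroup "S n" R by (rule Sadd)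
      show "\<zero> \<in> S n" "a \<in> S n \<Longrightarrow> b \<in> S n \<Longrightarrow> a \<oplus> b \<in> S n" "a \<in> S n \<Longrightarrow> \<ominus> a \<in> S n"
        "a \<in> S n \<Longrightarrow> a \<in> carrier R" by auto
    qed
    have Smono: "S n \<subseteq> S l" if "l \<le> n" for l n
      unfolding S_def by (rule add.mono_generate) (use that in \<open>auto simp: W_def\<close>)
    have Smult: "a \<otimes> b \<in> S l" if "a \<in> S i" "b \<in> S j" "l \<le> i + j" for a b i j l
      unfolding S_def
    proof (rule generate_add_mult[OF Wc Wc Wc])
      fix u v assume "u \<in> W i" "v \<in> W j"
      then obtain xs ys where xy: "set xs \<subseteq> F0" "i \<le> length xs" "u = word_prod xs"
        "set ys \<subseteq> F0" "j \<le> length ys" "v = word_prod ys" by (auto simp: W_def)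
      then have "u \<otimes> v = word_prod (xs @ ys)" using word_prod_append F0c by auto
      then show "u \<otimes> v \<in> W l" unfolding W_def using xy that(3) by (intro image_eqI[of _ _ "xs @ ys"]) auto
    qed (use that in \<open>simp_all add: S_def\<close>)
    have wpL: "word_prod xs \<in> L" if "set xs \<subseteq> F0" "xs \<noteq> []" for xs
      using that
    proof (induction xs)
      case (Cons x xs)
      then show ?case using F0(2) LD(1,5) by (cases "xs = []") (auto simp: subset_iff)
    qed simp
    have SL: "S n \<subseteq> L" if "1 \<le> n" for n
    proof
      fix a assume "a \<in> S n"
      then show "a \<in> L"
        unfolding S_def
      proof (induction rule: generate.induct)
        case one show ?case using LD by simp
      next
        case (incl a) then show ?case using wpL that by (force simp: W_def)
      next
        case (inv a)
        then have "a \<in> L" using wpL that by (force simp: W_def)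
        then show ?case using LD(4) by (simp flip: a_inv_def)
      next
        case (eng a b) then show ?case using LD by simp
      qed
    qed
    have S1: "nonunital_subring R (S 1)"
      unfolding nonunital_subring_def using Sadd Smult[of _ 1 _ 1 1] by auto
    have S1n: "loc_nil (S 1)" by (rule loc_nil_subset[OF L(2) SL]) simp
    have carr: "(\<lambda>a. \<one> \<oplus> a) ` S n \<subseteq> carrier (unipotent L)" if "1 \<le> n" for n
      using SL[OF that] by auto
    \<comment> \<open>The induction descends from \<open>k'\<close> to \<open>1\<close>, so it must
      start at an index of at least \<open>1\<close>, also for \<open>k = 0\<close>, which can occur
      if \<open>\<one> = \<zero>\<close>.\<close>
    define k' where "k' = max k 1"
    have "\<exists>m. G.inv_mean ((\<lambda>a. \<one> \<oplus> a) ` S 1) m"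
    proof (rule inc_induct[of 1 k' "\<lambda>n. \<exists>m. G.inv_mean ((\<lambda>a. \<one> \<oplus> a) ` S n) m"])
      show "1 \<le> k'" by (simp add: k'_def)
      have W0: "W k' \<subseteq> {\<zero>}"
      proof
        fix w assume "w \<in> W k'"
        then obtain xs where xs: "set xs \<subseteq> F0" "k' \<le> length xs" "w = word_prod xs" by (auto simp: W_def)
        have sets: "set (take k xs) \<subseteq> F0" "set (drop k xs) \<subseteq> F0"
          using xs(1) set_take_subset[of k xs] set_drop_subset[of k xs] by auto
        have "word_prod xs = word_prod (take k xs) \<otimes> word_prod (drop k xs)"
          using word_prod_append[of "take k xs" "drop k xs"] sets F0c by auto
        moreover have "word_prod (take k xs) = \<zero>"
          using sets xs(2) by (intro k) (auto simp: k'_def)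
        ultimately show "w \<in> {\<zero>}" using xs(3) sets F0c by auto
      qed
      have "a = \<zero>" if "a \<in> S k'" for a
        using that unfolding S_def
      proof (induction rule: generate.induct)
        case (inv a)
        then have "a = \<zero>" using W0 by auto
        then show ?case by (simp flip: a_inv_def)
      qed (use W0 in auto)
      then have "S k' \<subseteq> {\<zero>}" by blast
      then have "(\<lambda>a. \<one> \<oplus> a) ` S k' \<subseteq> {\<one>}" by auto
      moreover have "mean (carrier (unipotent L)) (\<lambda>f. f \<one>)"
        using mean_eval[of \<one> "carrier (unipotent L)"] G.one_closed by simp
      ultimately have "G.inv_mean ((\<lambda>a. \<one> \<oplus> a) ` S k') (\<lambda>f. f \<one>)"
        unfolding G.inv_mean_def by auto
      then show "\<exists>m. G.inv_mean ((\<lambda>a. \<one> \<oplus> a) ` S k') m" by blast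
    next
      fix n assume n: "1 \<le> n" "\<exists>m. G.inv_mean ((\<lambda>a. \<one> \<oplus> a) ` S (Suc n)) m"
      then obtain m where m: "G.inv_mean ((\<lambda>a. \<one> \<oplus> a) ` S (Suc n)) m" by blast
      have "\<exists>m. G.inv_mean ((\<lambda>a. \<one> \<oplus> a) ` S (Suc n) \<union> (\<lambda>a. \<one> \<oplus> a) ` S n) m"
      proof (rule G.inv_mean_extend[OF carr carr[OF n(1)] m])
        fix g h assume "g \<in> (\<lambda>a. \<one> \<oplus> a) ` S n" "h \<in> (\<lambda>a. \<one> \<oplus> a) ` S (Suc n)"
        then obtain a b where ab: "a \<in> S n" "g = \<one> \<oplus> a" "b \<in> S (Suc n)" "h = \<one> \<oplus> b" by auto
        have "a \<in> S 1" using ab Smono n by blast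
        then obtain c where c: "c \<in> S 1" "g \<otimes> (\<one> \<oplus> c) = \<one>"
          using unipotent_right_inverse[OF S1 S1n] ab(2) by metis
        have cc: "a \<in> carrier R" "b \<in> carrier R" "c \<in> carrier R" "g \<in> carrier R"
          using ab c Sc by auto
        \<comment> \<open>The conjugate of \<open>b\<close> by \<open>g\<close>, with
          \<open>\<one> \<oplus> c\<close> as the inverse of \<open>g\<close>, so that
          \<open>h \<otimes> g = g \<otimes> (\<one> \<oplus> y)\<close>.\<close>
        define y where "y = (\<one> \<oplus> c) \<otimes> b \<otimes> g"
        have bc: "b \<oplus> c \<otimes> b \<in> S (Suc n)" using ab c by (intro Sa Smult[of c 1 b "Suc n"]) auto
        have "y = (b \<oplus> c \<otimes> b) \<oplus> (b \<oplus> c \<otimes> b) \<otimes> a"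
          using cc ab(2) by (simp add: y_def l_distr r_distr)
        also have "\<dots> \<in> S (Suc n)"
          using Sa[OF bc Smult[OF bc ab(1), of "Suc n"]] by simp
        finally have y: "y \<in> S (Suc n)" .
        have "g \<otimes> y = g \<otimes> (\<one> \<oplus> c) \<otimes> (b \<otimes> g)"
          using cc by (simp add: y_def m_assoc)
        then have "g \<otimes> (\<one> \<oplus> y) = g \<oplus> g \<otimes> (\<one> \<oplus> c) \<otimes> (b \<otimes> g)"
          using cc Sc[OF y] r_distr[of \<one> y g] by simp
        also have "\<dots> = h \<otimes> g" using cc c(2) ab(4) by (simp add: l_distr)
        finally show "\<exists>h'\<in>(\<lambda>a. \<one> \<oplus> a) ` S (Suc n). h \<otimes>\<^bsub>unipotent L\<^esub> g = g \<otimes>\<^bsub>unipotent L\<^esub> h'"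
          using y by (intro bexI[of _ "\<one> \<oplus> y"]) simp_all
      next
        fix g l assume "g \<in> (\<lambda>a. \<one> \<oplus> a) ` S n" "l \<in> (\<lambda>a. \<one> \<oplus> a) ` S n"
        then obtain a d where ad: "a \<in> S n" "g = \<one> \<oplus> a" "d \<in> S n" "l = \<one> \<oplus> d" by auto
        define p where "p = a \<oplus> d \<oplus> a \<otimes> d"
        have cc: "a \<in> carrier R" "d \<in> carrier R" using ad Sc by auto
        have gl: "g \<otimes> l = \<one> \<oplus> p" "l \<otimes> g = \<one> \<oplus> (d \<oplus> a \<oplus> d \<otimes> a)"
          using cc ad by (simp_all add: one_plus_mult p_def)
        have "p \<in> S n" unfolding p_def using ad by (intro Sa Smult[of a n d n]) auto
        then have "p \<in> S 1" using Smono n by blast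
        then obtain c where c: "c \<in> S 1" "(\<one> \<oplus> p) \<otimes> (\<one> \<oplus> c) = \<one>"
          using unipotent_right_inverse[OF S1 S1n] by metis
        \<comment> \<open>The commutator \<open>q\<close> satisfies
          \<open>l \<otimes> g = g \<otimes> l \<oplus> q\<close> and lies in
          \<open>S (n + n)\<close>, hence in \<open>S (Suc n)\<close> because
          \<open>n \<ge> 1\<close>. Below, \<open>y\<close> is \<open>q\<close> multiplied on the
          left by the inverse of \<open>g \<otimes> l\<close>.\<close>
        define q where "q = d \<otimes> a \<ominus> a \<otimes> d"
        have q: "q \<in> S (Suc n)"
          unfolding q_def minus_eq using ad n
          by (intro Sa Sm Smult[of d n a n] Smult[of a n d n]) auto
        have cc': "c \<in> carrier R" "p \<in> carrier R" "q \<in> carrier R"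
          using c Sc q \<open>p \<in> S n\<close> by auto
        define y where "y = q \<oplus> c \<otimes> q"
        have y: "y \<in> S (Suc n)"
          unfolding y_def using q c by (intro Sa Smult[of c 1 q "Suc n"]) auto
        have "y = (\<one> \<oplus> c) \<otimes> q" using cc' by (simp add: y_def l_distr)
        then have "(\<one> \<oplus> p) \<otimes> y = (\<one> \<oplus> p) \<otimes> (\<one> \<oplus> c) \<otimes> q"
          using cc' by (simp add: m_assoc)
        then have "g \<otimes> l \<otimes> (\<one> \<oplus> y) = (\<one> \<oplus> p) \<oplus> (\<one> \<oplus> p) \<otimes> (\<one> \<oplus> c) \<otimes> q"
          using cc' gl(1) Sc[OF y] r_distr[of \<one> y "\<one> \<oplus> p"] by simp
        also have "\<dots> = \<one> \<oplus> (p \<oplus> q)" using cc' c(2) by (simp add: a_assoc)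
        also have "p \<oplus> q = d \<oplus> a \<oplus> d \<otimes> a"
        proof -
          have "p \<oplus> q = a \<oplus> d \<oplus> d \<otimes> a \<oplus> (a \<otimes> d \<ominus> a \<otimes> d)"
            using cc by (simp add: p_def q_def minus_eq a_ac)
          then show ?thesis using cc a_comm[of a d] by (simp add: minus_eq r_neg)
        qed
        finally have "l \<otimes> g = g \<otimes> l \<otimes> (\<one> \<oplus> y)" using gl by simp
        then show "\<exists>h\<in>(\<lambda>a. \<one> \<oplus> a) ` S (Suc n).
            l \<otimes>\<^bsub>unipotent L\<^esub> g = g \<otimes>\<^bsub>unipotent L\<^esub> l \<otimes>\<^bsub>unipotent L\<^esub> h"
          using y by (intro bexI[of _ "\<one> \<oplus> y"]) simp_all
      qed simp
      moreover have "(\<lambda>a. \<one> \<oplus> a) ` S (Suc n) \<union> (\<lambda>a. \<one> \<oplus> a) ` S n = (\<lambda>a. \<one> \<oplus> a) ` S n"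
        using Smono[of n "Suc n"] by auto
      ultimately show "\<exists>m. G.inv_mean ((\<lambda>a. \<one> \<oplus> a) ` S n) m" by simp
    qed
    then obtain m where m: "G.inv_mean ((\<lambda>a. \<one> \<oplus> a) ` S 1) m" by blast
    have "F0 \<subseteq> S 1"
    proof
      fix a assume a: "a \<in> F0"
      then have "a = word_prod [a]" using F0c by auto
      then have "a \<in> W 1" unfolding W_def using a by (intro image_eqI[of _ _ "[a]"]) auto
      then show "a \<in> S 1" unfolding S_def by (rule generate.incl)
    qed
    then have "G.inv_mean F m" using m F0(3) unfolding G.inv_mean_def by blast
    then show "\<exists>m. G.inv_mean F m" by blast
  qed simp
qed

end

section \<open>Concentration of measure and fixed points\<close>

lemma mean_sum:
  assumes "mean A m" "finite I" "\<And>i. i \<in> I \<Longrightarrow> bounded_fun A (f i)"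
  shows "bounded_fun A (\<lambda>x. \<Sum>i\<in>I. f i x) \<and> m (\<lambda>x. \<Sum>i\<in>I. f i x) = (\<Sum>i\<in>I. m (f i))"
  using assms(2,3)
proof (induction I rule: finite_induct)
  case empty
  then show ?case using mean_const[OF assms(1), of 0] by simp
next
  case (insert i I)
  then show ?case using mean_add[OF assms(1), of "f i" "\<lambda>x. \<Sum>i\<in>I. f i x"] by auto
qed

section \<open>Groups with a bi-invariant metric\<close>

locale biinvariant_metric_group = group G + M: Metric_space "carrier G" d
  for G :: "('a, 'm) monoid_scheme" (structure) and d :: "'a \<Rightarrow> 'a \<Rightarrow> real" +
  assumes left_invariant: "\<lbrakk>g \<in> carrier G; x \<in> carrier G; y \<in> carrier G\<rbrakk> \<Longrightarrow> d (g \<otimes> x) (g \<otimes> y) = d x y"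
    and right_invariant: "\<lbrakk>g \<in> carrier G; x \<in> carrier G; y \<in> carrier G\<rbrakk> \<Longrightarrow> d (x \<otimes> g) (y \<otimes> g) = d x y"
begin

text \<open>Bi-invariance gives \<open>d (x \<otimes> y) (a \<otimes> b) \<le> d x a + d y b\<close>
  and makes inversion an isometry.\<close>

lemma topological_group: "topological_group G M.mtopology"
  unfolding topological_group_def
proof (intro conjI)
  show "group G" by (rule group_axioms)
  show "continuous_map (prod_topology M.mtopology M.mtopology) M.mtopology (\<lambda>(x, y). x \<otimes> y)"
    unfolding continuous_map_def
  proof (intro conjI allI impI)
    fix U assume U: "openin M.mtopology U"
    show "openin (prod_topology M.mtopology M.mtopology)
      {x \<in> topspace (prod_topology M.mtopology M.mtopology). (case x of (x, y) \<Rightarrow> x \<otimes> y) \<in> U}"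
      unfolding openin_prod_topology_alt
    proof (intro allI impI)
      fix x y
      assume "(x, y) \<in> {x \<in> topspace (prod_topology M.mtopology M.mtopology). (case x of (x, y) \<Rightarrow> x \<otimes> y) \<in> U}"
      then have xy: "x \<in> carrier G" "y \<in> carrier G" "x \<otimes> y \<in> U" by auto
      then obtain r where r: "r > 0" "M.mball (x \<otimes> y) r \<subseteq> U" using U by (auto simp: M.openin_mtopology)
      have "a \<otimes> b \<in> U" if ab: "a \<in> M.mball x (r / 2)" "b \<in> M.mball y (r / 2)" for a b
      proof -
        have c: "a \<in> carrier G" "b \<in> carrier G" and dd: "d x a < r / 2" "d y b < r / 2" using ab by auto
        have "d (x \<otimes> y) (a \<otimes> b) \<le> d (x \<otimes> y) (a \<otimes> y) + d (a \<otimes> y) (a \<otimes> b)"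
          using xy c by (intro M.triangle) auto
        also have "\<dots> = d x a + d y b" using xy c by (simp add: left_invariant right_invariant)
        finally show ?thesis using r(2) dd xy c by (auto intro!: subsetD[OF r(2)])
      qed
      then show "\<exists>U' V. openin M.mtopology U' \<and> openin M.mtopology V \<and> x \<in> U' \<and> y \<in> V \<and>
          U' \<times> V \<subseteq> {x \<in> topspace (prod_topology M.mtopology M.mtopology). (case x of (x, y) \<Rightarrow> x \<otimes> y) \<in> U}"
        using xy r(1)
        by (intro exI[of _ "M.mball x (r / 2)"] exI[of _ "M.mball y (r / 2)"]) auto
    qed
  qed auto
  have "d (inv x) (inv y) = d x y" if "x \<in> carrier G" "y \<in> carrier G" for x y
  proof -
    have "d (inv x) (inv y) = d (x \<otimes> inv x) (x \<otimes> inv y)"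
      using left_invariant[of x "inv x" "inv y"] that by (simp del: r_inv)
    also have "\<dots> = d (x \<otimes> inv x \<otimes> y) (x \<otimes> inv y \<otimes> y)"
      using right_invariant[of y "x \<otimes> inv x" "x \<otimes> inv y"] that by (simp del: r_inv)
    also have "x \<otimes> inv x \<otimes> y = y" using that by simp
    also have "x \<otimes> inv y \<otimes> y = x" using that by (simp add: m_assoc)
    finally show ?thesis using M.commute by simp
  qed
  then show "continuous_map M.mtopology M.mtopology (\<lambda>x. inv x)"
    unfolding M.metric_continuous_map[OF M.Metric_space_axioms] by auto
qed simp

text \<open>\<open>T\<close> averages \<open>S f\<close> over the left coset \<open>x H\<close>,
  like a conditional expectation. \<open>S\<close> is an arbitrary family of means, so the
  construction can be iterated along a chain of subgroups.\<close>

lemma coset_average: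
  assumes H: "subgroup H G" and m: "mean H m"
    and inv: "\<And>h f. h \<in> H \<Longrightarrow> bounded_fun H f \<Longrightarrow> m (\<lambda>x. f (h \<otimes> x)) = m f"
    and S: "\<And>x. x \<in> carrier G \<Longrightarrow> mean (carrier G) (\<lambda>f. S f x)"
  defines "T \<equiv> \<lambda>f x. m (\<lambda>h. S f (x \<otimes> h))"
  shows "\<And>x. x \<in> carrier G \<Longrightarrow> mean (carrier G) (\<lambda>f. T f x)"
    "\<And>f x k. bounded_fun (carrier G) f \<Longrightarrow> x \<in> carrier G \<Longrightarrow> k \<in> H \<Longrightarrow> T f (x \<otimes> k) = T f x"
proof -
  have HG: "h \<in> carrier G" if "h \<in> H" for h using subgroup.mem_carrier[OF H that] .
  have bS: "bounded_fun H (\<lambda>h. S f (x \<otimes> h))" if f: "bounded_fun (carrier G) f" and x: "x \<in> carrier G" for f x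
  proof -
    obtain B where B: "\<And>x. x \<in> carrier G \<Longrightarrow> \<bar>f x\<bar> \<le> B" using f by (auto simp: bounded_fun_def)
    have "\<bar>S f (x \<otimes> h)\<bar> \<le> B" if "h \<in> H" for h
      using mean_abs_le[OF S[of "x \<otimes> h"], of f B] B x HG[OF that] by simp
    then show ?thesis by (auto simp: bounded_fun_def)
  qed
  show "mean (carrier G) (\<lambda>f. T f x)" if x: "x \<in> carrier G" for x
    unfolding mean_def T_def
  proof (intro conjI allI impI)
    fix f g assume fg: "bounded_fun (carrier G) f" "bounded_fun (carrier G) g"
    have "m (\<lambda>h. S (\<lambda>x. f x + g x) (x \<otimes> h)) = m (\<lambda>h. S f (x \<otimes> h) + S g (x \<otimes> h))"
      using fg x HG by (intro mean_cong[OF m bS] mean_add[OF S]) auto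
    also have "\<dots> = m (\<lambda>h. S f (x \<otimes> h)) + m (\<lambda>h. S g (x \<otimes> h))"
      by (rule mean_add[OF m bS bS]) (use fg x in auto)
    finally show "m (\<lambda>h. S (\<lambda>x. f x + g x) (x \<otimes> h)) = m (\<lambda>h. S f (x \<otimes> h)) + m (\<lambda>h. S g (x \<otimes> h))" .
  next
    fix f and c :: real assume f: "bounded_fun (carrier G) f"
    have "m (\<lambda>h. S (\<lambda>x. c * f x) (x \<otimes> h)) = m (\<lambda>h. c * S f (x \<otimes> h))"
      using f x HG by (intro mean_cong[OF m bS] mean_scale[OF S]) auto
    also have "\<dots> = c * m (\<lambda>h. S f (x \<otimes> h))" by (rule mean_scale[OF m bS[OF f x]])
    finally show "m (\<lambda>h. S (\<lambda>x. c * f x) (x \<otimes> h)) = c * m (\<lambda>h. S f (x \<otimes> h))" .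
  next
    fix f assume "bounded_fun (carrier G) f" "\<forall>x\<in>carrier G. 0 \<le> f x"
    then show "0 \<le> m (\<lambda>h. S f (x \<otimes> h))"
      using x HG by (intro mean_nonneg[OF m bS] mean_nonneg[OF S]) auto
  next
    have "m (\<lambda>h. S (\<lambda>_. 1) (x \<otimes> h)) = m (\<lambda>_. 1)"
      using x HG by (intro mean_cong[OF m bS] mean_one[OF S]) auto
    then show "m (\<lambda>h. S (\<lambda>_. 1) (x \<otimes> h)) = 1" using mean_one[OF m] by simp
  qed
  show "T f (x \<otimes> k) = T f x" if f: "bounded_fun (carrier G) f" and x: "x \<in> carrier G" and k: "k \<in> H" for f x k
  proof -
    have "T f (x \<otimes> k) = m (\<lambda>h. S f (x \<otimes> (k \<otimes> h)))"
      unfolding T_def using x k HG bS[OF f, of "x \<otimes> k"]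
      by (intro mean_cong[OF m]) (auto simp: m_assoc)
    also have "\<dots> = T f x" unfolding T_def by (rule inv[OF k bS[OF f x]])
    finally show ?thesis .
  qed
qed

text \<open>
  Averaging successively over the subgroups of the chain writes \<open>f - m f\<close> as a sum of martingale
  differences that are orthogonal and at most \<open>L / N\<close>.
\<close>

lemma concentration:
  assumes N: "N \<ge> 1" and K0: "K 0 = {\<one>}" and KN: "K N = carrier G"
    and K: "\<And>i. i \<le> N \<Longrightarrow> subgroup (K i) G" "\<And>i. i < N \<Longrightarrow> K i \<subseteq> K (Suc i)"
    and means: "\<And>i. i \<le> N \<Longrightarrow> \<exists>m. mean (K i) m \<and>
      (\<forall>h\<in>K i. \<forall>f. bounded_fun (K i) f \<longrightarrow> m (\<lambda>x. f (h \<otimes> x)) = m f)"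
    and step: "\<And>i x. i < N \<Longrightarrow> x \<in> K (Suc i) \<Longrightarrow> \<exists>y\<in>K i. d x y \<le> 1 / N"
  obtains m where "inv_mean (carrier G) m"
    "\<And>f L. bounded_fun (carrier G) f \<Longrightarrow> 0 \<le> L \<Longrightarrow>
       (\<And>x y. x \<in> carrier G \<Longrightarrow> y \<in> carrier G \<Longrightarrow> \<bar>f x - f y\<bar> \<le> L * d x y) \<Longrightarrow>
       m (\<lambda>x. (f x - m f)\<^sup>2) \<le> L\<^sup>2 / N"
proof -
  let ?A = "carrier G"
  have KA: "h \<in> ?A" if "i \<le> N" "h \<in> K i" for i h using subgroup.mem_carrier[OF K(1)] that by blast
  obtain \<mu> where \<mu>: "\<And>i. i \<le> N \<Longrightarrow> mean (K i) (\<mu> i)"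
    "\<And>i h f. i \<le> N \<Longrightarrow> h \<in> K i \<Longrightarrow> bounded_fun (K i) f \<Longrightarrow> \<mu> i (\<lambda>x. f (h \<otimes> x)) = \<mu> i f"
    using means by metis
  \<comment> \<open>\<open>S i\<close> plays the part of the conditional expectation onto functions
    constant on the left cosets of \<open>K i\<close>. It averages over \<open>K 1\<close>, ...,
    \<open>K i\<close> in turn and starts with the identity because \<open>K 0\<close> is
    trivial.\<close>
  define S where "S = rec_nat (\<lambda>f. f) (\<lambda>i S f x. \<mu> (Suc i) (\<lambda>h. S f (x \<otimes> h)))"
  have S0: "S 0 f x = f x" and SS: "S (Suc i) f x = \<mu> (Suc i) (\<lambda>h. S i f (x \<otimes> h))" for i f x
    by (simp_all add: S_def)
  have SS': "S (Suc i) = (\<lambda>f x. \<mu> (Suc i) (\<lambda>h. S i f (x \<otimes> h)))" for i by (simp add: S_def)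
  have Sm: "mean ?A (\<lambda>f. S i f x)" if "i \<le> N" "x \<in> ?A" for i x
    using that
  proof (induction i arbitrary: x)
    case 0 then show ?case by (simp add: S0 mean_eval)
  next
    case (Suc i)
    show ?case unfolding SS'
      by (rule coset_average(1)[OF K(1)[OF Suc.prems(1)] \<mu>(1)[OF Suc.prems(1)] \<mu>(2)[OF Suc.prems(1)] Suc.IH])
        (use Suc.prems in auto)
  qed
  have Sinv: "S i f (x \<otimes> k) = S i f x" if "i \<le> N" "bounded_fun ?A f" "x \<in> ?A" "k \<in> K i" for i f x k
  proof (cases i)
    case 0
    then show ?thesis using that K0 by (simp add: S0)
  next
    case (Suc j)
    have j: "Suc j \<le> N" using that Suc by simp
    show ?thesis unfolding Suc SS'
      by (rule coset_average(2)[OF K(1)[OF j] \<mu>(1)[OF j] \<mu>(2)[OF j] Sm]) (use that Suc in auto)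
  qed
  have Sb: "bounded_fun ?A (S i f)" if "i \<le> N" and f: "bounded_fun ?A f" for i f
  proof -
    obtain B where B: "\<And>x. x \<in> ?A \<Longrightarrow> \<bar>f x\<bar> \<le> B" using f by (auto simp: bounded_fun_def)
    have "\<bar>S i f x\<bar> \<le> B" if "x \<in> ?A" for x
      using mean_abs_le[OF Sm[OF \<open>i \<le> N\<close> that], of f B] B by blast
    then show ?thesis by (auto simp: bounded_fun_def)
  qed
  have SbK: "bounded_fun (K j) (\<lambda>h. S i f (x \<otimes> h))"
    if "i \<le> N" "j \<le> N" "bounded_fun ?A f" "x \<in> ?A" for i j f x
    using Sb[OF that(1,3)] KA[OF that(2)] that(4) by (auto simp: bounded_fun_def)
  have KK: "K i \<subseteq> K (Suc i)" if "Suc i \<le> N" for i using K(2) that by simp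
  \<comment> \<open>The pull-out property of conditional expectations, which makes the cross terms
    below vanish.\<close>
  have Spull: "S i (\<lambda>x. f x * u x) x = S i f x * u x"
    if "i \<le> N" "bounded_fun ?A f" "bounded_fun ?A u" "x \<in> ?A"
      "\<And>x k. x \<in> ?A \<Longrightarrow> k \<in> K i \<Longrightarrow> u (x \<otimes> k) = u x" for i f u x
    using that
  proof (induction i arbitrary: x)
    case 0 then show ?case by (simp add: S0)
  next
    case (Suc i)
    have i: "i \<le> N" and fu: "bounded_fun ?A (\<lambda>x. f x * u x)" using Suc.prems by auto
    have "S i (\<lambda>x. f x * u x) (x \<otimes> h) = u x * S i f (x \<otimes> h)" if h: "h \<in> K (Suc i)" for h
    proof -
      have "S i (\<lambda>x. f x * u x) (x \<otimes> h) = S i f (x \<otimes> h) * u (x \<otimes> h)"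
        using Suc.prems KK[OF Suc.prems(1)] KA[OF Suc.prems(1) h] by (intro Suc.IH) auto
      then show ?thesis using Suc.prems(4,5) h by simp
    qed
    then have "S (Suc i) (\<lambda>x. f x * u x) x = \<mu> (Suc i) (\<lambda>h. u x * S i f (x \<otimes> h))"
      unfolding SS by (intro mean_cong[OF \<mu>(1)] SbK fu i Suc.prems) 
    also have "\<dots> = u x * \<mu> (Suc i) (\<lambda>h. S i f (x \<otimes> h))"
      by (rule mean_scale[OF \<mu>(1) SbK]) (use Suc.prems in auto)
    finally show ?case by (simp add: SS)
  qed
  \<comment> \<open>Averaging acts by right multiplication and so commutes with left translations;
    this makes the final mean left-invariant.\<close>
  have Strans: "S i (\<lambda>x. f (g \<otimes> x)) x = S i f (g \<otimes> x)"
    if "i \<le> N" "bounded_fun ?A f" "g \<in> ?A" "x \<in> ?A" for i f g x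
    using that
  proof (induction i arbitrary: x)
    case 0 then show ?case by (simp add: S0)
  next
    case (Suc i)
    have fg: "bounded_fun ?A (\<lambda>x. f (g \<otimes> x))"
      by (rule bounded_fun_comp[OF Suc.prems(2)]) (use Suc.prems in simp)
    show ?case unfolding SS
      by (rule mean_cong[OF \<mu>(1) SbK])
        (use Suc KA[OF Suc.prems(1)] fg in \<open>auto simp: m_assoc\<close>)
  qed
  \<comment> \<open>Right-invariance of \<open>d\<close> keeps the Lipschitz constant under
    averaging over right translates.\<close>
  have Slip: "\<bar>S i f x - S i f y\<bar> \<le> L * d x y"
    if "i \<le> N" "bounded_fun ?A f" "x \<in> ?A" "y \<in> ?A"
      "\<And>x y. x \<in> ?A \<Longrightarrow> y \<in> ?A \<Longrightarrow> \<bar>f x - f y\<bar> \<le> L * d x y" for i f L x y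
    using that(1-4)
  proof (induction i arbitrary: x y)
    case 0 then show ?case using that(5) by (simp add: S0)
  next
    case (Suc i)
    have b: "bounded_fun (K (Suc i)) (\<lambda>h. S i f (z \<otimes> h))" if "z \<in> ?A" for z
      using SbK Suc.prems that by simp
    have "S (Suc i) f x - S (Suc i) f y = \<mu> (Suc i) (\<lambda>h. S i f (x \<otimes> h) - S i f (y \<otimes> h))"
      unfolding SS using mean_diff[OF \<mu>(1) b b] Suc.prems by simp
    also have "\<bar>\<dots>\<bar> \<le> L * d x y"
    proof (rule mean_abs_le[OF \<mu>(1)[OF Suc.prems(1)]])
      fix h assume "h \<in> K (Suc i)"
      then have h: "h \<in> ?A" using KA Suc.prems by blast
      then show "\<bar>S i f (x \<otimes> h) - S i f (y \<otimes> h)\<bar> \<le> L * d x y"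
        using Suc.IH[of "x \<otimes> h" "y \<otimes> h"] Suc.prems by (simp add: right_invariant)
    qed
    finally show ?case .
  qed
  \<comment> \<open>The conditional variance of \<open>f\<close> after \<open>i\<close> averagings:
    one square \<open>(L / N)\<^sup>2\<close> per step, because the increments are
    orthogonal.\<close>
  have Svar: "S i (\<lambda>x. (f x - S i f x)\<^sup>2) x \<le> i * (L / N)\<^sup>2"
    if "i \<le> N" "bounded_fun ?A f" "x \<in> ?A" "0 \<le> L"
      "\<And>x y. x \<in> ?A \<Longrightarrow> y \<in> ?A \<Longrightarrow> \<bar>f x - f y\<bar> \<le> L * d x y" for i f L x
    using that(1-3)
  proof (induction i arbitrary: x)
    case 0 then show ?case by (simp add: S0)
  next
    case (Suc i)
    have i: "i \<le> N" "i < N" using Suc.prems by auto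
    note mi = \<mu>(1)[OF Suc.prems(1)]
    define P where "P = S i f"
    define Q where "Q = S (Suc i) f"
    have bd: "bounded_fun ?A P" "bounded_fun ?A Q" "bounded_fun ?A f"
      using Sb i Suc.prems by (auto simp: P_def Q_def)
    have Pinv: "P (x \<otimes> k) = P x" and Qinv: "Q (x \<otimes> k) = Q x" if "x \<in> ?A" "k \<in> K i" for x k
      using Sinv i bd(3) that KK[OF Suc.prems(1)] Suc.prems(1) by (auto simp: P_def Q_def)
    \<comment> \<open>\<open>Q y\<close> averages \<open>P\<close> over the coset
      \<open>y K (Suc i)\<close>. By left-invariance every point of it is within
      \<open>1 / N\<close> of \<open>y K i\<close>, on which \<open>P\<close> has the value
      \<open>P y\<close>.\<close>
    have PQ: "\<bar>P y - Q y\<bar> \<le> L / N" if y: "y \<in> ?A" for y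
    proof -
      have b: "bounded_fun (K (Suc i)) (\<lambda>h. P (y \<otimes> h))" unfolding P_def using SbK Suc.prems y by simp
      have "P y - Q y = \<mu> (Suc i) (\<lambda>h. P y - P (y \<otimes> h))"
        using mean_diff[OF mi bounded_fun_const b, of "P y"] mean_const[OF mi]
        by (simp add: Q_def SS P_def)
      also have "\<bar>\<dots>\<bar> \<le> L / N"
      proof (rule mean_abs_le[OF mi])
        fix h assume h: "h \<in> K (Suc i)"
        then obtain k where k: "k \<in> K i" "d h k \<le> 1 / N" using step i by blast
        have hk: "h \<in> ?A" "k \<in> ?A" using KA h k Suc.prems i by blast+
        have "\<bar>P (y \<otimes> k) - P (y \<otimes> h)\<bar> \<le> L * d (y \<otimes> k) (y \<otimes> h)"
          unfolding P_def using Slip[OF i(1) bd(3)] y hk \<open>0 \<le> L\<close> \<open>\<And>x y. x \<in> ?A \<Longrightarrow> y \<in> ?A \<Longrightarrow> \<bar>f x - f y\<bar> \<le> L * d x y\<close> by simp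
        also have "\<dots> = L * d h k" using y hk M.commute[of k h] by (simp add: left_invariant)
        also have "\<dots> \<le> L * (1 / N)" by (rule mult_left_mono[OF k(2) \<open>0 \<le> L\<close>])
        finally show "\<bar>P y - P (y \<otimes> h)\<bar> \<le> L / N" using Pinv[OF y k(1)] by simp
      qed
      finally show ?thesis .
    qed
    have "S i (\<lambda>x. (f x - Q x)\<^sup>2) y \<le> Suc i * (L / N)\<^sup>2" if y: "y \<in> ?A" for y
    proof -
      note my = Sm[OF i(1) y]
      have b1: "bounded_fun ?A (\<lambda>x. (f x - P x)\<^sup>2)" and b2: "bounded_fun ?A (\<lambda>x. (P x - Q x)\<^sup>2)"
        and b3: "bounded_fun ?A (\<lambda>x. (f x - P x) * (P x - Q x))"
        unfolding power2_eq_square by (intro bounded_fun_mult bounded_fun_diff bd)+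
      have b4: "bounded_fun ?A (\<lambda>x. 2 * ((f x - P x) * (P x - Q x)))"
        by (intro bounded_fun_mult[OF _ b3]) simp
      have b5: "bounded_fun ?A (\<lambda>x. (f x - P x)\<^sup>2 + (P x - Q x)\<^sup>2)" by (rule bounded_fun_add[OF b1 b2])
      \<comment> \<open>The cross term: \<open>P - Q\<close> is constant on the cosets of
        \<open>K i\<close> and can be pulled out, and \<open>f - P\<close> has conditional
        expectation \<open>0\<close>.\<close>
      have "S i (\<lambda>x. (f x - P x) * (P x - Q x)) y = S i (\<lambda>x. f x - P x) y * (P y - Q y)"
        using Pinv Qinv bd y i(1) by (intro Spull bounded_fun_diff) auto
      also have "S i (\<lambda>x. f x - P x) y = S i f y - S i P y" by (rule mean_diff[OF my bd(3,1)])
      also have "S i P y = S i (\<lambda>x. 1 * P x) y" by simp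
      also have "\<dots> = S i (\<lambda>_. 1) y * P y" using Pinv bd y i(1) by (intro Spull) auto
      also have "\<dots> = P y" using mean_one[OF my] by simp
      finally have cross: "S i (\<lambda>x. (f x - P x) * (P x - Q x)) y = 0" by (simp add: P_def)
      have eq: "(\<lambda>x. (f x - Q x)\<^sup>2) = (\<lambda>x. ((f x - P x)\<^sup>2 + (P x - Q x)\<^sup>2) + 2 * ((f x - P x) * (P x - Q x)))"
        by (rule ext) (simp add: power2_eq_square algebra_simps)
      have "S i (\<lambda>x. (f x - Q x)\<^sup>2) y = S i (\<lambda>x. (f x - P x)\<^sup>2 + (P x - Q x)\<^sup>2) y
          + 2 * S i (\<lambda>x. (f x - P x) * (P x - Q x)) y"
        unfolding eq using mean_add[OF my b5 b4] mean_scale[OF my b3, of 2] by simp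
      also have "\<dots> = S i (\<lambda>x. (f x - P x)\<^sup>2) y + S i (\<lambda>x. (P x - Q x)\<^sup>2) y"
        using mean_add[OF my b1 b2] cross by simp
      also have "S i (\<lambda>x. (f x - P x)\<^sup>2) y \<le> i * (L / N)\<^sup>2"
        unfolding P_def using Suc.IH[OF i(1) bd(3) y] .
      also have "S i (\<lambda>x. (P x - Q x)\<^sup>2) y \<le> S i (\<lambda>_. (L / N)\<^sup>2) y"
      proof (rule mean_mono[OF my b2])
        show "(P x - Q x)\<^sup>2 \<le> (L / N)\<^sup>2" if "x \<in> ?A" for x
          using PQ[OF that] power_mono[OF PQ[OF that], of 2] by simp
      qed simp
      also have "S i (\<lambda>_. (L / N)\<^sup>2) y = (L / N)\<^sup>2" by (rule mean_const[OF my])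
      finally show ?thesis by (simp add: algebra_simps)
    qed
    then have "\<mu> (Suc i) (\<lambda>h. S i (\<lambda>x. (f x - Q x)\<^sup>2) (x \<otimes> h)) \<le> \<mu> (Suc i) (\<lambda>_. Suc i * (L / N)\<^sup>2)"
    proof (intro mean_mono[OF mi SbK])
      show "bounded_fun ?A (\<lambda>x. (f x - Q x)\<^sup>2)"
        unfolding power2_eq_square by (intro bounded_fun_mult bounded_fun_diff bd)
    qed (use Suc.prems KA in auto)
    then show ?case using mean_const[OF mi] by (simp add: SS Q_def)
  qed
  \<comment> \<open>\<open>K N\<close> is the whole group, so \<open>S N f\<close> is constant and
    its value at \<open>\<one>\<close> is the mean.\<close>
  define m where "m f = S N f \<one>" for f
  have mm: "mean ?A m" unfolding m_def using Sm[of N \<one>] by simp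
  have Sconst: "S N f x = m f" if "bounded_fun ?A f" "x \<in> ?A" for f x
    using Sinv[of N f \<one> x] that KN by (simp add: m_def)
  have "inv_mean ?A m"
    unfolding inv_mean_def
  proof (intro conjI ballI allI impI mm)
    fix h f assume hf: "h \<in> ?A" "bounded_fun ?A f"
    have "m (\<lambda>x. f (h \<otimes> x)) = S N f (h \<otimes> \<one>)" unfolding m_def using Strans hf by simp
    then show "m (\<lambda>x. f (h \<otimes> x)) = m f" using Sconst hf by simp
  qed
  moreover have "m (\<lambda>x. (f x - m f)\<^sup>2) \<le> L\<^sup>2 / N"
    if f: "bounded_fun ?A f" and L: "0 \<le> L"
      "\<And>x y. x \<in> ?A \<Longrightarrow> y \<in> ?A \<Longrightarrow> \<bar>f x - f y\<bar> \<le> L * d x y" for f L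
  proof -
    have b: "bounded_fun ?A (\<lambda>x. (f x - m f)\<^sup>2)"
      unfolding power2_eq_square using f by (intro bounded_fun_mult bounded_fun_diff) auto
    have "m (\<lambda>x. (f x - m f)\<^sup>2) = m (\<lambda>x. (f x - S N f x)\<^sup>2)"
      by (rule mean_cong[OF mm b]) (simp add: Sconst f)
    also have "\<dots> \<le> N * (L / N)\<^sup>2" unfolding m_def using Svar[of N f \<one> L] f L by simp
    also have "\<dots> = L\<^sup>2 / N" using N by (simp add: power2_eq_square field_simps)
    finally show ?thesis .
  qed
  ultimately show thesis using that by blast
qed

end

text \<open>The witness is the inf-convolution of \<open>f\<close> with \<open>d / \<delta>\<close>.\<close>

lemma (in Metric_space) lipschitz_approximation:
  assumes M: "M \<noteq> {}" and \<delta>: "0 < \<delta>" and e: "0 \<le> e"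
    and f: "\<And>x. x \<in> M \<Longrightarrow> f x \<in> {0..1 :: real}"
    and uc: "\<And>x y. x \<in> M \<Longrightarrow> y \<in> M \<Longrightarrow> d x y < \<delta> \<Longrightarrow> \<bar>f x - f y\<bar> \<le> e"
  obtains g where "\<And>x. x \<in> M \<Longrightarrow> g x \<in> {0..1}" "\<And>x. x \<in> M \<Longrightarrow> \<bar>g x - f x\<bar> \<le> e"
    "\<And>x y. x \<in> M \<Longrightarrow> y \<in> M \<Longrightarrow> \<bar>g x - g y\<bar> \<le> 1 / \<delta> * d x y"
proof -
  define g where "g x = (INF y\<in>M. f y + d x y / \<delta>)" for x
  have bdd: "bdd_below ((\<lambda>y. f y + d x y / \<delta>) ` M)" for x
    using f \<delta> by (intro bdd_belowI2[of _ 0]) (force intro!: add_nonneg_nonneg)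
  have up: "g x \<le> f y + d x y / \<delta>" if "y \<in> M" for x y
    unfolding g_def using that by (intro cINF_lower bdd)
  have low: "c \<le> g x" if "\<And>y. y \<in> M \<Longrightarrow> c \<le> f y + d x y / \<delta>" for x c
    unfolding g_def using that by (intro cINF_greatest M)
  have gf: "g x \<le> f x" if "x \<in> M" for x using up[OF that, of x] that by simp
  have fg: "f x - e \<le> g x" if x: "x \<in> M" for x
  proof (rule low)
    fix y assume y: "y \<in> M"
    show "f x - e \<le> f y + d x y / \<delta>"
    \<comment> \<open>At distance at least \<open>\<delta>\<close> the penalty
      \<open>d x y / \<delta>\<close> is at least \<open>1\<close>, an upper bound of
      \<open>f\<close>; closer points change \<open>f\<close> by at most \<open>e\<close>.\<close>
    proof (cases "d x y < \<delta>")
      case True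
      have "0 \<le> d x y / \<delta>" using \<delta> by simp
      then show ?thesis using uc[OF x y True] by (auto simp: abs_le_iff)
    next
      case False
      then have "1 \<le> d x y / \<delta>" using \<delta> by simp
      then show ?thesis using f[OF x] f[OF y] e by auto
    qed
  qed
  have lip: "g x \<le> g y + d x y / \<delta>" if x: "x \<in> M" and y: "y \<in> M" for x y
  proof -
    have "g x - d x y / \<delta> \<le> g y"
    proof (rule low)
      fix z assume z: "z \<in> M"
      have "d x z / \<delta> \<le> d x y / \<delta> + d y z / \<delta>"
        using triangle[OF x y z] \<delta> by (simp add: divide_right_mono flip: add_divide_distrib)
      then show "g x - d x y / \<delta> \<le> f z + d y z / \<delta>"
        using up[OF z, of x] by simp
    qed
    then show ?thesis by simp
  qed
  show thesis
  proof (rule that)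
    fix x assume x: "x \<in> M"
    have "0 \<le> g x"
      by (rule low) (use f \<delta> in \<open>force intro!: add_nonneg_nonneg\<close>)
    then show "g x \<in> {0..1}" using gf[OF x] f[OF x] by simp
    show "\<bar>g x - f x\<bar> \<le> e" using gf[OF x] fg[OF x] e by simp
    fix y assume y: "y \<in> M"
    show "\<bar>g x - g y\<bar> \<le> 1 / \<delta> * d x y" using lip[OF x y] lip[OF y x] commute[of x y] by simp
  qed
qed

section \<open>Fixed points of continuous actions on compact spaces\<close>

context biinvariant_metric_group
begin

text \<open>The pairs for which the value of \<open>\<phi>\<close> changes by less than
  \<open>e\<close> form an open set that contains \<open>{\<one>} \<times> topspace X\<close>. As
  \<open>X\<close> is compact, the tube lemma gives a neighbourhood of \<open>\<one>\<close> that
  works for all points at once.\<close>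

lemma action_uniform:
  assumes act: "compact_action G M.mtopology X \<alpha>" and \<phi>: "continuous_map X euclideanreal \<phi>" and e: "0 < e"
  obtains \<delta> where "0 < \<delta>"
    "\<And>g x. g \<in> carrier G \<Longrightarrow> d g \<one> < \<delta> \<Longrightarrow> x \<in> topspace X \<Longrightarrow> \<bar>\<phi> (\<alpha> g x) - \<phi> x\<bar> < e"
proof -
  interpret group_action G "topspace X" \<alpha> using act by (simp add: compact_action_def)
  have cont: "continuous_map (prod_topology M.mtopology X) X (\<lambda>(g, x). \<alpha> g x)"
    using act by (simp add: compact_action_def)
  define W where "W = {p \<in> topspace (prod_topology M.mtopology X).
    \<bar>\<phi> (case p of (g, x) \<Rightarrow> \<alpha> g x) - \<phi> (snd p)\<bar> \<in> {..<e}}"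
  have "continuous_map (prod_topology M.mtopology X) euclideanreal (\<lambda>p. \<phi> (case p of (g, x) \<Rightarrow> \<alpha> g x))"
    using continuous_map_compose[OF cont \<phi>] by (simp add: comp_def)
  moreover have "continuous_map (prod_topology M.mtopology X) euclideanreal (\<lambda>p. \<phi> (snd p))"
    using continuous_map_compose[OF continuous_map_snd \<phi>] by (simp add: comp_def)
  ultimately have "continuous_map (prod_topology M.mtopology X) euclideanreal
      (\<lambda>p. \<bar>\<phi> (case p of (g, x) \<Rightarrow> \<alpha> g x) - \<phi> (snd p)\<bar>)"
    by (intro continuous_map_real_abs continuous_map_diff)
  then have W: "openin (prod_topology M.mtopology X) W"
    unfolding W_def by (rule openin_continuous_map_preimage) simp
  have "\<alpha> \<one> x = x" if "x \<in> topspace X" for x using id_eq_one that by (metis restrict_apply')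
  then have "{\<one>} \<times> topspace X \<subseteq> W" using e by (auto simp: W_def)
  moreover have "compactin X (topspace X)" using act by (simp add: compact_action_def compact_space_def)
  ultimately obtain U V where UV: "openin M.mtopology U" "\<one> \<in> U" "topspace X \<subseteq> V" "U \<times> V \<subseteq> W"
    using tube_lemma_right[OF W, of "topspace X" \<one>] by auto
  then obtain \<delta> where \<delta>: "\<delta> > 0" "M.mball \<one> \<delta> \<subseteq> U" by (auto simp: M.openin_mtopology)
  show thesis
  proof (rule that[OF \<delta>(1)])
    fix g x assume "g \<in> carrier G" "d g \<one> < \<delta>" "x \<in> topspace X"
    then have "g \<in> M.mball \<one> \<delta>" using M.commute[of g \<one>] by simp
    then have "(g, x) \<in> W" using \<delta>(2) UV(3,4) \<open>x \<in> topspace X\<close> by blast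
    then show "\<bar>\<phi> (\<alpha> g x) - \<phi> x\<bar> < e" by (simp add: W_def)
  qed
qed

text \<open>The means live on the \<open>K i\<close> as discrete groups. By left-invariance, the
  distances from \<open>K (Suc i)\<close> to \<open>K i\<close> control the diameter of the coset
  space.\<close>

definition amenable_chains :: bool where
  "amenable_chains \<longleftrightarrow> (\<forall>N\<ge>1. \<exists>K. K 0 = {\<one>} \<and> K N = carrier G \<and>
     (\<forall>i\<le>N. subgroup (K i) G) \<and> (\<forall>i<N. K i \<subseteq> K (Suc i)) \<and>
     (\<forall>i\<le>N. \<exists>m. mean (K i) m \<and>
        (\<forall>h\<in>K i. \<forall>f. bounded_fun (K i) f \<longrightarrow> m (\<lambda>x. f (h \<otimes> x)) = m f)) \<and>
     (\<forall>i<N. \<forall>x\<in>K (Suc i). \<exists>y\<in>K i. d x y \<le> 1 / N))"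

text \<open>By Chebyshev's inequality, most \<open>x\<close> have all \<open>f i (h \<otimes> x)\<close> close to the mean \<open>c i\<close> of \<open>f i\<close>.\<close>

lemma almost_invariant_point:
  assumes chains: "amenable_chains" and F: "finite F" "F \<subseteq> carrier G" and \<Phi>: "finite \<Phi>"
    and f: "\<And>i x. i \<in> \<Phi> \<Longrightarrow> x \<in> carrier G \<Longrightarrow> f i x \<in> {0..1 :: real}"
    and lip: "\<And>i x y. i \<in> \<Phi> \<Longrightarrow> x \<in> carrier G \<Longrightarrow> y \<in> carrier G \<Longrightarrow> \<bar>f i x - f i y\<bar> \<le> L i * d x y"
    and L: "\<And>i. i \<in> \<Phi> \<Longrightarrow> 0 \<le> L i" and e: "0 < e"
  obtains x c where "x \<in> carrier G" "\<And>i h. i \<in> \<Phi> \<Longrightarrow> h \<in> F \<Longrightarrow> \<bar>f i (h \<otimes> x) - c i\<bar> < e"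
proof -
  let ?A = "carrier G"
  \<comment> \<open>\<open>T / N\<close> bounds the mean of the sum \<open>Q\<close> of all squared
    deviations, so \<open>N\<close> is chosen with \<open>T / N < e\<^sup>2\<close>. Some point then
    has \<open>Q x < e\<^sup>2\<close>, which keeps each single deviation below
    \<open>e\<close>.\<close>
  define T where "T = (\<Sum>i\<in>\<Phi>. \<Sum>h\<in>F. (L i)\<^sup>2)"
  obtain n :: nat where n: "T / e\<^sup>2 < n" using reals_Archimedean2 by blast
  define N where "N = max n 1"
  have N: "1 \<le> N" "T < N * e\<^sup>2"
  proof -
    show "1 \<le> N" by (simp add: N_def)
    have "T < n * e\<^sup>2" using n e by (simp add: pos_divide_less_eq)
    also have "\<dots> \<le> N * e\<^sup>2" by (intro mult_right_mono) (auto simp: N_def)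
    finally show "T < N * e\<^sup>2" .
  qed
  obtain m where m: "inv_mean ?A m"
    "\<And>f L. bounded_fun ?A f \<Longrightarrow> 0 \<le> L \<Longrightarrow>
       (\<And>x y. x \<in> ?A \<Longrightarrow> y \<in> ?A \<Longrightarrow> \<bar>f x - f y\<bar> \<le> L * d x y) \<Longrightarrow>
       m (\<lambda>x. (f x - m f)\<^sup>2) \<le> L\<^sup>2 / N"
  proof -
    obtain K where K: "K 0 = {\<one>}" "K N = ?A"
     "\<And>i. i \<le> N \<Longrightarrow> subgroup (K i) G" "\<And>i. i < N \<Longrightarrow> K i \<subseteq> K (Suc i)"
     "\<And>i. i \<le> N \<Longrightarrow> \<exists>m. mean (K i) m \<and>
        (\<forall>h\<in>K i. \<forall>f. bounded_fun (K i) f \<longrightarrow> m (\<lambda>x. f (h \<otimes> x)) = m f)"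
     "\<And>i x. i < N \<Longrightarrow> x \<in> K (Suc i) \<Longrightarrow> \<exists>y\<in>K i. d x y \<le> 1 / N"
    proof -
      obtain K where "K 0 = {\<one>} \<and> K N = carrier G \<and>
        (\<forall>i\<le>N. subgroup (K i) G) \<and> (\<forall>i<N. K i \<subseteq> K (Suc i)) \<and>
        (\<forall>i\<le>N. \<exists>m. mean (K i) m \<and>
          (\<forall>h\<in>K i. \<forall>f. bounded_fun (K i) f \<longrightarrow> m (\<lambda>x. f (h \<otimes> x)) = m f)) \<and>
        (\<forall>i<N. \<forall>x\<in>K (Suc i). \<exists>y\<in>K i. d x y \<le> 1 / N)"
        using chains[unfolded amenable_chains_def, THEN spec, THEN mp, OF N(1)] by (rule exE)
      then show thesis by (intro that[of K]) simp_all
    qed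
    show thesis by (rule concentration[OF N(1) K]) (use that in blast)+
  qed
  have mm: "mean ?A m" using m(1) by (simp add: inv_mean_def)
  define q where "q i h x = (f i (h \<otimes> x) - m (f i))\<^sup>2" for i h x
  have fb: "bounded_fun ?A (f i)" if "i \<in> \<Phi>" for i
    unfolding bounded_fun_def using f[OF that] by (intro exI[of _ 1]) auto
  have fb2: "bounded_fun ?A (\<lambda>x. (f i x - m (f i))\<^sup>2)" if "i \<in> \<Phi>" for i
    unfolding power2_eq_square using fb[OF that] by (intro bounded_fun_mult bounded_fun_diff) auto
  have qb: "bounded_fun ?A (q i h)" if "i \<in> \<Phi>" "h \<in> F" for i h
    unfolding q_def using that F by (intro bounded_fun_comp[OF fb2]) auto
  have qm: "m (q i h) \<le> (L i)\<^sup>2 / N" if ih: "i \<in> \<Phi>" "h \<in> F" for i h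
  proof -
    have "m (q i h) = m (\<lambda>x. (f i x - m (f i))\<^sup>2)"
      using m(1) ih F fb2[OF ih(1)] unfolding inv_mean_def q_def by blast
    also have "\<dots> \<le> (L i)\<^sup>2 / N" by (rule m(2)[OF fb L lip]) (use ih in auto)
    finally show ?thesis .
  qed
  define Q where "Q x = (\<Sum>i\<in>\<Phi>. \<Sum>h\<in>F. q i h x)" for x
  have inner: "bounded_fun ?A (\<lambda>x. \<Sum>h\<in>F. q i h x)" "m (\<lambda>x. \<Sum>h\<in>F. q i h x) = (\<Sum>h\<in>F. m (q i h))"
    if "i \<in> \<Phi>" for i
    using mean_sum[OF mm F(1), of "q i"] qb[OF that] by auto
  have Qb: "bounded_fun ?A Q" and "m Q = (\<Sum>i\<in>\<Phi>. m (\<lambda>x. \<Sum>h\<in>F. q i h x))"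
    using mean_sum[OF mm \<Phi>, of "\<lambda>i x. \<Sum>h\<in>F. q i h x"] inner(1) by (simp_all add: Q_def[abs_def])
  then have "m Q = (\<Sum>i\<in>\<Phi>. \<Sum>h\<in>F. m (q i h))" using inner(2) by simp
  also have "\<dots> \<le> (\<Sum>i\<in>\<Phi>. \<Sum>h\<in>F. (L i)\<^sup>2 / N)" by (intro sum_mono qm)
  also have "\<dots> = T / N" by (simp only: T_def sum_divide_distrib)
  also have "\<dots> < e\<^sup>2" using N by (simp add: field_simps)
  finally have "m Q < e\<^sup>2" .
  have "\<exists>x\<in>?A. Q x < e\<^sup>2"
  proof (rule ccontr)
    assume "\<not> (\<exists>x\<in>?A. Q x < e\<^sup>2)"
    then have "m (\<lambda>_. e\<^sup>2) \<le> m Q" by (intro mean_mono[OF mm _ Qb]) (auto simp: not_less)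
    then show False using \<open>m Q < e\<^sup>2\<close> mean_const[OF mm] by simp
  qed
  then obtain x where x: "x \<in> ?A" "Q x < e\<^sup>2" by blast
  have "\<bar>f i (h \<otimes> x) - m (f i)\<bar> < e" if ih: "i \<in> \<Phi>" "h \<in> F" for i h
  proof -
    have "q i h x \<le> (\<Sum>h\<in>F. q i h x)"
      by (rule member_le_sum[OF ih(2) _ F(1)]) (simp add: q_def)
    also have "\<dots> \<le> Q x" unfolding Q_def
      by (rule member_le_sum[OF ih(1) _ \<Phi>]) (simp add: q_def sum_nonneg)
    finally have "(f i (h \<otimes> x) - m (f i))\<^sup>2 < e\<^sup>2" using x(2) by (simp add: q_def)
    then have "\<bar>f i (h \<otimes> x) - m (f i)\<bar>\<^sup>2 < e\<^sup>2" by simp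
    then show ?thesis by (rule power2_less_imp_less) (use e in simp)
  qed
  then show thesis by (rule that[of x "\<lambda>i. m (f i)", OF x(1)])
qed

text \<open>At a suitable orbit point, finitely many continuous functions change little under
  finitely many group elements. These conditions are closed, so compactness yields a point at which
  no continuous function changes, and continuous functions separate the points of a compact
  Hausdorff space.\<close>

theorem amenable_chains_fixed_point:
  assumes chains: "amenable_chains" and act: "compact_action G M.mtopology X \<alpha>"
  shows "\<exists>x\<in>topspace X. \<forall>g\<in>carrier G. \<alpha> g x = x"
proof -
  let ?A = "carrier G"
  interpret A: group_action G "topspace X" \<alpha> using act by (simp add: compact_action_def)
  have cX: "compact_space X" and hX: "Hausdorff_space X" and neX: "topspace X \<noteq> {}"
    and cont: "continuous_map (prod_topology M.mtopology X) X (\<lambda>(g, x). \<alpha> g x)"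
    using act by (auto simp: compact_action_def)
  have \<alpha>X: "\<alpha> g x \<in> topspace X" if "g \<in> ?A" "x \<in> topspace X" for g x
    using A.element_image that by blast
  have \<alpha>m: "\<alpha> (g \<otimes> h) x = \<alpha> g (\<alpha> h x)" if "g \<in> ?A" "h \<in> ?A" "x \<in> topspace X" for g h x
    using A.composition_rule that by blast
  have cont1: "continuous_map X X (\<alpha> g)" if "g \<in> ?A" for g
  proof -
    have "continuous_map X (prod_topology M.mtopology X) (\<lambda>x. (g, x))"
      using that by (simp add: continuous_map_pairedI)
    from continuous_map_compose[OF this cont] show ?thesis by (simp add: comp_def)
  qed
  obtain x0 where x0: "x0 \<in> topspace X" using neX by blast
  define C where "C = {\<phi>. continuous_map X euclideanreal \<phi> \<and> (\<forall>x\<in>topspace X. \<phi> x \<in> {0..1})}"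
  have fin: "\<exists>x\<in>topspace X. \<forall>\<phi>\<in>\<Phi>. \<forall>h\<in>F. \<bar>\<phi> (\<alpha> h x) - \<phi> x\<bar> \<le> e"
    if F: "finite F" "F \<subseteq> ?A" and \<Phi>: "finite \<Phi>" "\<Phi> \<subseteq> C" and e: "0 < e" for F \<Phi> e
  proof -
    \<comment> \<open>Four errors add up: two from replacing \<open>\<phi>\<close> by its Lipschitz
      approximation and two from the comparison with the constant \<open>c \<phi>\<close>.\<close>
    have e4: "0 < e / 4" using e by simp
    have "\<forall>\<phi>\<in>\<Phi>. \<exists>p. (\<forall>x\<in>?A. fst p x \<in> {0..1}) \<and> (\<forall>x\<in>?A. \<bar>fst p x - \<phi> (\<alpha> x x0)\<bar> \<le> e / 4) \<and>
        0 \<le> snd p \<and> (\<forall>x\<in>?A. \<forall>y\<in>?A. \<bar>fst p x - fst p y\<bar> \<le> snd p * d x y)"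
    proof
      fix \<phi> assume "\<phi> \<in> \<Phi>"
      have \<phi>: "continuous_map X euclideanreal \<phi>" "\<And>x. x \<in> topspace X \<Longrightarrow> \<phi> x \<in> {0..1}"
        using \<open>\<phi> \<in> \<Phi>\<close> \<Phi> by (auto simp: C_def)
      obtain \<delta> where \<delta>: "0 < \<delta>"
        "\<And>g x. g \<in> ?A \<Longrightarrow> d g \<one> < \<delta> \<Longrightarrow> x \<in> topspace X \<Longrightarrow> \<bar>\<phi> (\<alpha> g x) - \<phi> x\<bar> < e / 4"
        using action_uniform[OF act \<phi>(1) e4] by blast
      \<comment> \<open>The left factor \<open>x \<otimes> inv y\<close> takes \<open>y\<close> to
        \<open>x\<close> and has distance \<open>d x y\<close> to \<open>\<one>\<close> by
        right-invariance, so uniform continuity along the orbit follows from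
        \<open>action_uniform\<close>.\<close>
      have uc: "\<bar>\<phi> (\<alpha> x x0) - \<phi> (\<alpha> y x0)\<bar> \<le> e / 4" if xy: "x \<in> ?A" "y \<in> ?A" "d x y < \<delta>" for x y
      proof -
        have "d (x \<otimes> inv y) \<one> = d x y"
          using right_invariant[of "inv y" x y] xy by simp
        moreover have "\<alpha> (x \<otimes> inv y) (\<alpha> y x0) = \<alpha> x x0"
          using xy x0 \<alpha>m[of "x \<otimes> inv y" y x0] by (simp add: m_assoc)
        ultimately show ?thesis using \<delta>(2)[of "x \<otimes> inv y" "\<alpha> y x0"] xy \<alpha>X[OF xy(2) x0] by simp
      qed
      have ne: "?A \<noteq> {}" using one_closed by blast
      obtain g where "\<And>x. x \<in> ?A \<Longrightarrow> g x \<in> {0..1}" "\<And>x. x \<in> ?A \<Longrightarrow> \<bar>g x - \<phi> (\<alpha> x x0)\<bar> \<le> e / 4"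
        "\<And>x y. x \<in> ?A \<Longrightarrow> y \<in> ?A \<Longrightarrow> \<bar>g x - g y\<bar> \<le> 1 / \<delta> * d x y"
        using M.lipschitz_approximation[OF ne \<delta>(1), of "e / 4" "\<lambda>x. \<phi> (\<alpha> x x0)"] uc \<phi>(2) \<alpha>X x0 e4
        by (metis less_imp_le)
      then show "\<exists>p. (\<forall>x\<in>?A. fst p x \<in> {0..1}) \<and> (\<forall>x\<in>?A. \<bar>fst p x - \<phi> (\<alpha> x x0)\<bar> \<le> e / 4) \<and>
          0 \<le> snd p \<and> (\<forall>x\<in>?A. \<forall>y\<in>?A. \<bar>fst p x - fst p y\<bar> \<le> snd p * d x y)"
        using \<delta>(1) by (intro exI[of _ "(g, 1 / \<delta>)"]) auto
    qed
    from bchoice[OF this] obtain p where p: "\<forall>\<phi>\<in>\<Phi>. (\<forall>x\<in>?A. fst (p \<phi>) x \<in> {0..1}) \<and>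
        (\<forall>x\<in>?A. \<bar>fst (p \<phi>) x - \<phi> (\<alpha> x x0)\<bar> \<le> e / 4) \<and> 0 \<le> snd (p \<phi>) \<and>
        (\<forall>x\<in>?A. \<forall>y\<in>?A. \<bar>fst (p \<phi>) x - fst (p \<phi>) y\<bar> \<le> snd (p \<phi>) * d x y)" by (rule exE)
    define g L where "g \<phi> = fst (p \<phi>)" and "L \<phi> = snd (p \<phi>)" for \<phi>
    have g: "\<And>\<phi> x. \<phi> \<in> \<Phi> \<Longrightarrow> x \<in> ?A \<Longrightarrow> g \<phi> x \<in> {0..1}"
      "\<And>\<phi> x. \<phi> \<in> \<Phi> \<Longrightarrow> x \<in> ?A \<Longrightarrow> \<bar>g \<phi> x - \<phi> (\<alpha> x x0)\<bar> \<le> e / 4" "\<And>\<phi>. \<phi> \<in> \<Phi> \<Longrightarrow> 0 \<le> L \<phi>"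
      "\<And>\<phi> x y. \<phi> \<in> \<Phi> \<Longrightarrow> x \<in> ?A \<Longrightarrow> y \<in> ?A \<Longrightarrow> \<bar>g \<phi> x - g \<phi> y\<bar> \<le> L \<phi> * d x y"
      using p by (simp_all add: g_def L_def)
    \<comment> \<open>Including \<open>\<one>\<close> in the finite set makes the value at
      \<open>x\<close> itself close to \<open>c \<phi>\<close>.\<close>
    obtain x c where x: "x \<in> ?A" "\<And>\<phi> h. \<phi> \<in> \<Phi> \<Longrightarrow> h \<in> insert \<one> F \<Longrightarrow> \<bar>g \<phi> (h \<otimes> x) - c \<phi>\<bar> < e / 4"
      by (rule almost_invariant_point[OF chains, of "insert \<one> F" \<Phi> g L "e / 4"]) (use F \<Phi> g e4 in auto)
    show ?thesis
    proof (intro bexI ballI)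
      show xX: "\<alpha> x x0 \<in> topspace X" using \<alpha>X x x0 by blast
      fix \<phi> h assume ph: "\<phi> \<in> \<Phi>" "h \<in> F"
      have h: "h \<in> ?A" using ph F by blast
      have "\<bar>\<phi> (\<alpha> (h \<otimes> x) x0) - \<phi> (\<alpha> x x0)\<bar> \<le> e"
      proof -
        have 1: "\<bar>g \<phi> (h \<otimes> x) - c \<phi>\<bar> < e / 4" "\<bar>g \<phi> x - c \<phi>\<bar> < e / 4"
          using x(2)[of \<phi> h] x(2)[of \<phi> \<one>] ph x(1) by simp_all
        have 2: "\<bar>g \<phi> (h \<otimes> x) - \<phi> (\<alpha> (h \<otimes> x) x0)\<bar> \<le> e / 4" "\<bar>g \<phi> x - \<phi> (\<alpha> x x0)\<bar> \<le> e / 4"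
          using g(2) ph h x(1) by simp_all
        show ?thesis using 1 2 unfolding abs_le_iff abs_less_iff by (intro conjI; linarith)
      qed
      then show "\<bar>\<phi> (\<alpha> h (\<alpha> x x0)) - \<phi> (\<alpha> x x0)\<bar> \<le> e" using \<alpha>m[OF h x(1) x0] by simp
    qed
  qed
  define D where "D = (\<lambda>(h, \<phi>, e). {x \<in> topspace X. \<bar>\<phi> (\<alpha> h x) - \<phi> x\<bar> \<in> {..e :: real}})"
  define I where "I = ?A \<times> C \<times> {0 :: real<..}"
  have clo: "\<forall>S\<in>D ` I. closedin X S"
  proof
    fix S assume "S \<in> D ` I"
    then obtain h \<phi> e where i: "h \<in> ?A" "\<phi> \<in> C" "S = D (h, \<phi>, e)" by (auto simp: I_def)
    have \<phi>: "continuous_map X euclideanreal \<phi>" using i by (simp add: C_def)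
    have "continuous_map X euclideanreal (\<lambda>x. \<bar>\<phi> (\<alpha> h x) - \<phi> x\<bar>)"
      using continuous_map_compose[OF cont1[OF i(1)] \<phi>]
      by (intro continuous_map_real_abs continuous_map_diff \<phi>) (simp add: comp_def)
    then have "closedin X {x \<in> topspace X. \<bar>\<phi> (\<alpha> h x) - \<phi> x\<bar> \<in> {..e}}"
      by (rule closedin_continuous_map_preimage) simp
    then show "closedin X S" using i(3) by (simp add: D_def)
  qed
  have fip: "topspace X \<inter> \<Inter>\<S> \<noteq> {}" if \<S>: "finite \<S>" "\<S> \<subseteq> D ` I" for \<S>
  proof -
    obtain J where J: "finite J" "J \<subseteq> I" "\<S> = D ` J" using finite_subset_image[OF \<S>] by blast
    \<comment> \<open>The smallest of the finitely many tolerances; the entry \<open>1\<close>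
      covers the case of no condition.\<close>
    define e where "e = Min (insert 1 ((snd \<circ> snd) ` J))"
    have e: "0 < e" using J by (auto simp: e_def I_def)
    have ele: "e \<le> e'" if "(h, \<phi>, e') \<in> J" for h \<phi> e'
      unfolding e_def using J(1) that by (intro Min_le) (auto intro: rev_image_eqI)
    have JA: "fst ` J \<subseteq> ?A" "(fst \<circ> snd) ` J \<subseteq> C" using J(2) by (auto simp: I_def)
    obtain x where x: "x \<in> topspace X"
      "\<And>\<phi> h. \<phi> \<in> (fst \<circ> snd) ` J \<Longrightarrow> h \<in> fst ` J \<Longrightarrow> \<bar>\<phi> (\<alpha> h x) - \<phi> x\<bar> \<le> e"
      using fin[OF _ JA(1) _ JA(2) e] J(1) by blast
    have "x \<in> D j" if j: "j \<in> J" for j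
    proof -
      obtain h \<phi> e' where j': "j = (h, \<phi>, e')" by (cases j)
      have "h \<in> fst ` J" "\<phi> \<in> (fst \<circ> snd) ` J" using j j' by force+
      then have "\<bar>\<phi> (\<alpha> h x) - \<phi> x\<bar> \<le> e'" using x(2) ele j j' by force
      then show ?thesis using x(1) j' by (simp add: D_def)
    qed
    then show ?thesis using x(1) J(3) by blast
  qed
  have "compactin X (topspace X)" using cX by (simp add: compact_space_def)
  then have "topspace X \<inter> \<Inter>(D ` I) \<noteq> {}"
    using compactin_fip[of X "topspace X"] clo fip by blast
  then obtain x where x: "x \<in> topspace X" "\<And>i. i \<in> I \<Longrightarrow> x \<in> D i" by blast
  have "\<alpha> h x = x" if h: "h \<in> ?A" for h
  proof (rule ccontr)
    assume ne: "\<alpha> h x \<noteq> x"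
    have "normal_space X" using cX hX compact_Hausdorff_or_regular_imp_normal_space by blast
    moreover have "closedin X {x}" "closedin X {\<alpha> h x}"
      using hX x(1) \<alpha>X[OF h x(1)] by (simp_all add: closedin_Hausdorff_singleton)
    moreover have "disjnt {x} {\<alpha> h x}" using ne by simp
    ultimately obtain \<phi> where \<phi>: "continuous_map X (top_of_set {0..1 :: real}) \<phi>" "\<phi> ` {x} \<subseteq> {0}" "\<phi> ` {\<alpha> h x} \<subseteq> {1}"
      using Urysohn_lemma[of X "{x}" "{\<alpha> h x}" 0 1] by auto
    then have "\<phi> \<in> C" by (auto simp: C_def continuous_map_in_subtopology)
    then have "x \<in> D (h, \<phi>, 1 / 2)" using x(2) h by (simp add: I_def)
    then show False using \<phi> by (simp add: D_def)
  qed
  then show ?thesis using x(1) by blast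
qed

end

section \<open>Amenable length\<close>

text \<open>A fixed point carries an invariant Dirac measure.\<close>

lemma extremely_amenable_imp_amenable:
  assumes "extremely_amenable TYPE('x) G \<tau>" shows "amenable TYPE('x) G \<tau>"
  unfolding amenable_def
proof (intro conjI allI impI)
  show tg: "topological_group G \<tau>" using assms by (simp add: extremely_amenable_def)
  fix X :: "'x topology" and \<alpha>
  assume act: "compact_action G \<tau> X \<alpha>"
  then obtain x where x: "x \<in> topspace X" "\<And>g. g \<in> carrier G \<Longrightarrow> \<alpha> g x = x"
    using assms unfolding extremely_amenable_def by blast
  have hX: "Hausdorff_space X"
    and cont: "continuous_map (prod_topology \<tau> X) X (\<lambda>(g, x). \<alpha> g x)"
    using act by (auto simp: compact_action_def)
  define \<mu> where "\<mu> = return (borel_of X) x"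
  have sets: "sets \<mu> = sets (borel_of X)" by (simp add: \<mu>_def)
  have em: "emeasure \<mu> A = indicator A x" if "A \<in> sets (borel_of X)" for A
    unfolding \<mu>_def by (rule emeasure_return[OF that])
  have cx: "closedin X {x}" "compactin X {x}"
    using x(1) hX by (simp_all add: closedin_Hausdorff_singleton compactin_sing)
  have "regular_borel_prob X \<mu>"
    unfolding regular_borel_prob_def
  proof (intro conjI ballI)
    show "prob_space \<mu>" unfolding \<mu>_def using x(1) by (intro prob_space_return) simp
    show "sets \<mu> = sets (borel_of X)" by (rule sets)
    fix A assume "A \<in> sets \<mu>"
    then have A: "A \<in> sets (borel_of X)" by (simp add: sets)
    then have AX: "A \<subseteq> topspace X" using sets.sets_into_space by fastforce
    show "emeasure \<mu> A = (INF U\<in>{U. openin X U \<and> A \<subseteq> U}. emeasure \<mu> U)"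
    proof (rule antisym)
      show "emeasure \<mu> A \<le> (INF U\<in>{U. openin X U \<and> A \<subseteq> U}. emeasure \<mu> U)"
        by (intro INF_greatest emeasure_mono) (auto simp: sets openin_borel_of)
      show "(INF U\<in>{U. openin X U \<and> A \<subseteq> U}. emeasure \<mu> U) \<le> emeasure \<mu> A"
      proof (cases "x \<in> A")
        case True
        then show ?thesis using AX A
          by (intro INF_lower2[of "topspace X"]) (auto simp: em openin_borel_of indicator_def)
      next
        case False
        have "openin X (topspace X - {x})" using cx(1) by blast
        then show ?thesis using AX A False
          by (intro INF_lower2[of "topspace X - {x}"]) (auto simp: em openin_borel_of)
      qed
    qed
    show "emeasure \<mu> A = (SUP K\<in>{K. compactin X K \<and> K \<subseteq> A}. emeasure \<mu> K)"
    proof (rule antisym)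
      show "(SUP K\<in>{K. compactin X K \<and> K \<subseteq> A}. emeasure \<mu> K) \<le> emeasure \<mu> A"
        by (intro SUP_least emeasure_mono) (auto simp: sets A)
      show "emeasure \<mu> A \<le> (SUP K\<in>{K. compactin X K \<and> K \<subseteq> A}. emeasure \<mu> K)"
      proof (cases "x \<in> A")
        case True
        then show ?thesis using A cx(2) hX
          by (intro SUP_upper2[of "{x}"]) (auto simp: em compactin_borel_of)
      qed (simp add: em A)
    qed
  qed
  moreover have "distr \<mu> \<mu> (\<alpha> g) = \<mu>" if g: "g \<in> carrier G" for g
  proof -
    have "continuous_map X (prod_topology \<tau> X) (\<lambda>x. (g, x))"
      using g tg by (simp add: continuous_map_pairedI topological_group_def)
    from continuous_map_compose[OF this cont] have "continuous_map X X (\<alpha> g)" by (simp add: comp_def)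
    then have "\<alpha> g \<in> measurable (borel_of X) (borel_of X)" by (rule continuous_map_borel_of)
    then have "distr \<mu> (borel_of X) (\<alpha> g) = \<mu>"
      unfolding \<mu>_def using distr_return[of "\<alpha> g" "borel_of X" "borel_of X" x] x(1) x(2)[OF g] by simp
    moreover have "distr \<mu> \<mu> (\<alpha> g) = distr \<mu> (borel_of X) (\<alpha> g)"
      by (rule distr_cong) (simp_all add: sets)
    ultimately show ?thesis by simp
  qed
  ultimately show "\<exists>\<mu>. regular_borel_prob X \<mu> \<and> (\<forall>g\<in>carrier G. distr \<mu> \<mu> (\<alpha> g) = \<mu>)" by blast
qed

text \<open>Left-invariance turns \<open>d (g \<otimes> x) (g \<otimes> y \<otimes> h)\<close> into
  \<open>d (inv y \<otimes> x) h\<close>, so each coset distance is the distance of an element of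
  \<open>K (Suc i)\<close> to \<open>K i\<close>. Both bounds \<open>0\<close> and \<open>c\<close>
  are carried along, because real suprema need bounded sets and squaring needs nonnegative
  bases.\<close>

lemma (in biinvariant_metric_group) chain_length_le:
  assumes sub: "\<And>i. i \<le> n \<Longrightarrow> subgroup (K i) G"
    and step: "\<And>i x. i < n \<Longrightarrow> x \<in> K (Suc i) \<Longrightarrow> \<exists>y\<in>K i. d x y \<le> c"
  shows "chain_length G d n K \<le> sqrt (n * c\<^sup>2)"
proof -
  have "(SUP g\<in>carrier G. quotient_diam G d (K (Suc i)) (K i) g)\<^sup>2 \<le> c\<^sup>2" if i: "i < n" for i
  proof -
    interpret H: subgroup "K i" G using sub i by simp
    interpret H': subgroup "K (Suc i)" G using sub i by simp
    have bounds: "0 \<le> coset_dist G d (K i) g x y \<and> coset_dist G d (K i) g x y \<le> c"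
      if g: "g \<in> carrier G" and xy: "x \<in> K (Suc i)" "y \<in> K (Suc i)" for g x y
    proof
      show "0 \<le> coset_dist G d (K i) g x y"
        unfolding coset_dist_def
      proof (rule cINF_greatest)
        show "K i \<noteq> {}" using H.one_closed by blast
      qed simp
      have c: "x \<in> carrier G" "y \<in> carrier G" using xy by auto
      obtain h where h: "h \<in> K i" "d (inv y \<otimes> x) h \<le> c" using step[OF i, of "inv y \<otimes> x"] xy by auto
      have hc: "h \<in> carrier G" using h by simp
      have "d (g \<otimes> x) (g \<otimes> y \<otimes> h) = d x (y \<otimes> h)"
        using left_invariant[OF g c(1), of "y \<otimes> h"] c g hc by (simp add: m_assoc)
      also have "\<dots> = d (inv y \<otimes> x) (inv y \<otimes> (y \<otimes> h))"
        using left_invariant[of "inv y" x "y \<otimes> h"] c hc by simp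
      also have "inv y \<otimes> (y \<otimes> h) = h" using c hc by (simp add: m_assoc[symmetric])
      finally have "d (g \<otimes> x) (g \<otimes> y \<otimes> h) \<le> c" using h by simp
      then show "coset_dist G d (K i) g x y \<le> c"
        unfolding coset_dist_def using h(1) by (intro cINF_lower2[where x = h] bdd_belowI2[where m = 0]) auto
    qed
    have ne: "K (Suc i) \<times> K (Suc i) \<noteq> {}" using H'.one_closed by blast
    have qd: "0 \<le> quotient_diam G d (K (Suc i)) (K i) g \<and> quotient_diam G d (K (Suc i)) (K i) g \<le> c"
      if g: "g \<in> carrier G" for g
      unfolding quotient_diam_def
    proof
      show "(SUP (x, y)\<in>K (Suc i) \<times> K (Suc i). coset_dist G d (K i) g x y) \<le> c"
        using bounds[OF g] by (intro cSUP_least ne) auto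
      show "0 \<le> (SUP (x, y)\<in>K (Suc i) \<times> K (Suc i). coset_dist G d (K i) g x y)"
        using bounds[OF g] H'.one_closed
        by (intro cSUP_upper2[where x = "(\<one>, \<one>)"] bdd_aboveI2[where M = c]) auto
    qed
    have "0 \<le> (SUP g\<in>carrier G. quotient_diam G d (K (Suc i)) (K i) g)"
      using qd by (intro cSUP_upper2[where x = \<one>] bdd_aboveI2[where M = c]) auto
    moreover have "(SUP g\<in>carrier G. quotient_diam G d (K (Suc i)) (K i) g) \<le> c"
      using qd one_closed by (intro cSUP_least) auto
    ultimately show ?thesis by (intro power_mono) auto
  qed
  then have "(\<Sum>i<n. (SUP g\<in>carrier G. quotient_diam G d (K (Suc i)) (K i) g)\<^sup>2) \<le> (\<Sum>i<n. c\<^sup>2)"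
    by (intro sum_mono) auto
  then show ?thesis unfolding chain_length_def by simp
qed

lemma (in ring) unipotent_subgroup:
  assumes L: "nonunital_subring R L" "loc_nil L" and L': "nonunital_subring R L'" "L' \<subseteq> L"
  shows "subgroup (carrier (unipotent L')) (unipotent L)"
proof -
  interpret G: group "unipotent L" by (rule unipotent_group[OF L])
  interpret H: group "unipotent L'" by (rule unipotent_group[OF L'(1) loc_nil_subset[OF L(2) L'(2)]])
  show ?thesis
  proof (rule G.subgroupI)
    show sub: "carrier (unipotent L') \<subseteq> carrier (unipotent L)" using L'(2) by auto
    show "carrier (unipotent L') \<noteq> {}" using H.one_closed by blast
    fix x assume x: "x \<in> carrier (unipotent L')"
    have "inv\<^bsub>unipotent L\<^esub> x = inv\<^bsub>unipotent L'\<^esub> x"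
      using H.l_inv[OF x] H.inv_closed[OF x] x sub by (intro G.inv_equality) auto
    then show "inv\<^bsub>unipotent L\<^esub> x \<in> carrier (unipotent L')" using H.inv_closed[OF x] by simp
    fix y assume y: "y \<in> carrier (unipotent L')"
    show "x \<otimes>\<^bsub>unipotent L\<^esub> y \<in> carrier (unipotent L')" using H.m_closed[OF x y] by simp
  qed
qed

section \<open>The filtration of the Levitzki radical of a nest ring\<close>

locale nest_in_continuous_ring = ranked_continuous +
  fixes E :: "'a set"
  assumes nest: "maximal_nest R E" and non_discrete: "non_discrete_ring R \<rho>"
begin

abbreviation T :: "('a, 'b) ring_scheme" where "T \<equiv> nest_ring R E"

lemma T_simps [simp]:
  "monoid.mult T = monoid.mult R" "monoid.one T = \<one>" "ring.zero T = \<zero>" "ring.add T = ring.add R"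
  by (simp_all add: nest_ring_def)

lemma T_carrier: "a \<in> carrier T \<longleftrightarrow> a \<in> carrier R \<and> (\<forall>e\<in>E. e \<otimes> a \<otimes> e = a \<otimes> e)"
  by (simp add: nest_ring_def)

text \<open>\<open>e \<otimes> a \<otimes> e = a \<otimes> e\<close> says that left multiplication
  by \<open>a\<close> maps \<open>e R\<close> into itself, a condition stable under sums and
  products.\<close>

lemma ring_T: "ring T"
proof -
  have Ec: "e \<in> carrier R" if "e \<in> E" for e using nest_carrier[OF nest that] .
  have Ee: "e \<otimes> e = e" if "e \<in> E" for e using nest_idem[OF nest that] idempotentsD by blast
  have "subring (carrier T) R"
  proof (rule subringI)
    fix a b assume ab: "a \<in> carrier T" "b \<in> carrier T"
    show "\<ominus> a \<in> carrier T" "a \<oplus> b \<in> carrier T"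
      using ab Ec by (auto simp: T_carrier l_distr r_distr l_minus r_minus)
    have "e \<otimes> (a \<otimes> b) \<otimes> e = a \<otimes> b \<otimes> e" if e: "e \<in> E" for e
    proof -
      have c: "a \<in> carrier R" "b \<in> carrier R" "e \<in> carrier R" using ab e Ec by (auto simp: T_carrier)
      have ae: "e \<otimes> a \<otimes> e = a \<otimes> e" and be: "e \<otimes> b \<otimes> e = b \<otimes> e"
        using ab e by (auto simp: T_carrier)
      have "e \<otimes> (a \<otimes> b) \<otimes> e = e \<otimes> a \<otimes> (b \<otimes> e)" using c by (simp add: m_assoc)
      also have "\<dots> = e \<otimes> a \<otimes> (e \<otimes> b \<otimes> e)" by (simp only: be)
      also have "\<dots> = e \<otimes> a \<otimes> e \<otimes> (b \<otimes> e)" using c by (simp add: m_assoc)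
      also have "\<dots> = a \<otimes> e \<otimes> (b \<otimes> e)" by (simp only: ae)
      also have "\<dots> = a \<otimes> (e \<otimes> b \<otimes> e)" using c by (simp add: m_assoc)
      also have "\<dots> = a \<otimes> b \<otimes> e" unfolding be using c by (simp add: m_assoc)
      finally show ?thesis .
    qed
    then show "a \<otimes> b \<in> carrier T" using ab by (simp add: T_carrier)
  qed (use Ec Ee in \<open>auto simp: T_carrier\<close>)
  then have "ring (R\<lparr>carrier := carrier T\<rparr>)" by (rule subring_is_ring)
  then show ?thesis by (simp add: nest_ring_def)
qed

sublocale T: ring T by (rule ring_T)

text \<open>Members of a nest are comparable and therefore commute. The result keeps
  \<open>a \<otimes> e\<close> in the Levitzki radical, an ideal of the nest ring.\<close>

lemma nest_in_T: assumes e: "e \<in> E" shows "e \<in> carrier T"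
  unfolding T_carrier
proof (intro conjI ballI)
  show "e \<in> carrier R" using nest_carrier[OF nest e] .
  fix f assume f: "f \<in> E"
  have "f \<otimes> f = f" using nest_idem[OF nest f] idempotentsD by blast
  then show "f \<otimes> e \<otimes> f = e \<otimes> f"
    using nest_linear[OF nest e f] by (auto simp: idem_le_def)
qed

text \<open>For \<open>e\<close> in the nest,
  \<open>e \<otimes> a \<otimes> e = a \<otimes> e\<close> holds in the nest ring, so
  \<open>a \<otimes> e = a\<close> implies \<open>e \<otimes> a = a\<close>: this is the two-sided
  corner of the radical at \<open>e\<close>.\<close>

definition corner :: "'a \<Rightarrow> 'a set" where
  "corner e = {a \<in> levitzki_radical T. a \<otimes> e = a}"

lemma levitzki_carrier_R: "a \<in> levitzki_radical T \<Longrightarrow> a \<in> carrier R"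
  using T.levitzki_carrier by (auto simp: T_carrier)

lemma corner_carrier: "a \<in> corner e \<Longrightarrow> a \<in> carrier R"
  using levitzki_carrier_R by (simp add: corner_def)

lemma corner_subring: assumes e: "e \<in> E" shows "nonunital_subring T (corner e)"
proof -
  interpret Lev: ideal "levitzki_radical T" T by (rule T.levitzki_ideal)
  have ec: "e \<in> carrier R" using nest_carrier[OF nest e] .
  have ecT: "e \<in> carrier T" by (rule nest_in_T[OF e])
  have "additive_subgroup (corner e) T"
  proof (intro additive_subgroup.intro T.add.subgroupI)
    show "corner e \<subseteq> carrier T" using T.levitzki_carrier by (auto simp: corner_def)
    have "\<zero> \<in> corner e" using Lev.zero_closed ec by (simp add: corner_def)
    then show "corner e \<noteq> {}" by blast
    fix a b assume a: "a \<in> corner e"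
    have aT: "a \<in> carrier T" using a T.levitzki_carrier by (auto simp: corner_def)
    have "\<ominus>\<^bsub>T\<^esub> a \<in> levitzki_radical T" using a by (simp add: corner_def)
    moreover have "\<ominus>\<^bsub>T\<^esub> a \<otimes> e = \<ominus>\<^bsub>T\<^esub> a"
      using T.l_minus[OF aT ecT] a by (simp add: corner_def)
    ultimately show "\<ominus>\<^bsub>T\<^esub> a \<in> corner e" by (simp add: corner_def)
    assume b: "b \<in> corner e"
    show "a \<oplus>\<^bsub>T\<^esub> b \<in> corner e"
      using a b Lev.a_closed[of a b] corner_carrier[of a e] corner_carrier[of b e] ec
      by (simp add: corner_def l_distr)
  qed
  moreover have "x \<otimes> y \<in> corner e" if "x \<in> corner e" "y \<in> corner e" for x y
    using that Lev.I_l_closed[of y x] T.levitzki_carrier corner_carrier[of x e] corner_carrier[of y e] ec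
    by (auto simp: corner_def m_assoc subset_iff)
  ultimately show ?thesis by (simp add: nonunital_subring_def)
qed

lemma corner_loc_nil: "T.loc_nil (corner e)"
  by (rule T.loc_nil_subset[OF T.levitzki_loc_nil]) (auto simp: corner_def)

lemma corner_mono:
  assumes "e \<in> E" "f \<in> E" "\<rho> e \<le> \<rho> f" shows "corner e \<subseteq> corner f"
proof
  fix a assume a: "a \<in> corner e"
  have c: "e \<in> carrier R" "f \<in> carrier R" "a \<in> carrier R"
    using nest_carrier[OF nest] assms corner_carrier[OF a] by auto
  have "e \<otimes> f = e" using nest_rho_le[OF nest assms(1,2)] assms(3) by (simp add: idem_le_def)
  then have "a \<otimes> e \<otimes> f = a \<otimes> e" using c by (simp add: m_assoc)
  then show "a \<in> corner f" using a by (simp add: corner_def)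
qed

abbreviation U :: "'a \<Rightarrow> 'a monoid" where "U e \<equiv> T.unipotent (corner e)"

text \<open>Since \<open>a \<otimes> f = a\<close>, the difference of
  \<open>\<one> \<oplus> a\<close> and \<open>\<one> \<oplus> a \<otimes> e\<close> is
  \<open>a \<otimes> (f \<ominus> e)\<close>, and the rank of \<open>f \<ominus> e\<close> is
  \<open>\<rho> f - \<rho> e\<close>.\<close>

lemma corner_step:
  assumes e: "e \<in> E" "f \<in> E" "\<rho> e \<le> \<rho> f" and x: "x \<in> carrier (U f)"
  shows "\<exists>y\<in>carrier (U e). rank_metric R \<rho> x y \<le> \<rho> f - \<rho> e"
proof -
  interpret Lev: ideal "levitzki_radical T" T by (rule T.levitzki_ideal)
  obtain a where a: "a \<in> corner f" "x = \<one> \<oplus> a" using x by auto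
  have c: "e \<in> carrier R" "f \<in> carrier R" "a \<in> carrier R"
    using nest_carrier[OF nest] e corner_carrier[OF a(1)] by auto
  have ei: "e \<in> idempotents R" "f \<in> idempotents R" using nest_idem[OF nest] e by auto
  have le: "idem_le R e f" using nest_rho_le[OF nest e(1,2)] e(3) by simp
  have "a \<otimes> e \<in> levitzki_radical T"
    using Lev.I_r_closed[of a e] a(1) nest_in_T[OF e(1)] by (simp add: corner_def)
  moreover have "a \<otimes> e \<otimes> e = a \<otimes> e" using c idempotentsD(2)[OF ei(1)] by (simp add: m_assoc)
  ultimately have ae: "a \<otimes> e \<in> corner e" by (simp add: corner_def)
  have "a \<otimes> f = a" using a(1) by (simp add: corner_def)
  have "(\<one> \<oplus> a) \<ominus> (\<one> \<oplus> a \<otimes> e) = a \<ominus> a \<otimes> e"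
    using c a_comm[of \<one> a] by (simp add: minus_eq minus_add a_assoc) (simp add: a_assoc[symmetric] r_neg)
  also have "\<dots> = a \<otimes> (f \<ominus> e)" using c \<open>a \<otimes> f = a\<close> by (simp add: minus_eq r_distr r_minus)
  finally have "rank_metric R \<rho> x (\<one> \<oplus> a \<otimes> e) = \<rho> (a \<otimes> (f \<ominus> e))"
    using c a(2) by (simp add: rank_metric_def)
  also have "\<dots> \<le> \<rho> (f \<ominus> e)" using c by (intro rho_mult) auto
  also have "\<dots> = \<rho> f - \<rho> e" by (rule idem_diff(2)[OF ei le])
  finally show ?thesis using ae by auto
qed

text \<open>Multiplication by an invertible element cannot lower the rank, because the inverse
  multiplies back.\<close>

lemma unipotent_biinvariant:
  assumes e: "e \<in> E"
  shows "biinvariant_metric_group (U e) (rank_metric R \<rho>)"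
proof -
  interpret G: group "U e" by (rule T.unipotent_group[OF corner_subring[OF e] corner_loc_nil])
  have sub: "carrier (U e) \<subseteq> carrier R" using corner_carrier by auto
  have mul: "\<rho> (g \<otimes> z) = \<rho> z \<and> \<rho> (z \<otimes> g) = \<rho> z"
    if g: "g \<in> carrier (U e)" and z: "z \<in> carrier R" for g z
  proof -
    define h where "h = inv\<^bsub>U e\<^esub> g"
    have gh: "g \<otimes> h = \<one>" "h \<otimes> g = \<one>" using G.r_inv[OF g] G.l_inv[OF g] by (simp_all add: h_def)
    have c: "g \<in> carrier R" "h \<in> carrier R" using sub g G.inv_closed[OF g] unfolding h_def by blast+
    have "\<rho> z \<le> \<rho> (g \<otimes> z)"
      using rho_mult(2)[of h "g \<otimes> z"] c z gh by (simp add: m_assoc[symmetric])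
    moreover have "\<rho> z \<le> \<rho> (z \<otimes> g)"
      using rho_mult(1)[of "z \<otimes> g" h] c z gh by (simp add: m_assoc)
    ultimately show ?thesis using rho_mult[of g z] rho_mult[of z g] c z by auto
  qed
  interpret M: Metric_space "carrier (U e)" "rank_metric R \<rho>"
    by (rule rank_metric_space[OF sub])
  show ?thesis
  proof unfold_locales
    fix g x y assume gxy: "g \<in> carrier (U e)" "x \<in> carrier (U e)"
      "y \<in> carrier (U e)"
    then have c: "g \<in> carrier R" "x \<in> carrier R" "y \<in> carrier R" using sub by blast+
    have "g \<otimes> x \<ominus> g \<otimes> y = g \<otimes> (x \<ominus> y)" "x \<otimes> g \<ominus> y \<otimes> g = (x \<ominus> y) \<otimes> g"
      using c by (simp_all add: minus_eq r_distr l_distr r_minus l_minus)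
    then show "rank_metric R \<rho> (g \<otimes>\<^bsub>U e\<^esub> x) (g \<otimes>\<^bsub>U e\<^esub> y) = rank_metric R \<rho> x y"
      "rank_metric R \<rho> (x \<otimes>\<^bsub>U e\<^esub> g) (y \<otimes>\<^bsub>U e\<^esub> g) = rank_metric R \<rho> x y"
      using mul[OF gxy(1), of "x \<ominus> y"] c by (simp_all add: rank_metric_def)
  qed
qed

lemma corner_subgroup:
  assumes "e \<in> E" "f \<in> E" "\<rho> e \<le> \<rho> f"
  shows "subgroup (carrier (U e)) (U f)"
  by (rule T.unipotent_subgroup[OF corner_subring[OF assms(2)] corner_loc_nil corner_subring[OF assms(1)]
        corner_mono[OF assms]])

text \<open>The nest has members \<open>f j\<close> of rank \<open>j * \<rho> e / N\<close>. The
  rank determines them, so \<open>f 0 = \<zero>\<close>, with trivial group, and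
  \<open>f N = e\<close>; consecutive ranks differ by
  \<open>\<rho> e / N \<le> 1 / N\<close>.\<close>

lemma corner_chain:
  assumes e: "e \<in> E" and N: "N \<ge> (1 :: nat)"
  obtains f :: "nat \<Rightarrow> 'a" where "\<And>i. i \<le> N \<Longrightarrow> f i \<in> E"
    "carrier (U (f 0)) = {\<one>}" "f N = e"
    "\<And>i. i \<le> N \<Longrightarrow> subgroup (carrier (U (f i))) (U e)"
    "\<And>i. i < N \<Longrightarrow> carrier (U (f i)) \<subseteq> carrier (U (f (Suc i)))"
    "\<And>i x. i < N \<Longrightarrow> x \<in> carrier (U (f (Suc i))) \<Longrightarrow>
       \<exists>y\<in>carrier (U (f i)). rank_metric R \<rho> x y \<le> 1 / N"
proof -
  have e01: "0 \<le> \<rho> e" "\<rho> e \<le> 1" using nest_carrier[OF nest e] rho_nonneg rho_le_1 by auto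
  have "\<exists>c\<in>E. \<rho> c = j * \<rho> e / N" if j: "j \<le> N" for j :: nat
  proof -
    have "real j * \<rho> e \<le> real N * 1" using j e01 by (intro mult_mono) auto
    then have "0 \<le> j * \<rho> e / N" "j * \<rho> e / N \<le> 1" using e01 N by (simp_all add: field_simps)
    then show ?thesis using nest_rho_surj[OF nest non_discrete] by metis
  qed
  then obtain f where f: "\<And>j. j \<le> N \<Longrightarrow> f j \<in> E \<and> \<rho> (f j) = j * \<rho> e / N" by metis
  have "f 0 = \<zero>" using f[of 0] rho_eq_0_iff nest_carrier[OF nest] by auto
  moreover have "\<zero> \<in> levitzki_radical T"
    using additive_subgroup.zero_closed[OF ideal.axioms(1)[OF T.levitzki_ideal]] by simp
  ultimately have "corner (f 0) = {\<zero>}"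
    using levitzki_carrier_R by (auto simp: corner_def)
  then have "carrier (U (f 0)) = {\<one>}" by simp
  moreover have fN: "f N = e"
  proof (rule idem_le_rho_eq)
    show "f N \<in> idempotents R" "e \<in> idempotents R" using nest_idem[OF nest] f e by auto
    have "\<rho> (f N) = \<rho> e" using f[of N] N by simp
    then show "idem_le R (f N) e" "\<rho> e \<le> \<rho> (f N)"
      using nest_rho_le[OF nest, of "f N" e] f e by auto
  qed
  moreover have le: "\<rho> (f i) \<le> \<rho> (f j)" if "i \<le> j" "j \<le> N" for i j
    using f[of i] f[of j] that e01 by (simp add: divide_right_mono mult_right_mono)
  have "subgroup (carrier (U (f i))) (U e)" if i: "i \<le> N" for i
    using corner_subgroup[of "f i" e] f[OF i] e le[OF i order_refl] fN by simp
  moreover have "carrier (U (f i)) \<subseteq> carrier (U (f (Suc i)))" if "i < N" for i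
    using corner_mono[OF _ _ le, of i "Suc i"] f[of i] f[of "Suc i"] that by auto
  moreover have "\<exists>y\<in>carrier (U (f i)). rank_metric R \<rho> x y \<le> 1 / N"
    if i: "i < N" and x: "x \<in> carrier (U (f (Suc i)))" for i x
  proof -
    have "\<rho> (f (Suc i)) - \<rho> (f i) \<le> 1 / N"
      using f[of i] f[of "Suc i"] i e01 N
      by (simp add: diff_divide_distrib[symmetric] divide_right_mono distrib_right)
    moreover have l: "\<rho> (f i) \<le> \<rho> (f (Suc i))" using le[of i "Suc i"] i by linarith
    have fE: "f i \<in> E" "f (Suc i) \<in> E" using f i by simp_all
    obtain y where "y \<in> carrier (U (f i))" "rank_metric R \<rho> x y \<le> \<rho> (f (Suc i)) - \<rho> (f i)"
      using corner_step[OF fE l x] by blast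
    ultimately show ?thesis by (meson order_trans)
  qed
  ultimately show thesis using f by (intro that[of f]) blast+
qed

text \<open>The groups in a chain for \<open>U e\<close> are again of the form
  \<open>U (f i)\<close>, so \<open>unipotent_inv_mean\<close> supplies all the means. The type
  \<open>'x\<close> of points stays free: the amenable chains take it to be
  \<open>'a set set\<close>, while the theorem leaves it arbitrary.\<close>

lemma corner_extremely_amenable:
  assumes e: "e \<in> E"
  shows "extremely_amenable TYPE('x) (U e) (rank_topology_on R \<rho> (carrier (U e)))"
proof -
  interpret B: biinvariant_metric_group "U e" "rank_metric R \<rho>"
    by (rule unipotent_biinvariant[OF e])
  have "B.amenable_chains"
    unfolding B.amenable_chains_def
  proof (intro allI impI)
    fix N :: nat assume N: "1 \<le> N"
    obtain f :: "nat \<Rightarrow> 'a" where f: "\<And>i. i \<le> N \<Longrightarrow> f i \<in> E"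
      "carrier (U (f 0)) = {\<one>}" "f N = e"
      "\<And>i. i \<le> N \<Longrightarrow> subgroup (carrier (U (f i))) (U e)"
      "\<And>i. i < N \<Longrightarrow> carrier (U (f i)) \<subseteq> carrier (U (f (Suc i)))"
      "\<And>i x. i < N \<Longrightarrow> x \<in> carrier (U (f (Suc i))) \<Longrightarrow>
         \<exists>y\<in>carrier (U (f i)). rank_metric R \<rho> x y \<le> 1 / N"
      by (rule corner_chain[OF e N], rule that)
    have "\<exists>m. mean (carrier (U (f i))) m \<and> (\<forall>h\<in>carrier (U (f i)). \<forall>u. bounded_fun (carrier (U (f i))) u \<longrightarrow>
        m (\<lambda>x. u (h \<otimes>\<^bsub>U e\<^esub> x)) = m u)" if i: "i \<le> N" for i
    proof -
      interpret H: group "U (f i)"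
        by (rule T.unipotent_group[OF corner_subring[OF f(1)[OF i]] corner_loc_nil])
      show ?thesis
        using T.unipotent_inv_mean[OF corner_subring[OF f(1)[OF i]] corner_loc_nil]
        unfolding H.inv_mean_def T.unipotent_simps(2) by blast
    qed
    then show "\<exists>K. K 0 = {\<one>\<^bsub>U e\<^esub>} \<and> K N = carrier (U e) \<and>
       (\<forall>i\<le>N. subgroup (K i) (U e)) \<and> (\<forall>i<N. K i \<subseteq> K (Suc i)) \<and>
       (\<forall>i\<le>N. \<exists>m. mean (K i) m \<and> (\<forall>h\<in>K i. \<forall>u. bounded_fun (K i) u \<longrightarrow>
          m (\<lambda>x. u (h \<otimes>\<^bsub>U e\<^esub> x)) = m u)) \<and>
       (\<forall>i<N. \<forall>x\<in>K (Suc i). \<exists>y\<in>K i. rank_metric R \<rho> x y \<le> 1 / N)"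
      by (intro exI[of _ "\<lambda>i. carrier (U (f i))"] conjI allI impI ballI f(4-6))
        (simp_all only: f(2,3) T.unipotent_simps(3) T_simps)
  qed
  then have "\<exists>x\<in>topspace X. \<forall>g\<in>carrier (U e). \<alpha> g x = x"
    if "compact_action (U e) B.M.mtopology X \<alpha>" for X :: "'x topology" and \<alpha>
    using B.amenable_chains_fixed_point that by blast
  then show ?thesis
    unfolding extremely_amenable_def rank_topology_on_def using B.topological_group by blast
qed

lemma one_in_nest: "\<one> \<in> E"
proof (rule nest_memI[OF nest])
  show "\<one> \<in> idempotents R" by (simp add: idempotents_def)
  fix e assume "e \<in> E"
  then have "e \<in> carrier R" by (rule nest_carrier[OF nest])
  then show "idem_le R \<one> e \<or> idem_le R e \<one>" by (simp add: idem_le_def)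
qed

lemma one_plus_levitzki_eq: "one_plus_levitzki T = U \<one>"
proof -
  have "corner \<one> = levitzki_radical T" using levitzki_carrier_R by (auto simp: corner_def)
  then show ?thesis by (simp add: one_plus_levitzki_def T.unipotent_def)
qed

text \<open>A chain of \<open>N\<close> steps of diameter at most \<open>1 / N\<close> has length at
  most \<open>1 / sqrt N\<close>: the squares in the definition of the length favour many small
  steps.\<close>

lemma amenable_length_zero:
  "amenable_length (U \<one>) (rank_topology_on R \<rho> (carrier (U \<one>)))
    (rank_metric R \<rho>) = 0"
  (is "amenable_length ?G ?\<tau> _ = 0")
proof -
  note e = one_in_nest
  interpret B: biinvariant_metric_group ?G "rank_metric R \<rho>" by (rule unipotent_biinvariant[OF e])
  have le: "amenable_length ?G ?\<tau> (rank_metric R \<rho>) \<le> ennreal (1 / sqrt (Suc n))" for n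
  proof -
    define N where "N = Suc n"
    have N: "1 \<le> N" by (simp add: N_def)
    obtain f :: "nat \<Rightarrow> 'a" where f: "\<And>i. i \<le> N \<Longrightarrow> f i \<in> E"
      "carrier (U (f 0)) = {\<one>}" "f N = \<one>"
      "\<And>i. i \<le> N \<Longrightarrow> subgroup (carrier (U (f i))) ?G"
      "\<And>i. i < N \<Longrightarrow> carrier (U (f i)) \<subseteq> carrier (U (f (Suc i)))"
      "\<And>i x. i < N \<Longrightarrow> x \<in> carrier (U (f (Suc i))) \<Longrightarrow>
         \<exists>y\<in>carrier (U (f i)). rank_metric R \<rho> x y \<le> 1 / N"
      by (rule corner_chain[OF e N], rule that)
    define K where "K i = carrier (U (f i))" for i
    have "amenable_chain ?G ?\<tau> N K"
      unfolding amenable_chain_def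
    proof (intro conjI allI impI)
      show "K 0 = {\<one>\<^bsub>?G\<^esub>}" using f(2) by (simp add: K_def)
      show "K N = carrier ?G" using f(3) by (simp add: K_def)
    next
      fix i assume i: "i < N"
      show "K i \<subseteq> K (Suc i)"
        unfolding K_def by (rule f(5)[OF i])
    next
      fix i assume i: "i \<le> N"
      show "subgroup (K i) ?G" unfolding K_def by (rule f(4)[OF i])
      have KG: "K i \<subseteq> carrier ?G" using subgroup.subset[OF f(4)[OF i]] by (simp only: K_def)
      have 1: "?G\<lparr>carrier := K i\<rparr> = U (f i)" by (simp add: T.unipotent_def K_def)
      interpret S: Submetric "carrier ?G" "rank_metric R \<rho>" "K i"
        by unfold_locales (rule KG)
      \<comment> \<open>The relative topology is the metric topology of the restricted rank metric,
        so the extreme amenability of \<open>U (f i)\<close> as a group in its own right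
        applies.\<close>
      have 2: "subtopology ?\<tau> (K i) = rank_topology_on R \<rho> (carrier (U (f i)))"
        unfolding rank_topology_on_def using S.mtopology_submetric by (simp only: K_def)
      show "amenable TYPE('a set set) (?G\<lparr>carrier := K i\<rparr>) (subtopology ?\<tau> (K i))"
        unfolding 1 2 by (rule extremely_amenable_imp_amenable[OF corner_extremely_amenable[OF f(1)[OF i]]])
    qed
    then have "amenable_length ?G ?\<tau> (rank_metric R \<rho>) \<le> ennreal (chain_length ?G (rank_metric R \<rho>) N K)"
      unfolding amenable_length_def by (intro Inf_lower) blast
    also have "chain_length ?G (rank_metric R \<rho>) N K \<le> sqrt (N * (1 / N)\<^sup>2)"
      by (rule B.chain_length_le) (use f(4,6) in \<open>simp_all only: K_def\<close>)
    also have "N * (1 / N)\<^sup>2 = 1 / real N" using N by (simp add: power2_eq_square)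
    finally show ?thesis by (simp add: ennreal_leI real_sqrt_divide N_def)
  qed
  have "(\<lambda>n. ennreal (1 / sqrt (Suc n))) \<longlonglongrightarrow> ennreal 0"
    by (intro tendsto_ennrealI) real_asymp
  then have "amenable_length ?G ?\<tau> (rank_metric R \<rho>) \<le> ennreal 0"
    by (rule LIMSEQ_le_const) (use le in blast)
  then show ?thesis by simp
qed

end

theorem corollary11p11:
  fixes R :: "('a, 'm) ring_scheme" and \<rho> :: "'a \<Rightarrow> real" and E :: "'a set"
  defines "G \<equiv> one_plus_levitzki (nest_ring R E)"
  defines "\<tau> \<equiv> rank_topology_on R \<rho> (carrier G)"
  assumes "irreducible_ring R" and "continuous_ring R"
    and "rank_function R \<rho>"
    and "non_discrete_ring R \<rho>"
    and "maximal_nest R E"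
  shows "amenable_length G \<tau> (rank_metric R \<rho>) = 0 \<and>
         extremely_amenable TYPE('x) G \<tau>"
proof -
  interpret C: regular_continuous R
    using assms(4)
    by (auto simp: continuous_ring_def regular_ring_def regular_continuous_def regular_continuous_axioms_def
        von_neumann_regular_def von_neumann_regular_axioms_def)
  interpret nest_in_continuous_ring R \<rho> E
    by unfold_locales (use assms(3,5-7) C.irreducible_prime in auto)
  show ?thesis
    unfolding \<tau>_def G_def one_plus_levitzki_eq
    using amenable_length_zero corner_extremely_amenable[OF one_in_nest] by blast
qed

end
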